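(* Let $\theta$ be one of the $2\times 2$ real matrices in the list given in the context, and let $\Sigma_{G(\theta)}$ be a one-input linear control system on $G(\theta)$ with linear vector field $\mathcal{X}=(A,\xi)$ and left-invariant vector field $Y=(\alpha,\eta)$. Assume that $\Sigma_{G(\theta)}$ has nilrank two (i.e. $\det A\neq 0$) and satisfies the LARC. Let $G^0$ be the set of singularities of $\mathcal{X}$ and let $\pi:G(\theta)\to G^0\setminus G(\theta)$ be the canonical projection. Then $\Sigma_{G(\theta)}$ admits a unique control set with nonempty interior, $\mathcal{C}_{G(\theta)}$, and it is given by $$\mathcal{C}_{G(\theta)}=\pi^{-1}\left(\mathcal{C}_{G^0\setminus G(\theta)}\right),$$ where $\mathcal{C}_{G^0\setminus G(\theta)}$ is the control set with nonempty interior of the induced system $\Sigma_{G^0\setminus G(\theta)}$ on $G^0\setminus G(\theta)$ that contains the origin $\pi(e)$ in its closure. Moreover, if $$\widehat{\Omega}=\{u\in\mathrm{int}\,\Omega:\ \det(A-\alpha u\theta)\neq 0\}$$ and $I_0\subset\widehat{\Omega}$ is the connected component of $\widehat\Omega$ containing $0$, then: 1. if $\det A>0$ and $\mathrm{tr}(A-\alpha u\theta)>0$ for all $u\in I_0$, then $\mathcal{C}_{G(\theta)}$ is open; 2. if $\det A>0$ and $\mathrm{tr}(A-\alpha u\theta)<0$ for all $u\in I_0$, then $\mathcal{C}_{G(\theta)}$ is closed; 3. if $\det A>0$ and $\mathrm{tr}(A-\alpha u\theta)=0$ for some $u\in I_0$, then $\mathcal{C}_{G(\theta)}=G(\theta)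$.
   Context: **Groups.** $\theta$ is one of $\begin{pmatrix}1&1\\0&1\end{pmatrix}$; $\begin{pmatrix}1&0\\0&\gamma\end{pmatrix}$ with $|\gamma|\le 1$; $\begin{pmatrix}\gamma&-1\\1&\gamma\end{pmatrix}$ with $\gamma\in\mathbb{R}$. Put $\rho_t=e^{t\theta}$. $G(\theta)=\mathbb{R}\times_\rho\mathbb{R}^2$ is $\mathbb{R}\times\mathbb{R}^2$ with product $(t_1,v_1)(t_2,v_2)=(t_1+t_2,v_1+\rho_{t_1}v_2)$ and identity $e=(0,0)$. Put $\Lambda_t^\theta w=\int_0^t e^{s\theta}w\,ds$. **Linear control systems on $G(\theta)$.** A linear vector field $\mathcal{X}=(A,\xi)$, with $\xi\in\mathbb{R}^2$ and $A\in\mathfrak{gl}(2,\mathbb{R})$, $A\theta=\theta A$, is $\mathcal{X}(t,v)=(0,Av+\Lambda_t^\theta\xi)$; a left-invariant vector field $Y=(\alpha,\eta)\in\mathbb{R}\times\mathbb{R}^2$ is $Y(t,v)=(\alpha,\rho_t\eta)$. A one-input linear control system (LCS) $\Sigma_{G(\theta)}$ is $\dot g=\mathcal{X}(g)+uY(g)$, i.e. $\dot t=u\alpha$, $\dot v=Av+\Lambda_t^\theta\xi+u\rho_t\eta$, with $u\in\Omega=[u^-,u^+]$, $u^-<0<u^+$. The nilrank of $\Sigma_{G(\theta)}$ is the rank of $A$. **Control systems.** For a system $\dot x=f_0(x)+u f_1(x)$ on a manifold $M$, $\mathcal{U}$ is the set of piecewise constant functions $\mathbf{u}$ with values in $\Omega$,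 and $\phi(s,x,\mathbf{u})$ is the solution with $\phi(0,x,\mathbf{u})=x$ (defined for all $s\in\mathbb{R}$). $\mathcal{O}^+(x)=\{\phi(S,x,\mathbf{u}):S>0,\mathbf{u}\in\mathcal{U}\}$. The system satisfies the Lie algebra rank condition (LARC) if the smallest Lie algebra of vector fields containing $f_0,f_1$ spans $T_xM$ at every $x\in M$. (For $\Sigma_{G(\theta)}$: equivalently, $\alpha\ne0$ and $w=\alpha\xi+A\eta$ is nonzero and not a common eigenvector of $A$ and $\theta$.) A subset $D\subset M$ is a control set if (i) for every $x\in D$ there is $\mathbf{u}\in\mathcal{U}$ with $\phi(\mathbb{R}^+,x,\mathbf{u})\subset D$; (ii) $D\subset\overline{\mathcal{O}^+(x)}$ for every $x\in D$; (iii) $D$ is maximal with respect to (i) and (ii). **Induced system.** $H\setminus G$ denotes the space of cosets $Hg$ and $\pi(g)=Hg$. If the closed subgroup $H$ is invariant under the flow of $\mathcal{X}$ (as is $G^0=\{g:\mathcal{X}(g)=0\}$), the induced system $\Sigma_{H\setminus G}$ is the control-affine system on $H\setminus G$ whose vector fields are the $\pi$-projections of $\mathcal{X}$ and $Y$. *)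

theory Defs
  imports "HOL-Analysis.Analysis" "HOL-Algebra.Coset"
begin

type_synonym plane = "real^2"
type_synonym point = "real \<times> (real^2)"

definition admissible_theta :: "real^2^2 \<Rightarrow> bool" where
  "admissible_theta \<theta> \<longleftrightarrow>
     \<theta> = vector [vector [1, 1], vector [0, 1]] \<or>
     (\<exists>\<gamma>. \<bar>\<gamma>\<bar> \<le> 1 \<and> \<theta> = vector [vector [1, 0], vector [0, \<gamma>]]) \<or>
     (\<exists>\<gamma>. \<theta> = vector [vector [\<gamma>, - 1], vector [1, \<gamma>]])"

text \<open>The product of the type \<^typ>\<open>real^2^2\<close> is componentwise, so the library's \<^const>\<open>exp\<close> and
  \<^const>\<open>power\<close> cannot be used for matrices. The \<open>n\<close>-th matrix power is written as an iterate of
  \<open>(**)\<close>.\<close>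

definition mat_exp :: "real^'n^'n \<Rightarrow> real^'n^'n" where
  "mat_exp M = (\<Sum>n. (1 / fact n) *\<^sub>R (((**) M) ^^ n) (mat 1))"

definition rho :: "real^2^2 \<Rightarrow> real \<Rightarrow> real^2^2" where
  "rho \<theta> t = mat_exp (t *\<^sub>R \<theta>)"

text \<open>The interval integral is oriented: it changes sign when \<open>t < 0\<close>.\<close>

definition Lam :: "real^2^2 \<Rightarrow> real \<Rightarrow> plane \<Rightarrow> plane" where
  "Lam \<theta> t w = (LBINT s=0..t. rho \<theta> s *v w)"

definition G :: "real^2^2 \<Rightarrow> point monoid" where
  "G \<theta> = \<lparr>carrier = UNIV,
          mult = (\<lambda>(t1, v1) (t2, v2). (t1 + t2, v1 + rho \<theta> t1 *v v2)),
          one = (0, 0)\<rparr>"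

definition linear_vf :: "real^2^2 \<Rightarrow> real^2^2 \<Rightarrow> plane \<Rightarrow> point \<Rightarrow> point" where
  "linear_vf \<theta> A \<xi> = (\<lambda>(t, v). (0, A *v v + Lam \<theta> t \<xi>))"

definition left_inv_vf :: "real^2^2 \<Rightarrow> real \<Rightarrow> plane \<Rightarrow> point \<Rightarrow> point" where
  "left_inv_vf \<theta> \<alpha> \<eta> = (\<lambda>(t, v). (\<alpha>, rho \<theta> t *v \<eta>))"

definition nilrank :: "real^2^2 \<Rightarrow> nat" where
  "nilrank A = rank A"

definition locally_constant_at :: "(real \<Rightarrow> real) \<Rightarrow> real \<Rightarrow> bool" where
  "locally_constant_at u s \<longleftrightarrow> (\<forall>\<^sub>F r in nhds s. u r = u s)"

text \<open>Piecewise constant functions on the whole line: finitely many switching times in every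
  bounded interval, arbitrary values in the control range at the switching times.\<close>

definition controls :: "real set \<Rightarrow> (real \<Rightarrow> real) set" where
  "controls \<Omega> = {u. range u \<subseteq> \<Omega> \<and> (\<forall>a b. finite {s \<in> {a..b}. \<not> locally_constant_at u s})}"

text \<open>The notions below are used both for a system on \<open>G(\<theta>)\<close> and for a system on a space of
  cosets. A system enters through the topology \<open>T\<close> of its state space and through the predicate
  \<open>sol\<close>, where \<open>sol u c\<close> means that the curve \<open>c\<close>, defined for all times, is a solution
  for the control \<open>u\<close>; thus \<open>c = \<phi>(\<cdot>, c 0, u)\<close>.\<close>

definition positive_orbit ::
  "real set \<Rightarrow> ((real \<Rightarrow> real) \<Rightarrow> (real \<Rightarrow> 'a) \<Rightarrow> bool) \<Rightarrow> 'a \<Rightarrow> 'a set" where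
  "positive_orbit \<Omega> sol x = {c S | c S u. S > 0 \<and> u \<in> controls \<Omega> \<and> sol u c \<and> c 0 = x}"

definition pre_control_set ::
  "'a topology \<Rightarrow> real set \<Rightarrow> ((real \<Rightarrow> real) \<Rightarrow> (real \<Rightarrow> 'a) \<Rightarrow> bool) \<Rightarrow> 'a set \<Rightarrow> bool" where
  "pre_control_set T \<Omega> sol D \<longleftrightarrow>
     D \<subseteq> topspace T \<and>
     (\<forall>x\<in>D. \<exists>u\<in>controls \<Omega>. \<exists>c. sol u c \<and> c 0 = x \<and> c ` {0..} \<subseteq> D) \<and>
     (\<forall>x\<in>D. D \<subseteq> T closure_of (positive_orbit \<Omega> sol x))"

definition control_set ::
  "'a topology \<Rightarrow> real set \<Rightarrow> ((real \<Rightarrow> real) \<Rightarrow> (real \<Rightarrow> 'a) \<Rightarrow> bool) \<Rightarrow> 'a set \<Rightarrow> bool" where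
  "control_set T \<Omega> sol D \<longleftrightarrow>
     pre_control_set T \<Omega> sol D \<and>
     (\<forall>D'. pre_control_set T \<Omega> sol D' \<and> D \<subseteq> D' \<longrightarrow> D' = D)"

text \<open>For a piecewise constant control, a solution is a continuous curve that satisfies the
  differential equation at every time that is not a switching time.\<close>

definition vf_solution ::
  "('a::real_normed_vector \<Rightarrow> 'a) \<Rightarrow> ('a \<Rightarrow> 'a) \<Rightarrow> (real \<Rightarrow> real) \<Rightarrow> (real \<Rightarrow> 'a) \<Rightarrow> bool" where
  "vf_solution f0 f1 u c \<longleftrightarrow>
     continuous_on UNIV c \<and>
     (\<forall>s. locally_constant_at u s \<longrightarrow>
        (c has_vector_derivative (f0 (c s) + u s *\<^sub>R f1 (c s))) (at s))"

definition lie_bracket ::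
  "('a::real_normed_vector \<Rightarrow> 'a) \<Rightarrow> ('a \<Rightarrow> 'a) \<Rightarrow> 'a \<Rightarrow> 'a" where
  "lie_bracket f g = (\<lambda>x. frechet_derivative g (at x) (f x) - frechet_derivative f (at x) (g x))"

inductive_set lie_generated ::
  "('a::real_normed_vector \<Rightarrow> 'a) set \<Rightarrow> ('a \<Rightarrow> 'a) set" for S where
  base: "f \<in> S \<Longrightarrow> f \<in> lie_generated S"
| add: "f \<in> lie_generated S \<Longrightarrow> g \<in> lie_generated S \<Longrightarrow> (\<lambda>x. f x + g x) \<in> lie_generated S"
| scale: "f \<in> lie_generated S \<Longrightarrow> (\<lambda>x. c *\<^sub>R f x) \<in> lie_generated S"
| bracket: "f \<in> lie_generated S \<Longrightarrow> g \<in> lie_generated S \<Longrightarrow> lie_bracket f g \<in> lie_generated S"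

definition LARC :: "('a::real_normed_vector \<Rightarrow> 'a) \<Rightarrow> ('a \<Rightarrow> 'a) \<Rightarrow> bool" where
  "LARC f0 f1 \<longleftrightarrow> (\<forall>x. span ((\<lambda>f. f x) ` lie_generated {f0, f1}) = UNIV)"

definition coset_proj :: "real^2^2 \<Rightarrow> point set \<Rightarrow> point \<Rightarrow> point set" where
  "coset_proj \<theta> H g = H #>\<^bsub>G \<theta>\<^esub> g"

definition coset_topology :: "real^2^2 \<Rightarrow> point set \<Rightarrow> point set topology" where
  "coset_topology \<theta> H =
     topology (\<lambda>U. U \<subseteq> rcosets\<^bsub>G \<theta>\<^esub> H \<and> open (coset_proj \<theta> H -` U))"

text \<open>The manifold structure of \<open>H\G\<close> is the one for which \<open>\<pi>\<close> is a submersion: a function \<open>f\<close>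
  on \<open>H\G\<close> is differentiable iff \<open>f \<circ> \<pi>\<close> is. The \<open>\<pi>\<close>-projection of a vector field \<open>Z\<close> acts
  on such an \<open>f\<close> by \<open>(\<pi>\<^sub>*Z) f (\<pi> g) = d(f \<circ> \<pi>)\<^sub>g (Z g)\<close>, for every representative \<open>g\<close> of the coset,
  and \<open>c\<close> is an integral curve iff the derivative of \<open>f \<circ> c\<close> is \<open>(\<pi>\<^sub>*Z) f \<circ> c\<close> for all such \<open>f\<close>.\<close>

definition induced_solution ::
  "real^2^2 \<Rightarrow> point set \<Rightarrow> (point \<Rightarrow> point) \<Rightarrow> (point \<Rightarrow> point) \<Rightarrow>
   (real \<Rightarrow> real) \<Rightarrow> (real \<Rightarrow> point set) \<Rightarrow> bool" where
  "induced_solution \<theta> H f0 f1 u c \<longleftrightarrow>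
     continuous_map euclideanreal (coset_topology \<theta> H) c \<and>
     (\<forall>s. locally_constant_at u s \<longrightarrow>
        (\<forall>f :: point set \<Rightarrow> real. (\<forall>g. (f \<circ> coset_proj \<theta> H) differentiable (at g)) \<longrightarrow>
          (\<forall>g. coset_proj \<theta> H g = c s \<longrightarrow>
            ((f \<circ> c) has_real_derivative
               frechet_derivative (f \<circ> coset_proj \<theta> H) (at g) (f0 g + u s *\<^sub>R f1 g)) (at s))))"

lemma openin_coset_topology:
  "openin (coset_topology \<theta> H) U \<longleftrightarrow> U \<subseteq> rcosets\<^bsub>G \<theta>\<^esub> H \<and> open (coset_proj \<theta> H -` U)"
proof -
  have "istopology (\<lambda>U. U \<subseteq> rcosets\<^bsub>G \<theta>\<^esub> H \<and> open (coset_proj \<theta> H -` U))"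
    unfolding istopology_def by (auto simp: vimage_Union intro!: open_Int)
  then show ?thesis
    by (simp add: coset_topology_def topology_inverse')
qed

lemma topspace_coset_topology: "topspace (coset_topology \<theta> H) = rcosets\<^bsub>G \<theta>\<^esub> H"
proof -
  have "coset_proj \<theta> H -` (rcosets\<^bsub>G \<theta>\<^esub> H) = UNIV"
    by (auto simp: coset_proj_def RCOSETS_def G_def)
  then have "openin (coset_topology \<theta> H) (rcosets\<^bsub>G \<theta>\<^esub> H)"
    by (simp add: openin_coset_topology)
  then show ?thesis
    by (meson openin_coset_topology openin_subset openin_topspace subset_antisym)
qed

end

theory Submission
  imports Defs "HOL-Real_Asymp.Real_Asymp"
begin

text \<open>
  Choose \<open>\<zeta>\<close> with \<open>A \<zeta> = \<xi>\<close>. In the coordinates \<open>(t, x)\<close> with \<open>x = \<rho>\<^sub>-\<^sub>t (v + \<Lambda>\<^sub>t \<zeta>)\<close> the system reads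
  \<open>t' = \<alpha> u\<close>, \<open>x' = (A - u B) x + u b\<close> with \<open>B = \<alpha> \<theta>\<close> and \<open>b = \<eta> + \<alpha> \<zeta>\<close>. The singularities of the linear
  vector field are the points with \<open>x = 0\<close> and the cosets are the fibres of \<open>x\<close>, so the induced system is
  the planar equation for \<open>x\<close>, and the full system only adds the drift \<open>\<tau> = \<integral>u\<close> to it. Since \<open>A\<close> and \<open>B\<close>
  commute, a control of duration \<open>S\<close> and drift \<open>\<tau>\<close> acts on the plane as an affine map whose linear part
  \<open>exp (S A - \<tau> B)\<close> depends on \<open>S\<close> and \<open>\<tau>\<close> only. The rank condition forces \<open>\<alpha> \<noteq> 0\<close> and makes \<open>b\<close> a
  cyclic vector of \<open>A\<close> or of \<open>B\<close>.

  \<^emph>\<open>Existence.\<close> If \<open>b\<close> is no eigenvector of \<open>A - u B\<close>, the linearisation at the equilibrium \<open>x(u)\<close> of the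
  constant control \<open>u\<close> is controllable, and \<open>x(u)\<close> is a hub: it reaches, and is reached from, each point of
  a ball (\<open>eqpt_hub\<close>). The excluded case at \<open>u = 0\<close> means that \<open>A\<close> is a scalar matrix; then the \<open>x(u)\<close> with
  small \<open>u \<noteq> 0\<close> are hubs and attract or repel the whole plane. So all \<open>x(u)\<close> with small \<open>u \<noteq> 0\<close> lie in
  one control set, called \<open>region\<close>. Waiting at \<open>x(v)\<close> and at \<open>x(-v)\<close> produces any prescribed drift, so
  \<open>\<real> \<times> region\<close> is a control set of the full system (\<open>control_set_lifted_region\<close>).

  \<^emph>\<open>Uniqueness in the group.\<close> A control set with an interior point has loops of the planar system with
  large duration and small drift, because it returns close to its first coordinate \<open>t\<close>. Unless \<open>A\<close> is
  a centre, their return maps and those of the loops at \<open>x(u)\<close> are hyperbolic with a common splitting, and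
  two such maps have orbits that run from near one fixed point to near the other (\<open>loops_connected\<close>).

  \<^emph>\<open>Uniqueness in the quotient.\<close> Here loops can have a large drift, and uniqueness needs that \<open>0\<close> lies in
  the closure. If \<open>0\<close> is a hub this is immediate. Otherwise \<open>A = l I\<close>, and the affine functions
  \<open>1 - \<beta> \<ell>(x)\<close>, with \<open>\<ell> B = \<beta> \<ell>\<close> and \<open>\<ell>(b) = 1\<close>, are monotone along trajectories up to an exponential
  factor (\<open>left_eigen_monotone\<close>). They are positive near \<open>0\<close>, and a loop through a point where they are positive
  must contract if \<open>l < 0\<close> and expand if \<open>l > 0\<close>; iterating it leads to \<open>region\<close>.

  \<^emph>\<open>The three cases.\<close> If \<open>A\<close> is stable, all points reach the hub, so \<open>region\<close> is the closure of an
  orbit; if \<open>-A\<close> is stable, the hub reaches all points, so \<open>region\<close> is the open set of points that reach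
  it. If \<open>A - u B\<close> is a centre for some \<open>u\<close>, nearby controls give spirals inwards and outwards around
  nearby points, or rotations about distinct points, which generate all translations; either way the
  plane is controllable (\<open>reaches_all\<close>).
\<close>

section \<open>Planar linear algebra and the matrix exponential\<close>

definition wedge :: "plane \<Rightarrow> plane \<Rightarrow> real" where
  "wedge x y = x $ 1 * y $ 2 - x $ 2 * y $ 1"

lemma wedge_simps:
  "wedge (x + y) z = wedge x z + wedge y z"
  "wedge x (y + z) = wedge x y + wedge x z"
  "wedge (x - y) z = wedge x z - wedge y z"
  "wedge x (y - z) = wedge x y - wedge x z"
  "wedge (c *\<^sub>R x) y = c * wedge x y"
  "wedge x (c *\<^sub>R y) = c * wedge x y"
  "wedge x x = 0" "wedge 0 x = 0" "wedge x 0 = 0"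
  by (auto simp: wedge_def algebra_simps)

lemma plane_matrix_components:
  fixes M N :: "real^2^2" and x y :: plane
  shows "(M *v x) $ 1 = M $ 1 $ 1 * x $ 1 + M $ 1 $ 2 * x $ 2"
    "(M *v x) $ 2 = M $ 2 $ 1 * x $ 1 + M $ 2 $ 2 * x $ 2"
    "trace M = M $ 1 $ 1 + M $ 2 $ 2"
    "(M ** N) $ i $ j = M $ i $ 1 * N $ 1 $ j + M $ i $ 2 * N $ 2 $ j"
    "x = y \<longleftrightarrow> x $ 1 = y $ 1 \<and> x $ 2 = y $ 2"
    "M = N \<longleftrightarrow> M $ 1 $ 1 = N $ 1 $ 1 \<and> M $ 1 $ 2 = N $ 1 $ 2 \<and> M $ 2 $ 1 = N $ 2 $ 1 \<and> M $ 2 $ 2 = N $ 2 $ 2"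
    "(mat c :: real^2^2) $ 1 $ 1 = c" "(mat c :: real^2^2) $ 1 $ 2 = 0"
    "(mat c :: real^2^2) $ 2 $ 1 = 0" "(mat c :: real^2^2) $ 2 $ 2 = c"
  by (auto simp: matrix_vector_mult_def matrix_matrix_mult_def trace_def sum_2 vec_eq_iff forall_2 mat_def)

lemma wedge_matrix: "wedge (M *v x) (M *v y) = det M * wedge x y"
  by (simp add: wedge_def det_2 plane_matrix_components algebra_simps)

lemma cayley_hamilton_plane:
  fixes M :: "real^2^2"
  shows "M *v (M *v x) = trace M *\<^sub>R (M *v x) - det M *\<^sub>R x"
  by (simp add: det_2 plane_matrix_components algebra_simps)

lemma wedge_eq_0_imp_multiple:
  assumes "wedge x y = 0" "x \<noteq> 0"
  obtains c where "y = c *\<^sub>R x"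
proof -
  have "x $ 1 \<noteq> 0 \<or> x $ 2 \<noteq> 0" using assms(2) by (auto simp: plane_matrix_components)
  then show thesis
  proof
    assume "x $ 1 \<noteq> 0"
    then have "y = (y $ 1 / x $ 1) *\<^sub>R x"
      using assms(1) by (auto simp: plane_matrix_components wedge_def field_simps)
    then show thesis by (rule that)
  next
    assume "x $ 2 \<noteq> 0"
    then have "y = (y $ 2 / x $ 2) *\<^sub>R x"
      using assms(1) by (auto simp: plane_matrix_components wedge_def field_simps)
    then show thesis by (rule that)
  qed
qed

text \<open>Cramer's rule.\<close>
lemma wedge_expand:
  assumes "wedge x y \<noteq> 0"
  shows "z = (wedge z y / wedge x y) *\<^sub>R x + (wedge x z / wedge x y) *\<^sub>R y"
proof -
  have "wedge x y *\<^sub>R z = wedge z y *\<^sub>R x + wedge x z *\<^sub>R y"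
    by (simp add: wedge_def plane_matrix_components algebra_simps)
  then have "z = (1 / wedge x y) *\<^sub>R (wedge z y *\<^sub>R x + wedge x z *\<^sub>R y)"
    using assms by (metis divideR_right divide_inverse scaleR_one scaleR_scaleR mult_1)
  then show ?thesis by (simp add: scaleR_add_right)
qed

lemma wedge_tendsto [tendsto_intros]:
  "(f \<longlongrightarrow> x) F \<Longrightarrow> (g \<longlongrightarrow> y) F \<Longrightarrow> ((\<lambda>t. wedge (f t) (g t)) \<longlongrightarrow> wedge x y) F"
  unfolding wedge_def by (intro tendsto_intros)

lemma norm_matrix_vector_mult_le:
  fixes M :: "real^'n^'m"
  shows "norm (M *v x) \<le> norm M * norm x"
proof -
  have "norm (M *v x) = L2_set (\<lambda>i. norm ((M *v x) $ i)) UNIV" by (simp add: norm_vec_def)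
  also have "\<dots> \<le> L2_set (\<lambda>i. norm (M $ i) * norm x) UNIV"
    by (rule L2_set_mono) (auto simp: matrix_vector_mul_component Cauchy_Schwarz_ineq2)
  also have "\<dots> = norm M * norm x"
    by (simp add: L2_set_left_distrib norm_vec_def)
  finally show ?thesis .
qed

lemma bounded_bilinear_matrix_vector_mult:
  "bounded_bilinear ((*v) :: real^'n^'m \<Rightarrow> real^'n \<Rightarrow> real^'m)"
  by (unfold_locales)
    (auto simp: matrix_vector_mult_add_rdistrib matrix_vector_right_distrib scaleR_matrix_vector_assoc[symmetric]
      matrix_vector_mult_scaleR norm_matrix_vector_mult_le intro!: exI[of _ 1])

lemma bounded_bilinear_matrix_matrix_mult:
  "bounded_bilinear ((**) :: real^'n^'m \<Rightarrow> real^'k^'n \<Rightarrow> real^'k^'m)"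
proof
  fix M :: "real^'n^'m" and N N' :: "real^'k^'n" and M' :: "real^'n^'m" and r :: real
  show "(M + M') ** N = M ** N + M' ** N" by (simp add: matrix_matrix_mult_def vec_eq_iff algebra_simps sum.distrib)
  show "M ** (N + N') = M ** N + M ** N'" by (rule matrix_add_ldistrib)
  show "(r *\<^sub>R M) ** N = r *\<^sub>R (M ** N)" by (simp add: matrix_matrix_mult_def vec_eq_iff sum_distrib_left algebra_simps)
  show "M ** (r *\<^sub>R N) = r *\<^sub>R (M ** N)" by (simp add: matrix_matrix_mult_def vec_eq_iff sum_distrib_left algebra_simps)
next
  have "norm (M ** N) \<le> norm M * norm N * real CARD('m)" for M :: "real^'n^'m" and N :: "real^'k^'n"
  proof -
    have row: "(M ** N) $ i = transpose N *v (M $ i)" for i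
      by (simp add: vec_eq_iff matrix_matrix_mult_def matrix_vector_mult_def transpose_def mult.commute)
    have tr: "norm (transpose N) = norm N"
    proof -
      have *: "norm P = sqrt (\<Sum>i\<in>UNIV. \<Sum>j\<in>UNIV. (P $ i $ j)\<^sup>2)" for P :: "real^'a^'b"
        by (simp add: norm_vec_def L2_set_def sum_nonneg)
      show ?thesis unfolding * transpose_def by (subst sum.swap) simp
    qed
    have "norm (M ** N) \<le> (\<Sum>i\<in>UNIV. norm ((M ** N) $ i))"
      by (simp add: norm_vec_def L2_set_le_sum)
    also have "\<dots> \<le> (\<Sum>i\<in>(UNIV::'m set). norm M * norm N)"
    proof (rule sum_mono)
      fix i
      have "norm ((M ** N) $ i) \<le> norm N * norm (M $ i)"
        using norm_matrix_vector_mult_le[of "transpose N" "M $ i"] by (simp add: row tr)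
      also have "\<dots> \<le> norm N * norm M" by (intro mult_left_mono Finite_Cartesian_Product.norm_nth_le) auto
      finally show "norm ((M ** N) $ i) \<le> norm M * norm N" by (simp add: mult.commute)
    qed
    finally show ?thesis by (simp add: mult.commute)
  qed
  then show "\<exists>K. \<forall>(M::real^'n^'m) (N::real^'k^'n). norm (M ** N) \<le> norm M * norm N * K" by blast
qed

interpretation mv: bounded_bilinear "(*v) :: real^'n^'m \<Rightarrow> real^'n \<Rightarrow> real^'m"
  by (rule bounded_bilinear_matrix_vector_mult)

interpretation mm: bounded_bilinear "(**) :: real^'n^'m \<Rightarrow> real^'k^'n \<Rightarrow> real^'k^'m"
  by (rule bounded_bilinear_matrix_matrix_mult)

abbreviation matpow :: "real^'n^'n \<Rightarrow> nat \<Rightarrow> real^'n^'n" where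
  "matpow M n \<equiv> (((**) M) ^^ n) (mat 1)"

lemma matpow_scaleR: "matpow (s *\<^sub>R M) n = s ^ n *\<^sub>R matpow M n"
  by (induction n) (auto simp: mm.scaleR_left mm.scaleR_right)

lemma matpow_commute:
  assumes "M ** N = N ** M"
  shows "N ** matpow M n = matpow M n ** N"
proof (induction n)
  case (Suc n)
  have "N ** (M ** matpow M n) = M ** (N ** matpow M n)"
    by (metis assms matrix_mul_assoc)
  then show ?case using Suc by (simp add: matrix_mul_assoc)
qed simp

text \<open>The growth bound that makes the exponential series converge; submultiplicativity of the norm up to a
  constant suffices.\<close>
lemma matpow_norm_le:
  fixes M :: "real^'n^'n"
  shows "\<exists>c K. \<forall>n. norm (matpow M n) \<le> K * c ^ n"
proof -
  obtain c where c: "norm (M ** N) \<le> norm N * c" for N :: "real^'n^'n"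
    using bounded_linear.bounded[OF mm.bounded_linear_right] by metis
  have "norm (matpow M n) \<le> norm (mat 1 :: real^'n^'n) * \<bar>c\<bar> ^ n" for n
  proof (induction n)
    case (Suc n)
    have "norm (matpow M (Suc n)) \<le> norm (matpow M n) * \<bar>c\<bar>"
      using c[of "matpow M n"] by simp (meson abs_ge_self mult_left_mono norm_ge_zero order_trans)
    also have "\<dots> \<le> norm (mat 1 :: real^'n^'n) * \<bar>c\<bar> ^ n * \<bar>c\<bar>"
      by (intro mult_right_mono Suc) auto
    finally show ?case by (simp add: mult_ac)
  qed simp
  then show ?thesis by blast
qed

lemma summable_mat_exp: "summable (\<lambda>n. (1 / fact n) *\<^sub>R matpow M n)"
proof -
  obtain c K where cK: "\<And>n. norm (matpow M n) \<le> K * c ^ n" using matpow_norm_le by blast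
  have "summable (\<lambda>n. K * (inverse (fact n) * c ^ n))"
    by (intro summable_mult summable_exp)
  then show ?thesis
  proof (rule summable_comparison_test'[where N=0])
    fix n :: nat
    show "norm ((1 / fact n) *\<^sub>R matpow M n) \<le> K * (inverse (fact n) * c ^ n)"
      using mult_left_mono[OF cK[of n], of "inverse (fact n)"] by (simp add: divide_inverse mult_ac)
  qed
qed

lemma mat_exp_0 [simp]: "mat_exp 0 = mat 1"
proof -
  have "matpow (0::real^'n^'n) n = (if n = 0 then mat 1 else 0)" for n by (cases n) auto
  then have "mat_exp (0::real^'n^'n) = (\<Sum>n. if n = 0 then mat 1 else 0)"
    unfolding mat_exp_def by (metis (no_types, lifting) div_by_1 fact_0 scaleR_one scaleR_zero_right)
  also have "\<dots> = mat 1" using suminf_finite[of "{0}" "\<lambda>n. if n = 0 then mat 1 else (0::real^'n^'n)"] by simp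
  finally show ?thesis .
qed

lemma mat_exp_commute:
  assumes "M ** N = N ** M"
  shows "N ** mat_exp M = mat_exp M ** N"
  unfolding mat_exp_def
  by (simp add: bounded_linear.suminf[OF mm.bounded_linear_right summable_mat_exp]
      bounded_linear.suminf[OF mm.bounded_linear_left summable_mat_exp]
      mm.scaleR_left mm.scaleR_right matpow_commute[OF assms])

lemma has_vector_derivative_matI:
  assumes "\<And>i j. ((\<lambda>t. f t $ i $ j) has_real_derivative f' $ i $ j) (at s)"
  shows "((f :: real \<Rightarrow> real^'n^'m) has_vector_derivative f') (at s)"
  unfolding has_vector_derivative_def
proof (subst has_derivative_componentwise_within, intro ballI)
  fix e :: "real^'n^'m" assume "e \<in> Basis"
  then obtain i j where e: "e = axis i (axis j 1)" by (auto simp: Basis_vec_def)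
  show "((\<lambda>t. f t \<bullet> e) has_derivative (\<lambda>h. h *\<^sub>R f' \<bullet> e)) (at s)"
    using assms[of i j] by (simp add: e inner_axis has_field_derivative_def mult_commute_abs)
qed

text \<open>Each entry of \<open>s \<mapsto> mat_exp (s M)\<close> is a scalar power series, so that the theory of real power series
  gives the derivative.\<close>
lemma
  fixes M :: "real^'n^'n"
  shows mat_exp_entry: "mat_exp (s *\<^sub>R M) $ i $ j = (\<Sum>n. (matpow M n $ i $ j / fact n) * s ^ n)"
  and summable_mat_exp_entry: "summable (\<lambda>n. (matpow M n $ i $ j / fact n) * s ^ n)"
proof -
  let ?f = "\<lambda>n. (1 / fact n) *\<^sub>R matpow (s *\<^sub>R M) n"
  have bl: "bounded_linear (\<lambda>P::real^'n^'n. P $ i $ j)"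
    by (rule bounded_linear_compose[OF bounded_linear_vec_nth bounded_linear_vec_nth])
  have eq: "?f n $ i $ j = (matpow M n $ i $ j / fact n) * s ^ n" for n
    by (simp add: matpow_scaleR)
  show "mat_exp (s *\<^sub>R M) $ i $ j = (\<Sum>n. (matpow M n $ i $ j / fact n) * s ^ n)"
    unfolding mat_exp_def bounded_linear.suminf[OF bl summable_mat_exp] eq ..
  show "summable (\<lambda>n. (matpow M n $ i $ j / fact n) * s ^ n)"
    using bounded_linear.summable[OF bl summable_mat_exp[of "s *\<^sub>R M"]] by (simp only: eq)
qed

lemma mat_exp_has_vector_derivative:
  "((\<lambda>s. mat_exp (s *\<^sub>R M)) has_vector_derivative M ** mat_exp (s *\<^sub>R M)) (at s)"
proof (rule has_vector_derivative_matI)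
  fix i j
  let ?c = "\<lambda>k n. matpow M n $ k $ j / fact n"
  have diffs: "diffs (?c i) n = (\<Sum>k\<in>UNIV. M $ i $ k * ?c k n)" for n
  proof -
    have "diffs (?c i) n = matpow M (Suc n) $ i $ j / fact n"
      unfolding diffs_def fact_Suc by (simp del: funpow.simps of_nat_Suc)
    also have "\<dots> = (\<Sum>k\<in>UNIV. M $ i $ k * ?c k n)"
      by (simp add: matrix_matrix_mult_def sum_divide_distrib)
    finally show ?thesis .
  qed
  have "(\<Sum>n. diffs (?c i) n * s ^ n) = (\<Sum>n. \<Sum>k\<in>UNIV. M $ i $ k * (?c k n * s ^ n))"
    by (simp add: diffs sum_distrib_left sum_distrib_right mult_ac)
  also have "\<dots> = (\<Sum>k\<in>UNIV. \<Sum>n. M $ i $ k * (?c k n * s ^ n))"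
    by (rule suminf_sum) (intro summable_mult summable_mat_exp_entry)
  also have "\<dots> = (M ** mat_exp (s *\<^sub>R M)) $ i $ j"
    by (simp only: matrix_matrix_mult_def mat_exp_entry vec_lambda_beta suminf_mult[OF summable_mat_exp_entry])
  finally have "(\<Sum>n. diffs (?c i) n * s ^ n) = (M ** mat_exp (s *\<^sub>R M)) $ i $ j" .
  moreover have "((\<lambda>s. \<Sum>n. ?c i n * s ^ n) has_field_derivative (\<Sum>n. diffs (?c i) n * s ^ n)) (at s)"
    by (rule termdiffs_strong_converges_everywhere) (rule summable_mat_exp_entry)
  ultimately show "((\<lambda>s. mat_exp (s *\<^sub>R M) $ i $ j) has_real_derivative (M ** mat_exp (s *\<^sub>R M)) $ i $ j) (at s)"
    by (simp add: mat_exp_entry)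
qed

lemma constant_if_vector_derivative_0:
  fixes f :: "real \<Rightarrow> 'a::real_normed_vector"
  assumes "\<And>s. (f has_vector_derivative 0) (at s)"
  shows "f s = f r"
proof -
  have "f constant_on UNIV"
    by (rule has_vector_derivative_zero_constant[of UNIV f, simplified constant_on_def[symmetric]])
       (use assms in \<open>auto simp: constant_on_def\<close>)
  then show ?thesis unfolding constant_on_def by auto
qed

lemma mat_exp_minus_left: "mat_exp (- M) ** mat_exp M = mat 1"
proof -
  let ?f = "\<lambda>s. mat_exp ((- s) *\<^sub>R M) ** mat_exp (s *\<^sub>R M)"
  have minus: "((\<lambda>s. mat_exp ((- s) *\<^sub>R M)) has_vector_derivative (- (M ** mat_exp ((- s) *\<^sub>R M)))) (at s)" for s
    using mat_exp_has_vector_derivative[of "- M" s] by (simp add: mm.minus_left)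
  have "(?f has_vector_derivative 0) (at s)" for s
  proof -
    have "mat_exp ((- s) *\<^sub>R M) ** (M ** mat_exp (s *\<^sub>R M)) = M ** mat_exp ((- s) *\<^sub>R M) ** mat_exp (s *\<^sub>R M)"
      by (metis matrix_mul_assoc mat_exp_commute mm.scaleR_left mm.scaleR_right)
    then show ?thesis
      using mm.has_vector_derivative[OF minus[of s] mat_exp_has_vector_derivative[of M s]]
      by (simp add: mm.minus_left)
  qed
  from constant_if_vector_derivative_0[of ?f, OF this, of 1 0] show ?thesis by simp
qed

text \<open>Multiplying by the inverse \<open>mat_exp (- s M)\<close> turns a solution into a constant curve. The functional equation
  of the exponential follows by comparing the solutions of one linear equation.\<close>
lemma mat_exp_ode_unique:
  assumes "\<And>s. (Z has_vector_derivative M ** Z s) (at s)"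
  shows "Z s = mat_exp (s *\<^sub>R M) ** Z 0"
proof -
  let ?f = "\<lambda>s. mat_exp ((- s) *\<^sub>R M) ** Z s"
  have minus: "((\<lambda>s. mat_exp ((- s) *\<^sub>R M)) has_vector_derivative (- (M ** mat_exp ((- s) *\<^sub>R M)))) (at s)" for s
    using mat_exp_has_vector_derivative[of "- M" s] by (simp add: mm.minus_left)
  have "(?f has_vector_derivative 0) (at s)" for s
  proof -
    have "mat_exp ((- s) *\<^sub>R M) ** (M ** Z s) = M ** mat_exp ((- s) *\<^sub>R M) ** Z s"
      by (metis matrix_mul_assoc mat_exp_commute mm.scaleR_left mm.scaleR_right)
    then show ?thesis
      using mm.has_vector_derivative[OF minus[of s] assms[of s]]
      by (simp add: mm.minus_left)
  qed
  from constant_if_vector_derivative_0[of ?f, OF this, of s 0]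
  have eq: "mat_exp (- (s *\<^sub>R M)) ** Z s = Z 0" by simp
  have "Z s = mat_exp (s *\<^sub>R M) ** (mat_exp (- (s *\<^sub>R M)) ** Z s)"
    using mat_exp_minus_left[of "- (s *\<^sub>R M)"] by (simp add: matrix_mul_assoc)
  then show ?thesis by (simp only: eq)
qed

lemma mat_exp_add:
  assumes "M ** N = N ** M"
  shows "mat_exp (M + N) = mat_exp M ** mat_exp N"
proof -
  let ?Z = "\<lambda>s. mat_exp (s *\<^sub>R M) ** mat_exp (s *\<^sub>R N)"
  have "(?Z has_vector_derivative (M + N) ** ?Z s) (at s)" for s
  proof -
    have "mat_exp (s *\<^sub>R M) ** (N ** mat_exp (s *\<^sub>R N)) = N ** mat_exp (s *\<^sub>R M) ** mat_exp (s *\<^sub>R N)"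
      by (metis assms matrix_mul_assoc mat_exp_commute mm.scaleR_left mm.scaleR_right)
    then show ?thesis
      using mm.has_vector_derivative[OF mat_exp_has_vector_derivative[of M s] mat_exp_has_vector_derivative[of N s]]
      by (simp add: mm.add_left matrix_mul_assoc add.commute)
  qed
  from mat_exp_ode_unique[of ?Z, OF this, of 1] show ?thesis by simp
qed

lemma mat_exp_minus_vector: "mat_exp (- M) *v (mat_exp M *v x) = x" "mat_exp M *v (mat_exp (- M) *v x) = x"
  using mat_exp_minus_left[of M] mat_exp_minus_left[of "- M"]
  by (simp_all add: matrix_vector_mul_assoc)

lemma mat_exp_eigenvector:
  assumes "M *v x = c *\<^sub>R x"
  shows "mat_exp (s *\<^sub>R M) *v x = exp (s * c) *\<^sub>R x"
proof -
  let ?f = "\<lambda>s. exp (- s * c) *\<^sub>R (mat_exp (s *\<^sub>R M) *v x)"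
  have "(?f has_vector_derivative 0) (at s)" for s
  proof -
    have e: "((\<lambda>s. exp (- s * c)) has_vector_derivative (- c * exp (- s * c))) (at s)"
      by (auto simp flip: has_real_derivative_iff_has_vector_derivative intro!: derivative_eq_intros)
    have "((\<lambda>s. mat_exp (s *\<^sub>R M) *v x) has_vector_derivative (M ** mat_exp (s *\<^sub>R M)) *v x) (at s)"
      using mv.has_vector_derivative[OF mat_exp_has_vector_derivative[of M s] has_vector_derivative_const[of x]] by simp
    moreover have "(M ** mat_exp (s *\<^sub>R M)) *v x = c *\<^sub>R (mat_exp (s *\<^sub>R M) *v x)"
      by (metis assms mat_exp_commute matrix_vector_mul_assoc matrix_vector_mult_scaleR mm.scaleR_left mm.scaleR_right)
    ultimately show ?thesis
      using bounded_bilinear.has_vector_derivative[OF bounded_bilinear_scaleR e, of "\<lambda>s. mat_exp (s *\<^sub>R M) *v x"]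
      by (fastforce simp: algebra_simps)
  qed
  from constant_if_vector_derivative_0[of ?f, OF this, of s 0]
  have "exp (- s * c) *\<^sub>R (mat_exp (s *\<^sub>R M) *v x) = x" by simp
  then have "exp (s * c) *\<^sub>R exp (- s * c) *\<^sub>R (mat_exp (s *\<^sub>R M) *v x) = exp (s * c) *\<^sub>R x" by simp
  then show ?thesis by (simp flip: exp_add)
qed

section \<open>Linear and affine equations with constant coefficients\<close>

lemma rho_has_vector_derivative: "((\<lambda>s. rho M s) has_vector_derivative M ** rho M s) (at s)"
  unfolding rho_def by (rule mat_exp_has_vector_derivative)

lemma rho_0 [simp]: "rho M 0 = mat 1"
  by (simp add: rho_def)

lemma rho_add: "rho M (s + r) = rho M s ** rho M r"
  by (simp add: rho_def scaleR_add_left mat_exp_add mm.scaleR_left mm.scaleR_right)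

lemma rho_commute: "M ** N = N ** M \<Longrightarrow> N ** rho M s = rho M s ** N"
  unfolding rho_def by (rule mat_exp_commute) (simp add: mm.scaleR_left mm.scaleR_right)

lemma rho_minus_vector: "rho M (- s) *v (rho M s *v x) = x" "rho M s *v (rho M (- s) *v x) = x"
  by (simp_all add: rho_def mat_exp_minus_vector)

lemma rho_vector_has_vector_derivative:
  "((\<lambda>s. rho M s *v x) has_vector_derivative M *v (rho M s *v x)) (at s)"
  using mv.has_vector_derivative[OF rho_has_vector_derivative[of M s] has_vector_derivative_const[of x]]
  by (simp add: matrix_vector_mul_assoc)

lemma rho_isCont: "isCont (rho M) s"
  using has_vector_derivative_continuous[OF rho_has_vector_derivative[of M s]] by (simp add: eta_contract_eq)

lemma rho_tendsto [tendsto_intros]: "(f \<longlongrightarrow> s) F \<Longrightarrow> ((\<lambda>t. rho M (f t)) \<longlongrightarrow> rho M s) F"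
  using isCont_tendsto_compose[OF rho_isCont] .

lemma Lam_0 [simp]: "Lam M 0 w = 0"
  by (simp add: Lam_def zero_ereal_def[symmetric] interval_integral_endpoints_same)

lemma Lam_has_vector_derivative: "((\<lambda>t. Lam M t w) has_vector_derivative rho M t *v w) (at t)"
proof -
  let ?a = "- \<bar>t\<bar> - 1" and ?b = "\<bar>t\<bar> + 1"
  have cont: "continuous_on {?a..?b} (\<lambda>s. rho M s *v w)"
    by (intro mv.continuous_on continuous_intros continuous_at_imp_continuous_on ballI rho_isCont)
  have "((\<lambda>t. Lam M t w) has_vector_derivative rho M t *v w) (at t within {?a..?b})"
    unfolding Lam_def zero_ereal_def by (rule interval_integral_FTC2[OF _ _ cont]) auto
  then show ?thesis by (simp add: at_within_Icc_at)
qed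

lemma Lam_isCont: "isCont (\<lambda>t. Lam M t w) t"
  using has_vector_derivative_continuous[OF Lam_has_vector_derivative] .

lemma matrix_times_Lam: "M *v Lam M t w = rho M t *v w - w"
proof -
  let ?f = "\<lambda>t. M *v Lam M t w - rho M t *v w"
  have "(?f has_vector_derivative 0) (at t)" for t
  proof -
    have "(?f has_vector_derivative M *v (rho M t *v w) - M *v (rho M t *v w)) (at t)"
      by (intro has_vector_derivative_diff rho_vector_has_vector_derivative
          bounded_linear.has_vector_derivative[OF mv.bounded_linear_right Lam_has_vector_derivative])
    then show ?thesis by simp
  qed
  from constant_if_vector_derivative_0[of ?f, OF this, of t 0] show ?thesis
    by (simp add: mv.zero_right algebra_simps)
qed

lemma has_vector_derivative_shift:
  assumes "(f has_vector_derivative f') (at (s + a))"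
  shows "((\<lambda>s. f (s + a)) has_vector_derivative f') (at s)"
proof -
  have "((\<lambda>s. s + a) has_vector_derivative 1) (at s)"
    by (auto simp flip: has_real_derivative_iff_has_vector_derivative intro!: derivative_eq_intros)
  from vector_diff_chain_at[OF this assms] show ?thesis by (simp add: o_def)
qed

lemma Lam_add: "Lam M (s + r) w = Lam M r w + rho M r *v Lam M s w"
proof -
  let ?f = "\<lambda>s. Lam M (s + r) w - rho M r *v Lam M s w"
  have "(?f has_vector_derivative 0) (at s)" for s
  proof -
    have "((\<lambda>s. Lam M (s + r) w) has_vector_derivative rho M (s + r) *v w) (at s)"
      by (rule has_vector_derivative_shift[OF Lam_has_vector_derivative])
    moreover have "((\<lambda>s. rho M r *v Lam M s w) has_vector_derivative rho M r *v (rho M s *v w)) (at s)"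
      by (rule bounded_linear.has_vector_derivative[OF mv.bounded_linear_right Lam_has_vector_derivative])
    ultimately show ?thesis
      using has_vector_derivative_diff by (fastforce simp: rho_add[of M r s] add.commute[of s r] matrix_vector_mul_assoc)
  qed
  from constant_if_vector_derivative_0[of ?f, OF this, of s 0] show ?thesis
    by (simp add: mv.zero_right algebra_simps)
qed

text \<open>Variation of constants. The equation is only required in the open interval, since the solutions of a
  control system need not be differentiable at switching times.\<close>
lemma affine_ode_unique:
  fixes c :: "real \<Rightarrow> plane"
  assumes "a \<le> b" and cont: "continuous_on {a..b} c"
    and der: "\<And>s. a < s \<Longrightarrow> s < b \<Longrightarrow> (c has_vector_derivative M *v c s + v) (at s)"
  shows "c b = rho M (b - a) *v c a + Lam M (b - a) v"
proof -
  define d where "d = (\<lambda>s. c s - (rho M (s - a) *v c a + Lam M (s - a) v))"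
  define g where "g = (\<lambda>s. rho (- M) (s - a) *v d s)"
  have shift: "((\<lambda>s. f (s - a)) has_vector_derivative f') (at s)"
    if "(f has_vector_derivative f') (at (s - a))" for f :: "real \<Rightarrow> 'z::real_normed_vector" and f' s
    using has_vector_derivative_shift[of f f' s "- a"] that by simp
  have contd: "continuous_on {a..b} d" unfolding d_def
    by (intro continuous_intros cont mv.continuous_on continuous_at_imp_continuous_on ballI
        continuous_at_compose[of _ "\<lambda>s. s - a", unfolded o_def] rho_isCont Lam_isCont)
  have contg: "continuous_on {a..b} g" unfolding g_def
    by (intro contd continuous_intros mv.continuous_on continuous_at_imp_continuous_on[of _ "\<lambda>s. rho (- M) (s - a)"] ballI
        continuous_at_compose[of _ "\<lambda>s. s - a", unfolded o_def] rho_isCont)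
  have "(g has_vector_derivative 0) (at s)" if s: "s \<in> {a..b} - {a, b}" for s
  proof -
    have "(d has_vector_derivative (M *v c s + v) - (M *v (rho M (s - a) *v c a) + rho M (s - a) *v v)) (at s)"
      unfolding d_def
      by (intro has_vector_derivative_diff has_vector_derivative_add der shift
          rho_vector_has_vector_derivative Lam_has_vector_derivative) (use s in auto)
    moreover have "(M *v c s + v) - (M *v (rho M (s - a) *v c a) + rho M (s - a) *v v) = M *v d s"
      by (simp add: d_def mv.diff_right mv.add_right matrix_times_Lam)
    ultimately have "(d has_vector_derivative M *v d s) (at s)" by simp
    from mv.has_vector_derivative[OF shift[OF rho_has_vector_derivative[of "- M" "s - a"]] this]
    have "(g has_vector_derivative rho (- M) (s - a) *v (M *v d s) + ((- M) ** rho (- M) (s - a)) *v d s) (at s)"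
      unfolding g_def .
    moreover have "rho (- M) (s - a) *v (M *v d s) = M *v (rho (- M) (s - a) *v d s)"
      by (simp add: matrix_vector_mul_assoc rho_commute[of "- M" M] mm.minus_left mm.minus_right)
    ultimately show ?thesis by (simp add: matrix_vector_mul_assoc mm.minus_left mv.minus_left)
  qed
  then have "(g has_derivative (\<lambda>h. 0)) (at s within {a..b})" if "s \<in> {a..b} - {a, b}" for s
    using that by (simp add: has_vector_derivative_def has_derivative_at_withinI)
  from has_derivative_zero_unique_strong_interval[OF _ contg _ this, of "{a, b}" 0 b]
  have "g b = 0" using \<open>a \<le> b\<close> by (simp add: g_def d_def mv.zero_right)
  then have "rho M (b - a) *v (rho (- M) (b - a) *v d b) = 0" by (simp add: g_def mv.zero_right)
  moreover have "rho (- M) (b - a) = rho M (- (b - a))" by (simp only: rho_def scaleR_minus_left scaleR_minus_right)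
  ultimately have "d b = 0" using rho_minus_vector(2)[of M "b - a"] by simp
  then show ?thesis by (simp add: d_def)
qed

text \<open>With \<open>m\<close> half the trace, \<open>M - m I\<close> squares to the scalar \<open>\<kappa>\<close>, so that its exponential is
  \<open>C I + S (M - m I)\<close>, where \<open>(C, S)\<close> are cosine and sine, \<open>1\<close> and \<open>s\<close>, or hyperbolic cosine and sine,
  according to the sign of \<open>\<kappa>\<close>. The hypotheses on \<open>C\<close> and \<open>S\<close> treat the three cases at once.\<close>
lemma mat_exp_plane:
  fixes M :: "real^2^2"
  assumes C: "\<And>s. (C has_real_derivative \<kappa> * S s) (at s)" and S: "\<And>s. (S has_real_derivative C s) (at s)"
    and init: "C 0 = 1" "S 0 = 0" and m: "trace M = 2 * m" and \<kappa>: "\<kappa> = m\<^sup>2 - det M"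
    and s: "0 \<le> s"
  shows "mat_exp (s *\<^sub>R M) *v x = exp (s * m) *\<^sub>R (C s *\<^sub>R x + S s *\<^sub>R (M *v x - m *\<^sub>R x))"
proof -
  define c where "c = (\<lambda>s. exp (s * m) *\<^sub>R (C s *\<^sub>R x + S s *\<^sub>R (M *v x - m *\<^sub>R x)))"
  have "(c has_vector_derivative M *v c s + 0) (at s)" for s
  proof -
    have e: "((\<lambda>s. exp (s * m)) has_vector_derivative (m * exp (s * m))) (at s)"
      by (auto simp flip: has_real_derivative_iff_has_vector_derivative intro!: derivative_eq_intros)
    have d: "((\<lambda>s. C s *\<^sub>R x + S s *\<^sub>R (M *v x - m *\<^sub>R x)) has_vector_derivative
       (\<kappa> * S s) *\<^sub>R x + C s *\<^sub>R (M *v x - m *\<^sub>R x)) (at s)"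
      using C[of s] S[of s] by (auto intro!: derivative_eq_intros)
    have 1: "(c has_vector_derivative exp (s * m) *\<^sub>R ((\<kappa> * S s) *\<^sub>R x + C s *\<^sub>R (M *v x - m *\<^sub>R x))
       + (m * exp (s * m)) *\<^sub>R (C s *\<^sub>R x + S s *\<^sub>R (M *v x - m *\<^sub>R x))) (at s)"
      unfolding c_def by (rule bounded_bilinear.has_vector_derivative[OF bounded_bilinear_scaleR e d])
    have 2: "exp (s * m) *\<^sub>R ((\<kappa> * S s) *\<^sub>R x + C s *\<^sub>R (M *v x - m *\<^sub>R x))
       + (m * exp (s * m)) *\<^sub>R (C s *\<^sub>R x + S s *\<^sub>R (M *v x - m *\<^sub>R x)) = M *v c s + 0"
      unfolding c_def \<kappa>
      by (simp add: mv.scaleR_right mv.add_right mv.diff_right cayley_hamilton_plane m algebra_simps power2_eq_square)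
        (simp add: vec_eq_iff algebra_simps)
    show ?thesis using 1 unfolding 2 .
  qed
  then have "c s = rho M (s - 0) *v c 0 + Lam M (s - 0) 0"
    by (intro affine_ode_unique s continuous_at_imp_continuous_on ballI) (auto intro: has_vector_derivative_continuous)
  moreover have "Lam M s 0 = 0" by (simp add: Lam_def mv.zero_right)
  ultimately show ?thesis by (simp add: c_def init rho_def)
qed

lemma mat_exp_stable_tendsto_0:
  fixes M :: "real^2^2"
  assumes "trace M < 0" "det M > 0"
  shows "((\<lambda>s. mat_exp (s *\<^sub>R M) *v x) \<longlongrightarrow> 0) at_top"
proof -
  define m where "m = trace M / 2"
  define \<kappa> where "\<kappa> = m\<^sup>2 - det M"
  have m: "trace M = 2 * m" "m < 0" using assms by (auto simp: m_def)
  have "\<exists>C S. (\<forall>s. (C has_real_derivative \<kappa> * S s) (at s)) \<and> (\<forall>s. (S has_real_derivative C s) (at s)) \<and>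
     C 0 = 1 \<and> S 0 = 0 \<and> ((\<lambda>s. exp (s * m) * C s) \<longlongrightarrow> 0) at_top \<and> ((\<lambda>s. exp (s * m) * S s) \<longlongrightarrow> 0) at_top"
  proof -
    consider "\<kappa> < 0" | "\<kappa> = 0" | "\<kappa> > 0" by linarith
    then show ?thesis
    proof cases
      case 1
      define w where "w = sqrt (- \<kappa>)"
      have w: "w > 0" "\<kappa> = - (w * w)" using 1 by (auto simp: w_def)
      have e: "((\<lambda>s. exp (s * m)) \<longlongrightarrow> 0) at_top" using m by real_asymp
      have "((\<lambda>s. exp (s * m) * cos (w * s)) \<longlongrightarrow> 0) at_top"
        by (rule Lim_null_comparison[OF _ e]) (auto simp: abs_mult)
      moreover have "((\<lambda>s. exp (s * m) * (sin (w * s) / w)) \<longlongrightarrow> 0) at_top"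
      proof (rule Lim_null_comparison)
        show "\<forall>\<^sub>F s in at_top. norm (exp (s * m) * (sin (w * s) / w)) \<le> exp (s * m) / w"
          using w by (auto simp: abs_mult divide_simps)
        show "((\<lambda>s. exp (s * m) / w) \<longlongrightarrow> 0) at_top" using tendsto_divide[OF e tendsto_const[of w]] w by simp
      qed
      ultimately show ?thesis using w
        by (intro exI[of _ "\<lambda>s. cos (w * s)"] exI[of _ "\<lambda>s. sin (w * s) / w"])
           (auto intro!: derivative_eq_intros)
    next
      case 2
      have "((\<lambda>s. exp (s * m) * 1) \<longlongrightarrow> 0) at_top" "((\<lambda>s. exp (s * m) * s) \<longlongrightarrow> 0) at_top"
        using m by real_asymp+
      then show ?thesis using 2
        by (intro exI[of _ "\<lambda>s. 1"] exI[of _ "\<lambda>s. s"]) (auto intro!: derivative_eq_intros)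
    next
      case 3
      define w where "w = sqrt \<kappa>"
      have w: "w > 0" "\<kappa> = w * w" using 3 by (auto simp: w_def)
      have "w * w < (- m) * (- m)" using w(2) assms(2) by (simp add: \<kappa>_def power2_eq_square)
      then have "w < - m" using m(2) w(1) by (metis less_le_not_le mult_mono linorder_not_less neg_0_le_iff_le order.asym order.strict_implies_order)
      then have neg: "m + w < 0" "m - w < 0" using w(1) m(2) by auto
      have e: "((\<lambda>s. exp (s * (m + w))) \<longlongrightarrow> 0) at_top" "((\<lambda>s. exp (s * (m - w))) \<longlongrightarrow> 0) at_top"
        using neg by real_asymp+
      have lims: "((\<lambda>s. (exp (s * (m + w)) + exp (s * (m - w))) / 2) \<longlongrightarrow> 0) at_top"
        "((\<lambda>s. (exp (s * (m + w)) - exp (s * (m - w))) / (2 * w)) \<longlongrightarrow> 0) at_top"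
        using tendsto_divide[OF tendsto_add[OF e] tendsto_const[of 2]]
          tendsto_divide[OF tendsto_diff[OF e] tendsto_const[of "2 * w"]] w(1) by simp_all
      have eqs: "exp (s * m) * ((exp (w * s) + exp (- (w * s))) / 2) = (exp (s * (m + w)) + exp (s * (m - w))) / 2"
        "exp (s * m) * ((exp (w * s) - exp (- (w * s))) / (2 * w)) = (exp (s * (m + w)) - exp (s * (m - w))) / (2 * w)" for s
      proof -
        have "exp (s * (m + w)) = exp (s * m) * exp (w * s)" "exp (s * (m - w)) = exp (s * m) * exp (- (w * s))"
          by (simp_all add: algebra_simps flip: exp_add)
        then show "exp (s * m) * ((exp (w * s) + exp (- (w * s))) / 2) = (exp (s * (m + w)) + exp (s * (m - w))) / 2"
          "exp (s * m) * ((exp (w * s) - exp (- (w * s))) / (2 * w)) = (exp (s * (m + w)) - exp (s * (m - w))) / (2 * w)"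
          by (simp_all only: distrib_left right_diff_distrib times_divide_eq_right)
      qed
      have lim: "((\<lambda>s. exp (s * m) * ((exp (w * s) + exp (- (w * s))) / 2)) \<longlongrightarrow> 0) at_top"
        "((\<lambda>s. exp (s * m) * ((exp (w * s) - exp (- (w * s))) / (2 * w))) \<longlongrightarrow> 0) at_top"
        unfolding eqs by (fact lims)+
      show ?thesis
      proof (rule exI[of _ "\<lambda>s. (exp (w * s) + exp (- (w * s))) / 2"],
          rule exI[of _ "\<lambda>s. (exp (w * s) - exp (- (w * s))) / (2 * w)"], intro conjI allI lim)
        fix s
        show "((\<lambda>s. (exp (w * s) + exp (- (w * s))) / 2) has_real_derivative
            \<kappa> * ((exp (w * s) - exp (- (w * s))) / (2 * w))) (at s)"
          using w by (auto intro!: derivative_eq_intros simp: field_simps)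
        show "((\<lambda>s. (exp (w * s) - exp (- (w * s))) / (2 * w)) has_real_derivative
            (exp (w * s) + exp (- (w * s))) / 2) (at s)"
          using w by (auto intro!: derivative_eq_intros simp: field_simps)
      qed auto
    qed
  qed
  then obtain C S where CS: "\<And>s. (C has_real_derivative \<kappa> * S s) (at s)" "\<And>s. (S has_real_derivative C s) (at s)"
    "C 0 = 1" "S 0 = 0" and lim: "((\<lambda>s. exp (s * m) * C s) \<longlongrightarrow> 0) at_top" "((\<lambda>s. exp (s * m) * S s) \<longlongrightarrow> 0) at_top"
    by blast
  have "((\<lambda>s. (exp (s * m) * C s) *\<^sub>R x + (exp (s * m) * S s) *\<^sub>R (M *v x - m *\<^sub>R x)) \<longlongrightarrow> 0) at_top"
    using tendsto_add[OF tendsto_scaleR[OF lim(1) tendsto_const[of x]] tendsto_scaleR[OF lim(2) tendsto_const[of "M *v x - m *\<^sub>R x"]]]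
    by simp
  moreover have "\<forall>\<^sub>F s in at_top. (exp (s * m) * C s) *\<^sub>R x + (exp (s * m) * S s) *\<^sub>R (M *v x - m *\<^sub>R x) = mat_exp (s *\<^sub>R M) *v x"
    using eventually_ge_at_top[of 0]
    by eventually_elim (simp add: mat_exp_plane[OF CS m(1) \<kappa>_def] scaleR_add_right)
  ultimately show ?thesis by (rule Lim_transform_eventually)
qed

section \<open>The planar system\<close>

lemma trace_det_uminus: "trace (- M) = - trace M" "det (- M) = det M" for M :: "real^2^2"
  by (simp_all add: plane_matrix_components det_2)

lemma matrix_plane_injective:
  fixes M :: "real^2^2"
  assumes "det M \<noteq> 0" "M *v x = M *v y"
  shows "x = y"
proof -
  have "M *v (x - y) = 0" using assms(2) by (simp add: mv.diff_right)
  then have "det M *\<^sub>R (x - y) = 0"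
    using cayley_hamilton_plane[of M "x - y"] by (simp add: mv.zero_right)
  then show ?thesis using assms(1) by simp
qed

lemma has_vector_derivative_imp_quotient:
  assumes "(f has_vector_derivative f') (at (0::real))"
  shows "((\<lambda>h. (1 / h) *\<^sub>R (f h - f 0)) \<longlongrightarrow> f') (at 0)"
proof -
  have "((\<lambda>h. norm (f (0 + h) - f 0 - h *\<^sub>R f') / norm h) \<longlongrightarrow> 0) (at 0)"
    using assms unfolding has_vector_derivative_def has_derivative_at by blast
  moreover have "norm (f (0 + h) - f 0 - h *\<^sub>R f') / norm h = norm ((1 / h) *\<^sub>R (f h - f 0) - f')" if "h \<noteq> 0" for h
  proof -
    have "f h - f 0 - h *\<^sub>R f' = h *\<^sub>R ((1 / h) *\<^sub>R (f h - f 0) - f')" using that by (simp add: algebra_simps)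
    then have "norm (f h - f 0 - h *\<^sub>R f') = \<bar>h\<bar> * norm ((1 / h) *\<^sub>R (f h - f 0) - f')" by (metis norm_scaleR)
    then show ?thesis using that by simp
  qed
  then have "\<forall>\<^sub>F h in at 0. norm (f (0 + h) - f 0 - h *\<^sub>R f') / norm h = norm ((1 / h) *\<^sub>R (f h - f 0) - f')"
    unfolding eventually_at_filter by simp
  ultimately have "((\<lambda>h. norm ((1 / h) *\<^sub>R (f h - f 0) - f')) \<longlongrightarrow> 0) (at 0)"
    by (rule Lim_transform_eventually)
  then show ?thesis by (rule LIM_zero_cancel[OF tendsto_norm_zero_cancel])
qed

text \<open>Continuity of \<open>g\<close> is enough here because the other factor vanishes at \<open>p\<close>. This avoids differentiating the
  flow with respect to the control.\<close>
lemma has_derivative_vanishing_scaleR: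
  fixes g :: "'a::real_normed_vector \<Rightarrow> 'b::real_normed_vector"
  assumes "bounded_linear \<phi>" "isCont g p"
  shows "((\<lambda>x. \<phi> (x - p) *\<^sub>R g x) has_derivative (\<lambda>h. \<phi> h *\<^sub>R g p)) (at p)"
  unfolding has_derivative_at
proof
  interpret \<phi>: bounded_linear \<phi> by fact
  show "bounded_linear (\<lambda>h. \<phi> h *\<^sub>R g p)"
    by (rule bounded_linear_scaleR_const[OF assms(1)])
  obtain K where K: "\<And>h. norm (\<phi> h) \<le> norm h * K" using \<phi>.bounded by blast
  have lim: "((\<lambda>h. K * norm (g (p + h) - g p)) \<longlongrightarrow> 0) (at 0)"
    using assms(2) unfolding isCont_iff by (metis (no_types) LIM_zero tendsto_norm_zero tendsto_mult_right_zero)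
  show "((\<lambda>h. norm (\<phi> (p + h - p) *\<^sub>R g (p + h) - \<phi> (p - p) *\<^sub>R g p - \<phi> h *\<^sub>R g p) / norm h) \<longlongrightarrow> 0) (at 0)"
  proof (rule Lim_null_comparison[OF _ lim], rule always_eventually, rule allI)
    fix h
    have "norm (\<phi> (p + h - p) *\<^sub>R g (p + h) - \<phi> (p - p) *\<^sub>R g p - \<phi> h *\<^sub>R g p) = norm (\<phi> h) * norm (g (p + h) - g p)"
      by (simp add: \<phi>.zero scaleR_diff_right[symmetric])
    also have "\<dots> \<le> norm h * K * norm (g (p + h) - g p)" by (intro mult_right_mono K) auto
    finally have *: "norm (\<phi> (p + h - p) *\<^sub>R g (p + h) - \<phi> (p - p) *\<^sub>R g p - \<phi> h *\<^sub>R g p) \<le> norm h * K * norm (g (p + h) - g p)" .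
    show "norm (norm (\<phi> (p + h - p) *\<^sub>R g (p + h) - \<phi> (p - p) *\<^sub>R g p - \<phi> h *\<^sub>R g p) / norm h) \<le> K * norm (g (p + h) - g p)"
      using * K[of h] by (cases "h = 0") (auto simp: divide_simps mult_ac)
  qed
qed

text \<open>An invertible derivative at a single point suffices, by Sussmann's open mapping theorem.\<close>
lemma planar_open_mapping:
  fixes f :: "real \<times> real \<Rightarrow> plane"
  assumes "open S" "continuous_on S f" "p \<in> S"
    and der: "(f has_derivative (\<lambda>h. fst h *\<^sub>R k1 + snd h *\<^sub>R k2)) (at p)" and w: "wedge k1 k2 \<noteq> 0"
  shows "f p \<in> interior (f ` S)"
proof -
  define g' where "g' = (\<lambda>z. (wedge z k2 / wedge k1 k2, wedge k1 z / wedge k1 k2))"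
  have "linear g'"
    unfolding g'_def by (intro linearI) (auto simp: wedge_simps add_divide_distrib)
  then have "bounded_linear g'" by (simp add: linear_conv_bounded_linear)
  moreover have "(\<lambda>h. fst h *\<^sub>R k1 + snd h *\<^sub>R k2) \<circ> g' = id"
    using wedge_expand[OF w] by (auto simp: g'_def fun_eq_iff)
  ultimately show ?thesis
    by (intro sussmann_open_mapping[OF assms(1,2,3) der]) (use assms in \<open>auto simp: interior_open\<close>)
qed

text \<open>The planar system \<open>x' = (A - u B) x + u b\<close>. The last assumption is what the Lie algebra rank condition says
  about \<open>b\<close>.\<close>
locale plane_system =
  fixes A B :: "real^2^2" and b :: plane and um up :: real
  assumes commute: "A ** B = B ** A" and um: "um < 0" and up: "0 < up"
    and det_A: "det A \<noteq> 0"
    and cyclic: "wedge b (A *v b) \<noteq> 0 \<or> wedge b (B *v b) \<noteq> 0"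
begin

definition M :: "real \<Rightarrow> real^2^2" where "M u = A - u *\<^sub>R B"

definition flow :: "real \<Rightarrow> real \<Rightarrow> plane \<Rightarrow> plane" where
  "flow u s x = rho (M u) s *v x + u *\<^sub>R Lam (M u) s b"

text \<open>The linear part of the affine map that a control of duration \<open>S\<close> and integral \<open>\<tau>\<close> induces on the plane.\<close>
definition E :: "real \<Rightarrow> real \<Rightarrow> real^2^2" where
  "E S \<tau> = mat_exp (S *\<^sub>R A - \<tau> *\<^sub>R B)"

text \<open>The equilibrium \<open>- u (A - u B)\<^sup>-\<^sup>1 b\<close> of the constant control \<open>u\<close>; the inverse is written with the adjugate
  \<open>(tr M) I - M\<close>.\<close>
definition eqpt :: "real \<Rightarrow> plane" where
  "eqpt u = (- u / det (M u)) *\<^sub>R (trace (M u) *\<^sub>R b - M u *v b)"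

text \<open>\<open>reach S \<tau> x y\<close>: a control with finitely many pieces steers \<open>x\<close> to \<open>y\<close> in time \<open>S\<close>, and its integral is \<open>\<tau>\<close>.\<close>
inductive reach :: "real \<Rightarrow> real \<Rightarrow> plane \<Rightarrow> plane \<Rightarrow> bool" where
  step: "s > 0 \<Longrightarrow> u \<in> {um..up} \<Longrightarrow> reach s (u * s) x (flow u s x)"
| trans: "reach S \<tau> x y \<Longrightarrow> reach S' \<tau>' y z \<Longrightarrow> reach (S + S') (\<tau> + \<tau>') x z"

definition reaches :: "plane \<Rightarrow> plane \<Rightarrow> bool" where
  "reaches x y \<longleftrightarrow> (\<exists>S \<tau>. reach S \<tau> x y)"

definition hub :: "plane \<Rightarrow> bool" where
  "hub c \<longleftrightarrow> (\<exists>e>0. \<forall>y. dist y c < e \<longrightarrow> reaches c y \<and> reaches y c)"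

lemma reachesI: "reach S \<tau> x y \<Longrightarrow> reaches x y"
  unfolding reaches_def by blast

lemma reaches_trans [trans]: "reaches x y \<Longrightarrow> reaches y z \<Longrightarrow> reaches x z"
  unfolding reaches_def using reach.trans by blast

lemma reaches_flow: "s > 0 \<Longrightarrow> u \<in> {um..up} \<Longrightarrow> reaches x (flow u s x)"
  using reach.step reachesI by blast

lemma hub_open: "hub c \<Longrightarrow> \<exists>e>0. \<forall>y. dist y c < e \<longrightarrow> reaches c y \<and> reaches y c \<and> hub y"
proof -
  assume "hub c"
  then obtain e where e: "e > 0" "\<And>y. dist y c < e \<Longrightarrow> reaches c y \<and> reaches y c" unfolding hub_def by blast
  have "hub y" if "dist y c < e" for y
    unfolding hub_def
  proof (intro exI[of _ "e - dist y c"] conjI allI impI)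
    fix z assume "dist z y < e - dist y c"
    then have "dist z c < e" using dist_triangle[of z c y] by linarith
    then show "reaches y z" "reaches z y" using e(2)[OF that] e(2)[of z] reaches_trans by blast+
  qed (use that in auto)
  then show ?thesis using e by blast
qed

lemma M_0 [simp]: "M 0 = A" by (simp add: M_def)

lemma matrix_commute: "(a *\<^sub>R A - c *\<^sub>R B) ** (a' *\<^sub>R A - c' *\<^sub>R B) = (a' *\<^sub>R A - c' *\<^sub>R B) ** (a *\<^sub>R A - c *\<^sub>R B)"
  by (simp add: mm.diff_left mm.diff_right mm.scaleR_left mm.scaleR_right commute algebra_simps)

lemma rho_M: "rho (M u) s = E s (u * s)"
  by (simp add: rho_def E_def M_def algebra_simps)

lemma E_add: "E (S + S') (\<tau> + \<tau>') = E S \<tau> ** E S' \<tau>'"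
proof -
  have "(S + S') *\<^sub>R A - (\<tau> + \<tau>') *\<^sub>R B = (S *\<^sub>R A - \<tau> *\<^sub>R B) + (S' *\<^sub>R A - \<tau>' *\<^sub>R B)"
    by (simp add: algebra_simps)
  then show ?thesis unfolding E_def by (simp only: mat_exp_add matrix_commute)
qed

lemma E_add_vector: "E (S + S') (\<tau> + \<tau>') *v x = E S \<tau> *v (E S' \<tau>' *v x)"
  by (simp add: E_add matrix_vector_mul_assoc)

lemma E_0 [simp]: "E 0 0 = mat 1" by (simp add: E_def)

lemma E_inverse: "E (- S) (- \<tau>) *v (E S \<tau> *v x) = x" "E S \<tau> *v (E (- S) (- \<tau>) *v x) = x"
  using E_add_vector[of "- S" S "- \<tau>" \<tau> x] E_add_vector[of S "- S" \<tau> "- \<tau>" x] by simp_all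

lemma E_commute:
  assumes "A ** N = N ** A" "B ** N = N ** B"
  shows "N *v (E S \<tau> *v x) = E S \<tau> *v (N *v x)"
proof -
  have "(S *\<^sub>R A - \<tau> *\<^sub>R B) ** N = N ** (S *\<^sub>R A - \<tau> *\<^sub>R B)"
    using assms by (simp add: mm.diff_left mm.diff_right mm.scaleR_left mm.scaleR_right)
  then have "N ** E S \<tau> = E S \<tau> ** N" unfolding E_def by (rule mat_exp_commute)
  then show ?thesis by (simp add: matrix_vector_mul_assoc)
qed

lemma E_split: "E S \<tau> = mat_exp (S *\<^sub>R A) ** rho B (- \<tau>)"
  using E_add[of S 0 0 \<tau>] by (simp add: E_def rho_def)

lemma E_isCont: "isCont (E S) \<tau>"
proof -
  have "((\<lambda>\<tau>. mat_exp (S *\<^sub>R A) ** rho B (- \<tau>)) \<longlongrightarrow> mat_exp (S *\<^sub>R A) ** rho B (- \<tau>)) (at \<tau>)"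
    by (intro mm.tendsto tendsto_intros)
  then show ?thesis unfolding isCont_def by (simp add: E_split[abs_def])
qed

lemma E_tendsto [tendsto_intros]: "(f \<longlongrightarrow> \<tau>) F \<Longrightarrow> ((\<lambda>t. E S (f t)) \<longlongrightarrow> E S \<tau>) F"
  using isCont_tendsto_compose[OF E_isCont] .

lemma flow_0 [simp]: "flow u 0 x = x"
  by (simp add: flow_def)

lemma flow_diff: "flow u s x' = flow u s x + E s (u * s) *v (x' - x)"
  by (simp add: flow_def rho_M mv.diff_right)

lemma flow_add: "flow u (s + r) x = flow u r (flow u s x)"
  by (simp add: flow_def add.commute[of s r] rho_add)
     (simp add: Lam_add[of _ s r] add.commute[of r s] mv.add_right mv.scaleR_right matrix_vector_mul_assoc scaleR_add_right)

lemma flow_inverse: "flow u (- s) (flow u s x) = x" "flow u s (flow u (- s) x) = x"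
  using flow_add[of u s "- s" x] flow_add[of u "- s" s x] by simp_all

lemma flow_has_vector_derivative:
  "((\<lambda>s. flow u s x) has_vector_derivative M u *v flow u s x + u *\<^sub>R b) (at s)"
proof -
  have "((\<lambda>s. flow u s x) has_vector_derivative M u *v (rho (M u) s *v x) + u *\<^sub>R (rho (M u) s *v b)) (at s)"
    unfolding flow_def
    by (intro has_vector_derivative_add rho_vector_has_vector_derivative
        bounded_linear.has_vector_derivative[OF bounded_linear_scaleR_right Lam_has_vector_derivative])
  moreover have "M u *v (rho (M u) s *v x) + u *\<^sub>R (rho (M u) s *v b) = M u *v flow u s x + u *\<^sub>R b"
    by (simp add: flow_def mv.add_right mv.scaleR_right matrix_times_Lam scaleR_diff_right)
  ultimately show ?thesis by simp
qed

lemma rho_commute_M: "M u *v (rho (M v) s *v x) = rho (M v) s *v (M u *v x)"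
proof -
  have "M v ** M u = M u ** M v" using matrix_commute[of 1 v 1 u] by (simp add: M_def)
  then show ?thesis by (simp add: matrix_vector_mul_assoc rho_commute)
qed

lemma eqpt_zero: "det (M u) \<noteq> 0 \<Longrightarrow> M u *v eqpt u = - u *\<^sub>R b"
  by (simp add: eqpt_def mv.scaleR_right mv.minus_right mv.diff_right cayley_hamilton_plane)

lemma flow_eqpt:
  assumes "det (M u) \<noteq> 0"
  shows "flow u s x = eqpt u + E s (u * s) *v (x - eqpt u)"
proof -
  have "flow u s (eqpt u) = eqpt u"
    by (rule matrix_plane_injective[OF assms])
       (simp add: flow_def mv.add_right mv.scaleR_right matrix_times_Lam rho_commute_M eqpt_zero[OF assms] scaleR_diff_right mv.minus_right)
  then show ?thesis using flow_diff[of u s x "eqpt u"] by simp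
qed

lemma flow_eqpt_self: "det (M u) \<noteq> 0 \<Longrightarrow> flow u s (eqpt u) = eqpt u"
  by (simp add: flow_eqpt mv.zero_right)

text \<open>The affine dependence on the initial point with linear part \<open>E S \<tau>\<close>; this is where the commutation of \<open>A\<close>
  and \<open>B\<close> enters.\<close>
lemma reach_shift: "reach S \<tau> x y \<Longrightarrow> reach S \<tau> x' (y + E S \<tau> *v (x' - x))"
proof (induction arbitrary: x' rule: reach.induct)
  case (step s u x)
  then show ?case using reach.step[of s u x'] by (simp add: flow_diff[of u s x' x])
next
  case (trans S \<tau> x y S' \<tau>' z)
  show ?case using reach.trans[OF trans.IH(1)[of x'] trans.IH(2)]
    by (simp add: add.commute[of S] add.commute[of \<tau>] E_add_vector)
qed

lemma reach_lower_semicontinuous: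
  assumes r: "reach S \<tau> y z" and "e > 0"
  obtains d where "d > 0" "\<And>y'. dist y' y < d \<Longrightarrow> \<exists>z'. reach S \<tau> y' z' \<and> dist z' z < e"
proof -
  define K where "K = norm (E S \<tau>) + 1"
  have K: "K > 0" by (simp add: K_def add_nonneg_pos)
  have "\<exists>z'. reach S \<tau> y' z' \<and> dist z' z < e" if d: "dist y' y < e / K" for y'
  proof -
    have "dist (z + E S \<tau> *v (y' - y)) z \<le> norm (E S \<tau>) * dist y' y"
      by (simp add: dist_norm norm_matrix_vector_mult_le)
    also have "\<dots> \<le> K * dist y' y" by (intro mult_right_mono) (auto simp: K_def)
    also have "\<dots> < e" using d K by (simp add: pos_less_divide_eq mult.commute)
    finally show ?thesis using reach_shift[OF r, of y'] by blast
  qed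
  then show thesis using that[of "e / K"] K \<open>e > 0\<close> by simp
qed

lemma reach_bounds: "reach S \<tau> x y \<Longrightarrow> S > 0 \<and> um * S \<le> \<tau> \<and> \<tau> \<le> up * S"
  by (induction rule: reach.induct) (auto simp: distrib_left mult_right_mono)

lemma M_tendsto [tendsto_intros]: "(M \<longlongrightarrow> M u) (at u)"
  unfolding M_def[abs_def] by (intro tendsto_intros)

lemma trace_det_M_tendsto:
  "((\<lambda>v. det (M v)) \<longlongrightarrow> det (M u)) (at u)" "((\<lambda>v. trace (M v)) \<longlongrightarrow> trace (M u)) (at u)"
  "((\<lambda>v. M v *v x) \<longlongrightarrow> M u *v x) (at u)"
  unfolding M_def det_2 trace_def sum_2 by (intro tendsto_intros mv.tendsto)+ 

lemma trace_M: "trace (M u) = trace A - u * trace B"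
  by (simp add: M_def plane_matrix_components algebra_simps)

lemma eqpt_isCont: "det (M u) \<noteq> 0 \<Longrightarrow> isCont eqpt u"
  unfolding isCont_def eqpt_def by (intro tendsto_intros trace_det_M_tendsto) auto

lemma eqpt_0 [simp]: "eqpt 0 = 0"
  by (simp add: eqpt_def)

lemma attract:
  assumes "u \<in> {um..up}" "trace (M u) < 0" "det (M u) > 0" "e > 0"
  shows "\<exists>y. dist y (eqpt u) < e \<and> reaches x y"
proof -
  have "((\<lambda>s. mat_exp (s *\<^sub>R M u) *v (x - eqpt u)) \<longlongrightarrow> 0) at_top"
    by (rule mat_exp_stable_tendsto_0) (use assms in auto)
  then have "\<forall>\<^sub>F s in at_top. norm (mat_exp (s *\<^sub>R M u) *v (x - eqpt u)) < e"
    using \<open>e > 0\<close> by (auto dest: tendstoD[where e=e] simp: dist_norm)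
  then have "\<forall>\<^sub>F s in at_top. s > 0 \<and> norm (mat_exp (s *\<^sub>R M u) *v (x - eqpt u)) < e"
    using eventually_gt_at_top[of 0] by eventually_elim auto
  then obtain s where s: "s > 0" "norm (mat_exp (s *\<^sub>R M u) *v (x - eqpt u)) < e"
    by (auto dest: eventually_happens)
  have "flow u s x = eqpt u + mat_exp (s *\<^sub>R M u) *v (x - eqpt u)"
    using flow_eqpt[of u s x] assms(3) by (simp flip: rho_M add: rho_def)
  then show ?thesis using s reaches_flow[OF s(1) assms(1), of x] by (metis add_diff_cancel_left' dist_norm)
qed

text \<open>Time reversal turns an unstable constant control into a stable one.\<close>
lemma repel:
  assumes "u \<in> {um..up}" "trace (M u) > 0" "det (M u) > 0" "e > 0"
  shows "\<exists>y. dist y (eqpt u) < e \<and> reaches y x"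
proof -
  have "((\<lambda>s. mat_exp (s *\<^sub>R (- M u)) *v (x - eqpt u)) \<longlongrightarrow> 0) at_top"
    by (rule mat_exp_stable_tendsto_0) (use assms in \<open>auto simp: trace_det_uminus\<close>)
  then have "\<forall>\<^sub>F s in at_top. norm (mat_exp (s *\<^sub>R (- M u)) *v (x - eqpt u)) < e"
    using \<open>e > 0\<close> by (auto dest: tendstoD[where e=e] simp: dist_norm)
  then have "\<forall>\<^sub>F s in at_top. s > 0 \<and> norm (mat_exp (s *\<^sub>R (- M u)) *v (x - eqpt u)) < e"
    using eventually_gt_at_top[of 0] by eventually_elim auto
  then obtain s where s: "s > 0" "norm (mat_exp (s *\<^sub>R (- M u)) *v (x - eqpt u)) < e"
    by (auto dest: eventually_happens)
  have "flow u (- s) x = eqpt u + mat_exp (s *\<^sub>R (- M u)) *v (x - eqpt u)"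
    using flow_eqpt[of u "- s" x] rho_M[of u "- s", symmetric] assms(3) by (simp add: rho_def)
  then show ?thesis using s reaches_flow[OF s(1) assms(1), of "flow u (- s) x"]
    by (metis add_diff_cancel_left' dist_norm flow_inverse(2))
qed

text \<open>Started at the equilibrium of \<open>u\<close>, the flow of \<open>v\<close> differs from it by a multiple of \<open>v - u\<close>, whose other
  factor is continuous in \<open>v\<close>. So the derivative at \<open>v = u\<close> can be read off.\<close>
lemma flow_from_eqpt:
  assumes "det (M u) \<noteq> 0"
  shows "flow v h (eqpt u) = eqpt u + (v - u) *\<^sub>R Lam (M v) h (b - B *v eqpt u)"
proof -
  let ?c = "eqpt u" and ?d = "b - B *v eqpt u"
  let ?f = "\<lambda>h. flow v h ?c - ?c - (v - u) *\<^sub>R Lam (M v) h ?d"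
  have Mv: "M v *v ?c + v *\<^sub>R b = (v - u) *\<^sub>R ?d"
  proof -
    have "M v *v ?c = M u *v ?c - (v - u) *\<^sub>R (B *v ?c)"
      by (simp add: M_def mv.diff_left mv.scaleR_left algebra_simps)
    then show ?thesis by (simp add: eqpt_zero[OF assms] algebra_simps)
  qed
  have "(?f has_vector_derivative 0) (at h)" for h
  proof -
    have "(?f has_vector_derivative M v *v (rho (M v) h *v ?c) + v *\<^sub>R (rho (M v) h *v b) - 0 - (v - u) *\<^sub>R (rho (M v) h *v ?d)) (at h)"
      unfolding flow_def
      by (intro has_vector_derivative_add has_vector_derivative_diff has_vector_derivative_const rho_vector_has_vector_derivative
        bounded_linear.has_vector_derivative[OF bounded_linear_scaleR_right Lam_has_vector_derivative])
    moreover have "M v *v (rho (M v) h *v ?c) + v *\<^sub>R (rho (M v) h *v b) - 0 - (v - u) *\<^sub>R (rho (M v) h *v ?d)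
        = rho (M v) h *v (M v *v ?c + v *\<^sub>R b - (v - u) *\<^sub>R ?d)"
      by (simp add: rho_commute_M mv.add_right mv.diff_right mv.scaleR_right)
    ultimately show ?thesis by (simp add: Mv mv.zero_right)
  qed
  from constant_if_vector_derivative_0[of ?f, OF this, of h 0] show ?thesis by (simp add: algebra_simps)
qed

lemma Lam_M_isCont:
  assumes "det (M u) \<noteq> 0"
  shows "isCont (\<lambda>v. Lam (M v) h d) u"
proof -
  have eq: "Lam (M v) h d = (1 / det (M v)) *\<^sub>R (trace (M v) *\<^sub>R (E h (v * h) *v d - d) - M v *v (E h (v * h) *v d - d))"
    if "det (M v) \<noteq> 0" for v
  proof -
    define Z where "Z = E h (v * h) *v d - d"
    have "M v *v Lam (M v) h d = Z" by (simp only: matrix_times_Lam rho_M Z_def)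
    then have "M v *v Z = trace (M v) *\<^sub>R Z - det (M v) *\<^sub>R Lam (M v) h d"
      using cayley_hamilton_plane[of "M v" "Lam (M v) h d"] by (simp only:)
    then have "det (M v) *\<^sub>R Lam (M v) h d = trace (M v) *\<^sub>R Z - M v *v Z" by simp
    then show ?thesis unfolding Z_def[symmetric] using that by (simp flip: \<open>det (M v) *\<^sub>R Lam (M v) h d = _\<close>)
  qed
  have "((\<lambda>v. (1 / det (M v)) *\<^sub>R (trace (M v) *\<^sub>R (E h (v * h) *v d - d) - M v *v (E h (v * h) *v d - d)))
     \<longlongrightarrow> (1 / det (M u)) *\<^sub>R (trace (M u) *\<^sub>R (E h (u * h) *v d - d) - M u *v (E h (u * h) *v d - d))) (at u)"
    by (intro tendsto_intros trace_det_M_tendsto mv.tendsto) (use assms in auto)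
  moreover have "\<forall>\<^sub>F v in at u. det (M v) \<noteq> 0"
    using tendsto_imp_eventually_ne[OF trace_det_M_tendsto(1) assms] .
  then have "\<forall>\<^sub>F v in at u. (1 / det (M v)) *\<^sub>R (trace (M v) *\<^sub>R (E h (v * h) *v d - d) - M v *v (E h (v * h) *v d - d)) = Lam (M v) h d"
    by eventually_elim (simp add: eq)
  ultimately show ?thesis unfolding isCont_def eq[OF assms] by (rule Lim_transform_eventually)
qed

end

section \<open>Hubs: equilibria with controllable linearisation\<close>

lemma trace_wedge: "trace M * wedge x y = wedge (M *v x) y + wedge x (M *v y)" for M :: "real^2^2"
  by (simp add: wedge_def plane_matrix_components algebra_simps)

context plane_system begin

lemma M_commute_vector: "M u *v (B *v x) = B *v (M u *v x)" "M u *v (A *v x) = A *v (M u *v x)"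
proof -
  have "M u ** B = B ** M u" "M u ** A = A ** M u"
    by (simp_all add: M_def mm.diff_left mm.diff_right mm.scaleR_left mm.scaleR_right commute)
  then show "M u *v (B *v x) = B *v (M u *v x)" "M u *v (A *v x) = A *v (M u *v x)"
    by (simp_all add: matrix_vector_mul_assoc)
qed

lemma b_nonzero: "b \<noteq> 0"
  using cyclic by (auto simp: mv.zero_right wedge_simps)

text \<open>Two constant controls of duration \<open>h\<close> in succession, both near \<open>u\<close>: the derivatives of the endpoint with respect to
  them are \<open>K\<close> and \<open>k u\<close>. For \<open>h < 0\<close> the same computation runs backwards in time.\<close>
lemma endpoint_map_open:
  fixes h u
  defines "d \<equiv> b - B *v eqpt u"
  assumes u: "u \<in> {um<..<up}" and det: "det (M u) \<noteq> 0"
    and ind: "wedge (Lam (M u) h d) (rho (M u) h *v Lam (M u) h d) \<noteq> 0"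
  shows "eqpt u \<in> interior ((\<lambda>p. flow (snd p) h (flow (fst p) h (eqpt u))) ` ({um<..<up} \<times> {um<..<up}))"
proof -
  define k where "k = (\<lambda>v. Lam (M v) h d)"
  define f where "f = (\<lambda>p. flow (snd p) h (flow (fst p) h (eqpt u)))"
  have "\<forall>\<^sub>F v in nhds u. det (M v) \<noteq> 0"
    using tendsto_imp_eventually_ne[OF trace_det_M_tendsto(1) det] det by (simp add: eventually_nhds_conv_at)
  with eventually_nhds_in_open[OF open_greaterThanLessThan u]
  have "\<forall>\<^sub>F v in nhds u. v \<in> {um<..<up} \<and> det (M v) \<noteq> 0" by eventually_elim auto
  then obtain J where J: "open J" "u \<in> J" "\<And>v. v \<in> J \<Longrightarrow> v \<in> {um<..<up} \<and> det (M v) \<noteq> 0"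
    unfolding eventually_nhds by blast
  have f: "f p = eqpt u + (snd p - u) *\<^sub>R k (snd p) + (fst p - u) *\<^sub>R (E h (snd p * h) *v k (fst p))" for p
  proof -
    have "f p = flow (snd p) h (eqpt u) + E h (snd p * h) *v (flow (fst p) h (eqpt u) - eqpt u)"
      unfolding f_def by (rule flow_diff)
    then show ?thesis
      by (simp add: flow_from_eqpt[OF det] mv.scaleR_right k_def d_def)
  qed
  have kJ: "isCont k v" if "v \<in> J" for v
    unfolding k_def by (rule Lam_M_isCont) (use J(3) that in auto)
  have contk: "continuous_on J k" using kJ by (simp add: continuous_at_imp_continuous_on)
  have contE: "continuous_on UNIV (E h)" using E_isCont by (simp add: continuous_at_imp_continuous_on)
  have cont: "continuous_on (J \<times> J) f"
    unfolding f
    by (intro continuous_intros mv.continuous_on continuous_on_compose2[OF contk] continuous_on_compose2[OF contE]) auto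
  define K where "K = E h (u * h) *v k u"
  have w: "wedge K (k u) \<noteq> 0" using ind by (simp add: K_def k_def rho_M wedge_def algebra_simps)
  have der: "(f has_derivative (\<lambda>t. fst t *\<^sub>R K + snd t *\<^sub>R k u)) (at (u, u))"
  proof -
    have 1: "isCont (\<lambda>p. k (snd p)) (u, u)"
      by (rule isCont_o2[of _ snd k]) (use kJ J(2) in \<open>auto intro: continuous_intros\<close>)
    have 2: "isCont (\<lambda>p. k (fst p)) (u, u)"
      by (rule isCont_o2[of _ fst k]) (use kJ J(2) in \<open>auto intro: continuous_intros\<close>)
    have 3: "isCont (\<lambda>p. E h (snd p * h)) (u, u)"
      by (rule isCont_o2[of _ "\<lambda>p. snd p * h" "E h"]) (auto intro: continuous_intros E_isCont)
    have 4: "isCont (\<lambda>p. E h (snd p * h) *v k (fst p)) (u, u)"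
      using mv.tendsto[OF 3[unfolded isCont_def] 2[unfolded isCont_def]] by (simp add: isCont_def)
    have "((\<lambda>p. eqpt u + snd (p - (u, u)) *\<^sub>R k (snd p) + fst (p - (u, u)) *\<^sub>R (E h (snd p * h) *v k (fst p)))
        has_derivative (\<lambda>t. 0 + snd t *\<^sub>R k (snd (u, u)) + fst t *\<^sub>R (E h (snd (u, u) * h) *v k (fst (u, u))))) (at (u, u))"
      by (intro has_derivative_add has_derivative_const has_derivative_vanishing_scaleR bounded_linear_fst bounded_linear_snd 1 4)
    then show ?thesis unfolding f[abs_def] K_def by (simp add: add.commute)
  qed
  have "f (u, u) \<in> interior (f ` (J \<times> J))"
    by (rule planar_open_mapping[OF open_Times[OF J(1) J(1)] cont _ der w]) (use J in auto)
  moreover have "interior (f ` (J \<times> J)) \<subseteq> interior (f ` ({um<..<up} \<times> {um<..<up}))"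
    using J(3) by (intro interior_mono) auto
  ultimately have "f (u, u) \<in> interior (f ` ({um<..<up} \<times> {um<..<up}))" by (rule rev_subsetD)
  moreover have "f (u, u) = eqpt u" by (simp add: f_def flow_eqpt_self[OF det])
  ultimately show ?thesis by (simp add: f_def)
qed

text \<open>As \<open>h \<rightarrow> 0\<close>, the determinant in \<open>endpoint_map_open\<close> divided by \<open>h\<^sup>3\<close> tends to \<open>d \<and> (A - u B) d\<close>, where
  \<open>(A - u B) d = A b\<close>. It is nonzero exactly when \<open>b\<close> is no eigenvector of \<open>A - u B\<close>.\<close>
lemma eqpt_hub:
  assumes u: "u \<in> {um<..<up}" and det: "det (M u) \<noteq> 0" and cyc: "wedge b (M u *v b) \<noteq> 0"
  shows "hub (eqpt u)"
proof -
  define d where "d = b - B *v eqpt u"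
  have Md: "M u *v d = A *v b"
  proof -
    show ?thesis
      by (simp add: d_def M_commute_vector mv.diff_right mv.scaleR_right mv.minus_right eqpt_zero[OF det]) (simp add: M_def mv.diff_left mv.scaleR_left)
  qed
  have "wedge d (M u *v d) \<noteq> 0"
  proof
    assume "wedge d (M u *v d) = 0"
    then have "wedge (M u *v d) (M u *v (M u *v d)) = 0" by (simp add: wedge_matrix)
    then show False using cyc det_A by (simp add: Md wedge_matrix M_commute_vector)
  qed
  define k where "k = (\<lambda>h. Lam (M u) h d)"
  define W where "W = (\<lambda>h. wedge (k h) (rho (M u) h *v k h))"
  have k: "((\<lambda>h. (1 / h) *\<^sub>R k h) \<longlongrightarrow> d) (at 0)"
    using has_vector_derivative_imp_quotient[OF Lam_has_vector_derivative[of "M u" d 0]] by (simp add: k_def)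
  have R: "((\<lambda>h. (1 / h) *\<^sub>R (rho (M u) h - mat 1)) \<longlongrightarrow> M u) (at 0)"
    using has_vector_derivative_imp_quotient[OF rho_has_vector_derivative[of "M u" 0]] by simp
  \<comment> \<open>subtracting the identity from \<open>rho\<close> does not change \<open>W\<close>, since \<open>k h \<and> k h = 0\<close>\<close>
  have lim: "((\<lambda>h. wedge ((1 / h) *\<^sub>R k h) (((1 / h) *\<^sub>R (rho (M u) h - mat 1)) *v ((1 / h) *\<^sub>R k h))) \<longlongrightarrow> wedge d (M u *v d)) (at 0)"
    by (intro tendsto_intros mv.tendsto k R)
  have "\<forall>\<^sub>F h in at 0. W h \<noteq> 0"
    using tendsto_imp_eventually_ne[OF lim \<open>wedge d (M u *v d) \<noteq> 0\<close>]
    by eventually_elim (auto simp: W_def wedge_simps mv.scaleR_left mv.scaleR_right mv.diff_left)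
  then obtain r where r: "r > 0" "\<And>h. h \<noteq> 0 \<Longrightarrow> dist h 0 < r \<Longrightarrow> W h \<noteq> 0"
    unfolding eventually_at by auto
  define h where "h = r / 2"
  have h: "h > 0" "W h \<noteq> 0" "W (- h) \<noteq> 0" using r by (auto simp: h_def)
  have 1: "eqpt u \<in> interior ((\<lambda>p. flow (snd p) h (flow (fst p) h (eqpt u))) ` ({um<..<up} \<times> {um<..<up}))"
    using endpoint_map_open[OF u det, of h] h(2) by (simp add: W_def k_def d_def)
  have 2: "eqpt u \<in> interior ((\<lambda>p. flow (snd p) (- h) (flow (fst p) (- h) (eqpt u))) ` ({um<..<up} \<times> {um<..<up}))"
    using endpoint_map_open[OF u det, of "- h"] h(3) by (simp add: W_def k_def d_def)
  obtain e1 where e1: "e1 > 0" "ball (eqpt u) e1 \<subseteq> (\<lambda>p. flow (snd p) h (flow (fst p) h (eqpt u))) ` ({um<..<up} \<times> {um<..<up})"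
    using 1 unfolding mem_interior by blast
  obtain e2 where e2: "e2 > 0" "ball (eqpt u) e2 \<subseteq> (\<lambda>p. flow (snd p) (- h) (flow (fst p) (- h) (eqpt u))) ` ({um<..<up} \<times> {um<..<up})"
    using 2 unfolding mem_interior by blast
  show ?thesis unfolding hub_def
  proof (intro exI[of _ "min e1 e2"] conjI allI impI)
    fix y assume y: "dist y (eqpt u) < min e1 e2"
    then have "y \<in> ball (eqpt u) e1" "y \<in> ball (eqpt u) e2" by (auto simp: dist_commute)
    with e1(2) e2(2) obtain p q where p: "y = flow (snd p) h (flow (fst p) h (eqpt u))" "p \<in> {um<..<up} \<times> {um<..<up}"
      and q: "y = flow (snd q) (- h) (flow (fst q) (- h) (eqpt u))" "q \<in> {um<..<up} \<times> {um<..<up}" by blast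
    show "reaches (eqpt u) y"
      unfolding p(1) using p(2) h(1) by (intro reaches_trans[OF reaches_flow reaches_flow]) auto
    have "reaches y (flow (snd q) h y)" "reaches (flow (snd q) h y) (flow (fst q) h (flow (snd q) h y))"
      using q(2) h(1) by (auto intro!: reaches_flow)
    moreover have "flow (fst q) h (flow (snd q) h y) = eqpt u" by (simp add: q(1) flow_inverse)
    ultimately show "reaches y (eqpt u)" using reaches_trans by metis
  qed (use e1 e2 in auto)
qed

text \<open>If \<open>b\<close> is an eigenvector of \<open>A\<close>, then so is \<open>B b\<close> with the same eigenvalue, and the two form a basis.\<close>
lemma scalar_if_not_cyclic:
  assumes "wedge b (A *v b) = 0"
  obtains l where "l \<noteq> 0" "A = l *\<^sub>R mat 1"
proof -
  obtain l where l: "A *v b = l *\<^sub>R b" using wedge_eq_0_imp_multiple[OF assms b_nonzero] .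
  have w: "wedge b (B *v b) \<noteq> 0" using cyclic assms by simp
  have "A *v (B *v b) = B *v (A *v b)" by (simp add: matrix_vector_mul_assoc commute)
  then have AB: "A *v (B *v b) = l *\<^sub>R (B *v b)" by (simp add: l mv.scaleR_right)
  have "A *v x = (l *\<^sub>R mat 1) *v x" for x
  proof -
    have "A *v x = A *v ((wedge x (B *v b) / wedge b (B *v b)) *\<^sub>R b + (wedge b x / wedge b (B *v b)) *\<^sub>R (B *v b))"
      using wedge_expand[OF w, of x] by simp
    also have "\<dots> = l *\<^sub>R ((wedge x (B *v b) / wedge b (B *v b)) *\<^sub>R b + (wedge b x / wedge b (B *v b)) *\<^sub>R (B *v b))"
      by (simp add: mv.add_right mv.scaleR_right l AB scaleR_add_right mult.commute)
    also have "\<dots> = l *\<^sub>R x" using wedge_expand[OF w, of x] by simp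
    finally show ?thesis by (simp add: mv.scaleR_left)
  qed
  then have "A = l *\<^sub>R mat 1" by (simp add: matrix_eq)
  moreover from this det_A have "l \<noteq> 0" by (auto simp: det_2)
  ultimately show thesis using that by blast
qed

text \<open>All equilibria of small nonzero controls are hubs, and all are mutually reachable with the hub \<open>c\<close>. The control
  \<open>0\<close> is left out because its equilibrium need not be a hub when \<open>A\<close> is scalar.\<close>
definition core :: "plane \<Rightarrow> real \<Rightarrow> bool" where
  "core c e \<longleftrightarrow> e > 0 \<and> hub c \<and> (\<forall>v. 0 < \<bar>v\<bar> \<and> \<bar>v\<bar> < e \<longrightarrow>
     v \<in> {um<..<up} \<and> det (M v) \<noteq> 0 \<and> hub (eqpt v) \<and> reaches c (eqpt v) \<and> reaches (eqpt v) c)"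

lemma eventually_small:
  assumes "\<forall>\<^sub>F v in at (0::real). P v"
  obtains e where "e > 0" "\<And>v. 0 < \<bar>v\<bar> \<and> \<bar>v\<bar> < e \<Longrightarrow> P v"
  using assms unfolding eventually_at by (auto simp: dist_real_def)

lemma eventually_in_range: "\<forall>\<^sub>F v in at 0. v \<in> {um<..<up} \<and> det (M v) \<noteq> 0"
proof -
  have "\<forall>\<^sub>F v in nhds 0. v \<in> {um<..<up}"
    by (rule eventually_nhds_in_open) (use um up in auto)
  then have "\<forall>\<^sub>F v in at 0. v \<in> {um<..<up}" by (simp add: eventually_at_filter eventually_mono)
  moreover have "\<forall>\<^sub>F v in at 0. det (M v) \<noteq> 0"
    using tendsto_imp_eventually_ne[OF trace_det_M_tendsto(1)[of 0]] det_A by simp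
  ultimately show ?thesis by eventually_elim auto
qed

text \<open>If \<open>b\<close> is no eigenvector of \<open>A\<close>, the origin itself is a hub and the equilibria of small controls lie in its
  ball. If \<open>A = l I\<close>, then each small constant control attracts (\<open>l < 0\<close>) or repels (\<open>l > 0\<close>) the plane, and this
  connects the hubs \<open>eqpt v\<close> on both sides of \<open>v = 0\<close>.\<close>
lemma core_exists: "\<exists>c e. core c e"
proof (cases "wedge b (A *v b) = 0")
  case False
  have "hub (eqpt 0)" by (rule eqpt_hub) (use False um up det_A in auto)
  then obtain e where e: "e > 0" "\<And>y. dist y 0 < e \<Longrightarrow> reaches 0 y \<and> reaches y 0 \<and> hub y"
    using hub_open[OF \<open>hub (eqpt 0)\<close>] by auto
  have "(eqpt \<longlongrightarrow> eqpt 0) (at 0)" using eqpt_isCont[of 0] det_A by (simp add: isCont_def)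
  then have "\<forall>\<^sub>F v in at 0. dist (eqpt v) 0 < e" using e(1) by (auto dest: tendstoD)
  with eventually_in_range have "\<forall>\<^sub>F v in at 0. v \<in> {um<..<up} \<and> det (M v) \<noteq> 0 \<and> hub (eqpt v) \<and> reaches 0 (eqpt v) \<and> reaches (eqpt v) 0"
    by eventually_elim (use e in auto)
  then obtain e' where "e' > 0" "\<And>v. 0 < \<bar>v\<bar> \<and> \<bar>v\<bar> < e' \<Longrightarrow> v \<in> {um<..<up} \<and> det (M v) \<noteq> 0 \<and> hub (eqpt v) \<and> reaches 0 (eqpt v) \<and> reaches (eqpt v) 0"
    by (rule eventually_small) blast
  then have "core 0 e'" using \<open>hub (eqpt 0)\<close> unfolding core_def by auto
  then show ?thesis by blast
next
  case True
  then obtain l where l: "l \<noteq> 0" "A = l *\<^sub>R mat 1" using scalar_if_not_cyclic by blast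
  have trA: "trace A = 2 * l" "det A = l * l" by (simp_all add: l plane_matrix_components det_2)
  have sq: "l * l > 0" using l(1) by (metis not_real_square_gt_zero)
  then have pos: "det A > 0" using trA by simp
  have lim: "((\<lambda>v. l * trace (M v)) \<longlongrightarrow> 2 * (l * l)) (at 0)"
    using tendsto_mult_left[OF trace_det_M_tendsto(2)[of 0], of l] trA(1) by (simp add: mult_ac)
  have "\<forall>\<^sub>F v in at 0. det (M v) > 0"
    using order_tendstoD(1)[OF trace_det_M_tendsto(1)[of 0]] pos by simp
  moreover have "\<forall>\<^sub>F v in at 0. l * trace (M v) > 0"
    using order_tendstoD(1)[OF lim, of 0] sq by simp
  ultimately have "\<forall>\<^sub>F v in at 0. v \<in> {um<..<up} \<and> det (M v) > 0 \<and> l * trace (M v) > 0"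
    using eventually_in_range by eventually_elim auto
  then obtain e where e: "e > 0" "\<And>v. 0 < \<bar>v\<bar> \<and> \<bar>v\<bar> < e \<Longrightarrow> v \<in> {um<..<up} \<and> det (M v) > 0 \<and> l * trace (M v) > 0"
    by (rule eventually_small) blast
  have hub: "hub (eqpt v)" if v: "0 < \<bar>v\<bar> \<and> \<bar>v\<bar> < e" for v
  proof (rule eqpt_hub)
    have "wedge b (M v *v b) = - v * wedge b (B *v b)"
      using True by (simp add: M_def mv.diff_left mv.scaleR_left wedge_simps)
    then show "wedge b (M v *v b) \<noteq> 0" using v cyclic True by auto
  qed (use e(2)[OF v] in auto)
  have reach: "reaches (eqpt v) (eqpt v')" if v: "0 < \<bar>v\<bar> \<and> \<bar>v\<bar> < e" "0 < \<bar>v'\<bar> \<and> \<bar>v'\<bar> < e" for v v'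
  proof -
    from hub[OF v(1)] obtain r where r: "r > 0" "\<And>y. dist y (eqpt v) < r \<Longrightarrow> reaches (eqpt v) y"
      unfolding hub_def by blast
    from hub[OF v(2)] obtain r' where r': "r' > 0" "\<And>y. dist y (eqpt v') < r' \<Longrightarrow> reaches y (eqpt v')"
      unfolding hub_def by blast
    show ?thesis
    proof (cases "l < 0")
      case True
      then have "trace (M v') < 0" using e(2)[OF v(2)] by (auto simp: zero_less_mult_iff)
      then obtain y where "dist y (eqpt v') < r'" "reaches (eqpt v) y"
        using attract[of v' r' "eqpt v"] r'(1) e(2)[OF v(2)] by auto
      then show ?thesis using r'(2) reaches_trans by blast
    next
      case False
      then have "trace (M v) > 0" using e(2)[OF v(1)] l(1) by (auto simp: zero_less_mult_iff)
      then obtain y where "dist y (eqpt v) < r" "reaches y (eqpt v')"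
        using repel[of v r "eqpt v'"] r(1) e(2)[OF v(1)] by auto
      then show ?thesis using r(2) reaches_trans by blast
    qed
  qed
  have "core (eqpt (e / 2)) e"
    unfolding core_def
  proof (intro conjI allI impI)
    have e2: "0 < \<bar>e / 2\<bar> \<and> \<bar>e / 2\<bar> < e" using e(1) by simp
    show "hub (eqpt (e / 2))" by (rule hub[OF e2])
    fix v assume v: "0 < \<bar>v\<bar> \<and> \<bar>v\<bar> < e"
    show "v \<in> {um<..<up}" "det (M v) \<noteq> 0" using e(2)[OF v] by auto
    show "hub (eqpt v)" by (rule hub[OF v])
    show "reaches (eqpt (e / 2)) (eqpt v)" "reaches (eqpt v) (eqpt (e / 2))"
      using reach[OF e2 v] reach[OF v e2] by auto
  qed (use e in auto)
  then show ?thesis by blast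
qed

section \<open>Centres make the plane controllable\<close>

lemma eigenvector_free:
  assumes "det (M u) > 0" "trace (M u) = 0"
  shows "wedge b (M u *v b) \<noteq> 0"
proof
  assume "wedge b (M u *v b) = 0"
  then obtain c where c: "M u *v b = c *\<^sub>R b" using wedge_eq_0_imp_multiple b_nonzero by metis
  have "M u *v (M u *v b) = - (det (M u)) *\<^sub>R b" using assms(2) by (simp add: cayley_hamilton_plane)
  then have "(c * c) *\<^sub>R b = (- det (M u)) *\<^sub>R b" by (simp add: c mv.scaleR_right)
  then have "c * c = - det (M u)" using b_nonzero by (metis scaleR_cancel_right)
  then show False using assms(1) by (metis neg_less_0_iff_less not_square_less_zero)
qed

text \<open>Controls on the two sides of \<open>u\<close> spiral into and out of equilibria that lie in the ball of the hub
  \<open>eqpt u\<close>: spiral into it from \<open>x\<close>, then out of it to \<open>y\<close>.\<close>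
lemma reaches_all_if_trace_changes_sign:
  assumes u: "u \<in> {um<..<up}" and det: "det (M u) > 0" and tr: "trace (M u) = 0" and B: "trace B \<noteq> 0"
  shows "reaches x y"
proof -
  have "hub (eqpt u)" using eqpt_hub[OF u] det eigenvector_free[OF det tr] by auto
  then obtain e where e: "e > 0" "\<And>y. dist y (eqpt u) < e \<Longrightarrow> reaches (eqpt u) y \<and> reaches y (eqpt u)"
    unfolding hub_def by blast
  have "(eqpt \<longlongrightarrow> eqpt u) (at u)" using eqpt_isCont[of u] det by (simp add: isCont_def)
  then have "\<forall>\<^sub>F v in at u. dist (eqpt v) (eqpt u) < e / 2" using tendstoD[of eqpt _ _ "e / 2"] e(1) by simp
  moreover have "\<forall>\<^sub>F v in at u. det (M v) > 0"
    using order_tendstoD(1)[OF trace_det_M_tendsto(1) det] .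
  moreover have "\<forall>\<^sub>F v in at u. v \<in> {um<..<up}"
    using eventually_nhds_in_open[OF open_greaterThanLessThan u] by (simp add: eventually_at_filter eventually_mono)
  ultimately have "\<forall>\<^sub>F v in at u. dist (eqpt v) (eqpt u) < e / 2 \<and> det (M v) > 0 \<and> v \<in> {um<..<up}"
    by eventually_elim auto
  then obtain r where r: "r > 0" "\<And>v. v \<noteq> u \<Longrightarrow> dist v u < r \<Longrightarrow> dist (eqpt v) (eqpt u) < e / 2 \<and> det (M v) > 0 \<and> v \<in> {um<..<up}"
    unfolding eventually_at by auto
  define s where "s = (if trace B > 0 then r / 2 else - r / 2)"
  have s: "s \<noteq> 0" "\<bar>s\<bar> < r" "s * trace B > 0" using r(1) B by (auto simp: s_def zero_less_mult_iff mult_neg_neg)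
  have trs: "trace (M (u + s)) < 0" "trace (M (u - s)) > 0"
    using tr s(3) by (auto simp: trace_M algebra_simps)
  have p: "dist (eqpt (u + s)) (eqpt u) < e / 2 \<and> det (M (u + s)) > 0 \<and> u + s \<in> {um<..<up}"
    "dist (eqpt (u - s)) (eqpt u) < e / 2 \<and> det (M (u - s)) > 0 \<and> u - s \<in> {um<..<up}"
    using r(2)[of "u + s"] r(2)[of "u - s"] s by (auto simp: dist_real_def)
  obtain x' where x': "dist x' (eqpt (u + s)) < e / 2" "reaches x x'"
    using attract[of "u + s" "e / 2" x] p trs e(1) by auto
  obtain y' where y': "dist y' (eqpt (u - s)) < e / 2" "reaches y' y"
    using repel[of "u - s" "e / 2" y] p trs e(1) by auto
  have "dist x' (eqpt u) < e" "dist y' (eqpt u) < e"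
    using x'(1) y'(1) p dist_triangle[of x' "eqpt u" "eqpt (u + s)"] dist_triangle[of y' "eqpt u" "eqpt (u - s)"] by linarith+
  then show ?thesis using e(2) x'(2) y'(2) reaches_trans by meson
qed

end

context plane_system begin
text \<open>All matrices \<open>A - v B\<close> are multiples of the rotation generator \<open>J\<close>, and the centres of rotation fill a segment in
  direction \<open>e\<close>. Two half turns about distinct centres compose to a translation along \<open>e\<close>; conjugating with
  a quarter turn gives the translations along \<open>J e\<close>.\<close>
lemma reaches_all_if_trace_vanishes:
  assumes u0: "u0 \<in> {um<..<up}" and det: "det (M u0) > 0" and tr: "trace (M u0) = 0" and B: "trace B = 0"
  shows "reaches x y"
proof -
  define J where "J = M u0"
  define \<delta> where "\<delta> = det J"
  define \<omega> where "\<omega> = sqrt \<delta>"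
  have \<omega>: "\<omega> > 0" "\<delta> = \<omega> * \<omega>" using det by (auto simp: \<omega>_def \<delta>_def J_def)
  have JJ: "J *v (J *v z) = (- \<delta>) *\<^sub>R z" for z
    using tr by (simp add: J_def \<delta>_def cayley_hamilton_plane)
  have w: "wedge b (J *v b) \<noteq> 0" using eigenvector_free[OF det tr] by (simp add: J_def)
  obtain p q where pq: "B *v b = p *\<^sub>R b + q *\<^sub>R (J *v b)"
    using wedge_expand[OF w] by blast
  have BJ: "B *v (J *v b) = p *\<^sub>R (J *v b) + q *\<^sub>R (J *v (J *v b))"
  proof -
    have "B *v (J *v b) = J *v (B *v b)"
      by (simp add: J_def M_commute_vector)
    then show ?thesis by (simp add: pq mv.add_right mv.scaleR_right)
  qed
  have "2 * p * wedge b (J *v b) = trace B * wedge b (J *v b)"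
    unfolding trace_wedge by (simp add: pq BJ JJ wedge_simps)
  then have p: "p = 0" using B w by simp
  have Bq: "B *v z = q *\<^sub>R (J *v z)" for z
  proof -
    have "B *v (s *\<^sub>R b + t *\<^sub>R (J *v b)) = q *\<^sub>R (J *v (s *\<^sub>R b + t *\<^sub>R (J *v b)))" for s t
      using pq BJ p by (simp add: mv.add_right mv.scaleR_right scaleR_add_right mult.commute)
    then show ?thesis using wedge_expand[OF w, of z] by metis
  qed
  define k where "k = (\<lambda>v. 1 - (v - u0) * q)"
  have Mk: "M v = k v *\<^sub>R J" for v
  proof -
    have "M v *v z = (k v *\<^sub>R J) *v z" for z
    proof -
      have "M v *v z = J *v z - (v - u0) *\<^sub>R (B *v z)"
        by (simp add: J_def M_def mv.diff_left mv.scaleR_left algebra_simps)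
      then show ?thesis by (simp add: Bq k_def mv.scaleR_left algebra_simps)
    qed
    then show ?thesis by (simp add: matrix_eq)
  qed
  have detk: "det (M v) = k v * k v * \<delta>" for v
    unfolding Mk by (simp add: det_2 \<delta>_def algebra_simps)
  have k0: "k 0 \<noteq> 0" using det_A detk[of 0] by auto
  define e where "e = (1 / \<delta>) *\<^sub>R (J *v b)"
  \<comment> \<open>the position of the centre of rotation on the line spanned by \<open>e\<close>\<close>
  define \<kappa> where "\<kappa> = (\<lambda>v. v / k v)"
  have centre: "eqpt v = \<kappa> v *\<^sub>R e" if "k v > 0" for v
  proof (rule matrix_plane_injective)
    show det: "det (M v) \<noteq> 0" using that \<omega> by (simp add: detk)
    show "M v *v eqpt v = M v *v (\<kappa> v *\<^sub>R e)"
      unfolding eqpt_zero[OF det] using that \<omega>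
      by (simp add: Mk e_def \<kappa>_def mv.scaleR_left mv.scaleR_right JJ)
  qed
  have rot: "reaches z (\<kappa> v *\<^sub>R e + (cos \<phi> *\<^sub>R (z - \<kappa> v *\<^sub>R e) + (sin \<phi> / \<omega>) *\<^sub>R (J *v (z - \<kappa> v *\<^sub>R e))))"
    if "k v > 0" "v \<in> {um<..<up}" "\<phi> > 0" for v \<phi> z
  proof -
    define s where "s = \<phi> / (\<omega> * k v)"
    have s: "s > 0" "\<omega> * (s * k v) = \<phi>" using that \<omega> by (auto simp: s_def)
    have exp: "mat_exp (r *\<^sub>R J) *v z = exp (r * 0) *\<^sub>R (cos (\<omega> * r) *\<^sub>R z + (sin (\<omega> * r) / \<omega>) *\<^sub>R (J *v z - 0 *\<^sub>R z))" if "r \<ge> 0" for r z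
    proof (rule mat_exp_plane[where \<kappa> = "- \<delta>"])
      show "((\<lambda>r. cos (\<omega> * r)) has_real_derivative - \<delta> * (sin (\<omega> * s) / \<omega>)) (at s)" for s
        using \<omega> by (auto intro!: derivative_eq_intros)
      show "((\<lambda>r. sin (\<omega> * r) / \<omega>) has_real_derivative cos (\<omega> * s)) (at s)" for s
        using \<omega> by (auto intro!: derivative_eq_intros)
    qed (use that tr in \<open>auto simp: \<delta>_def J_def\<close>)
    have "E s (v * s) = mat_exp ((s * k v) *\<^sub>R J)"
      by (simp flip: rho_M add: rho_def Mk)
    then have "flow v s z = eqpt v + (cos \<phi> *\<^sub>R (z - eqpt v) + (sin \<phi> / \<omega>) *\<^sub>R (J *v (z - eqpt v)))"
      using flow_eqpt[of v s z] exp[of "s * k v"] s that \<omega> by (simp add: detk)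
    then have F: "flow v s z = \<kappa> v *\<^sub>R e + (cos \<phi> *\<^sub>R (z - \<kappa> v *\<^sub>R e) + (sin \<phi> / \<omega>) *\<^sub>R (J *v (z - \<kappa> v *\<^sub>R e)))"
      by (simp only: centre[OF that(1)])
    have R: "reaches z (flow v s z)" by (rule reaches_flow[OF s(1)]) (use that(2) in auto)
    show ?thesis by (rule back_subst[of "reaches z", OF R F])
  qed
  have half: "reaches z ((2 * \<kappa> v) *\<^sub>R e - z)" if "k v > 0" "v \<in> {um<..<up}" for v z
  proof -
    have F: "\<kappa> v *\<^sub>R e + (cos pi *\<^sub>R (z - \<kappa> v *\<^sub>R e) + (sin pi / \<omega>) *\<^sub>R (J *v (z - \<kappa> v *\<^sub>R e))) = (2 * \<kappa> v) *\<^sub>R e - z"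
      unfolding mult_2 scaleR_add_left by simp
    show ?thesis by (rule back_subst[of "reaches z", OF rot[OF that pi_gt_zero] F])
  qed
  have translate: "reaches z (z + (2 * (\<kappa> v' - \<kappa> v)) *\<^sub>R e)"
    if "k v > 0" "v \<in> {um<..<up}" "k v' > 0" "v' \<in> {um<..<up}" for v v' z
  proof -
    have F: "(2 * \<kappa> v') *\<^sub>R e - ((2 * \<kappa> v) *\<^sub>R e - z) = z + (2 * (\<kappa> v' - \<kappa> v)) *\<^sub>R e"
      by (simp add: right_diff_distrib scaleR_diff_left)
    show ?thesis
      by (rule back_subst[of "reaches z", OF reaches_trans[OF half[OF that(1,2)] half[OF that(3,4)]] F])
  qed
  have ku0: "k u0 = 1" by (simp add: k_def)
  have "\<forall>\<^sub>F v in at u0. k v > 0"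
    by (rule order_tendstoD(1)[of _ "k u0"]) (auto simp: k_def intro!: tendsto_eq_intros)
  moreover have "\<forall>\<^sub>F v in at u0. v \<in> {um<..<up}"
    using eventually_nhds_in_open[OF open_greaterThanLessThan u0] by (simp add: eventually_at_filter eventually_mono)
  ultimately have "\<forall>\<^sub>F v in at u0. k v > 0 \<and> v \<in> {um<..<up}" by eventually_elim auto
  then obtain r where r: "r > 0" "\<And>v. v \<noteq> u0 \<Longrightarrow> dist v u0 < r \<Longrightarrow> k v > 0 \<and> v \<in> {um<..<up}"
    unfolding eventually_at by auto
  then have r': "k v > 0 \<and> v \<in> {um<..<up}" if "v \<in> {u0..u0 + r / 2}" for v
    using that ku0 u0 r(1) by (cases "v = u0") (auto simp: dist_real_def)
  define v1 where "v1 = u0 + r / 2"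
  have v1: "k v1 > 0" "u0 < v1" using r' r(1) by (auto simp: v1_def)
  have "\<kappa> v1 \<noteq> \<kappa> u0"
  proof
    assume "\<kappa> v1 = \<kappa> u0"
    then have "v1 = u0 * k v1" using v1(1) by (simp add: \<kappa>_def ku0 nonzero_divide_eq_eq)
    moreover have "(v1 - u0) * k 0 = v1 - u0 * k v1" by (simp add: k_def algebra_simps)
    ultimately have "(v1 - u0) * k 0 = 0" by linarith
    then show False using k0 v1 by simp
  qed
  have cont: "continuous_on {u0..v1} \<kappa>"
    unfolding \<kappa>_def using r' by (intro continuous_intros) (force simp: k_def v1_def intro!: continuous_intros)+
  have small: "reaches z (z + t *\<^sub>R e)" if "\<bar>t\<bar> \<le> 2 * \<bar>\<kappa> v1 - \<kappa> u0\<bar>" for t z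
  proof -
    define a where "a = min (\<kappa> u0) (\<kappa> v1)"
    define a' where "a' = max (\<kappa> u0) (\<kappa> v1)"
    have attained: "\<exists>v\<in>{u0..v1}. \<kappa> v = s" if "a \<le> s" "s \<le> a'" for s
    proof (cases "\<kappa> u0 \<le> \<kappa> v1")
      case True
      then show ?thesis using IVT'[of \<kappa> u0 s v1] that v1 cont by (auto simp: a_def a'_def)
    next
      case False
      then show ?thesis using IVT2'[of \<kappa> v1 s u0] that v1 cont by (auto simp: a_def a'_def)
    qed
    have aa: "a' - a = \<bar>\<kappa> v1 - \<kappa> u0\<bar>" "a \<le> a'" by (auto simp: a_def a'_def)
    then have "a \<le> (if t \<ge> 0 then a else a')" "(if t \<ge> 0 then a else a') \<le> a'" by auto
    from attained[OF this] obtain v where v: "v \<in> {u0..v1}" "\<kappa> v = (if t \<ge> 0 then a else a')" by blast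
    have "a \<le> \<kappa> v + t / 2" "\<kappa> v + t / 2 \<le> a'"
      using that aa v(2) by (cases "t \<ge> 0"; simp; linarith)+
    from attained[OF this] obtain v' where v': "v' \<in> {u0..v1}" "\<kappa> v' = \<kappa> v + t / 2" by blast
    have "2 * (\<kappa> v' - \<kappa> v) = t" using v'(2) by simp
    moreover have "reaches z (z + (2 * (\<kappa> v' - \<kappa> v)) *\<^sub>R e)"
      using r' v(1) v'(1) by (intro translate) (auto simp: v1_def)
    ultimately show ?thesis by simp
  qed
  have along: "reaches z (z + t *\<^sub>R e)" for t z
  proof -
    define c where "c = 2 * \<bar>\<kappa> v1 - \<kappa> u0\<bar>"
    have "c > 0" using \<open>\<kappa> v1 \<noteq> \<kappa> u0\<close> by (simp add: c_def)
    obtain n :: nat where n: "\<bar>t\<bar> / c < real n" using reals_Archimedean2 by blast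
    then have npos: "n > 0" using \<open>c > 0\<close> by (cases n) (auto simp: divide_less_0_iff)
    have "\<bar>t / real n\<bar> \<le> c" using n npos \<open>c > 0\<close> by (simp add: divide_simps mult.commute)
    then have st: "reaches z (z + (t / real n) *\<^sub>R e)" for z using small by (simp add: c_def)
    have "reaches z (z + (real (Suc m) * (t / real n)) *\<^sub>R e)" for m
    proof (induction m)
      case (Suc m)
      have "(z + (real (Suc m) * (t / real n)) *\<^sub>R e) + (t / real n) *\<^sub>R e = z + (real (Suc (Suc m)) * (t / real n)) *\<^sub>R e"
        by (simp only: of_nat_Suc[of "Suc m"] distrib_right scaleR_add_left mult_1_left add_ac)
      then show ?case using reaches_trans[OF Suc st] by metis
    qed (use st in simp)
    from this[of "n - 1"] npos show ?thesis by simp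
  qed
  define Q where "Q = (\<lambda>z. u0 *\<^sub>R e + (1 / \<omega>) *\<^sub>R (J *v (z - u0 *\<^sub>R e)))"
  have Q: "reaches z (Q z)" for z
    using rot[of u0 "pi / 2" z] u0 by (simp add: ku0 \<kappa>_def Q_def)
  have QQ: "Q (Q z) = (2 * u0) *\<^sub>R e - z" for z
  proof -
    have "Q (Q z) = u0 *\<^sub>R e - (z - u0 *\<^sub>R e)" using \<omega> by (simp add: Q_def mv.scaleR_right JJ)
    then show ?thesis unfolding mult_2 scaleR_add_left by simp
  qed
  have across: "reaches z (z + t *\<^sub>R (J *v e))" for t z
  proof -
    have "reaches z (Q (Q (Q z)))" using Q reaches_trans by meson
    also have "reaches (Q (Q (Q z))) (Q (Q (Q z)) + (t * \<omega>) *\<^sub>R e)" by (rule along)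
    also have "reaches (Q (Q (Q z)) + (t * \<omega>) *\<^sub>R e) (Q (Q (Q (Q z)) + (t * \<omega>) *\<^sub>R e))" by (rule Q)
    also have "Q (Q (Q (Q z)) + (t * \<omega>) *\<^sub>R e) = Q (Q (Q (Q z))) + t *\<^sub>R (J *v e)"
      using \<omega> by (simp add: Q_def mv.add_right mv.diff_right mv.scaleR_right algebra_simps)
    also have "Q (Q (Q (Q z))) = z" by (simp add: QQ)
    finally show ?thesis .
  qed
  have we: "wedge e (J *v e) \<noteq> 0"
  proof -
    have "wedge e (J *v e) = (1 / \<delta>) * (1 / \<delta>) * (det J * wedge b (J *v b))"
      by (simp add: e_def mv.scaleR_right wedge_simps wedge_matrix)
    then show ?thesis using w \<omega> by (simp add: \<delta>_def)
  qed
  obtain s t where "y - x = s *\<^sub>R e + t *\<^sub>R (J *v e)" using wedge_expand[OF we] by blast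
  then have "y = x + s *\<^sub>R e + t *\<^sub>R (J *v e)" by (simp add: algebra_simps)
  then show ?thesis using reaches_trans[OF along[of x s] across[of "x + s *\<^sub>R e" t]] by simp
qed

lemma reaches_all:
  assumes "u \<in> {um<..<up}" "det (M u) > 0" "trace (M u) = 0"
  shows "reaches x y"
  using reaches_all_if_trace_changes_sign reaches_all_if_trace_vanishes assms by blast

end

section \<open>Piecewise constant controls and control sets\<close>

lemma locally_constant_at_iff_ball:
  "locally_constant_at u s \<longleftrightarrow> (\<exists>d>0. \<forall>r. dist r s < d \<longrightarrow> u r = u s)"
  unfolding locally_constant_at_def eventually_nhds_metric ..

lemma locally_constant_on_interval_const:
  assumes "\<And>s. s \<in> {a<..<b} \<Longrightarrow> locally_constant_at u s" "s \<in> {a<..<b}" "r \<in> {a<..<b}"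
  shows "u s = u r"
proof -
  have "(u has_real_derivative 0) (at x)" if "x \<in> {a<..<b}" for x
  proof -
    have "\<forall>\<^sub>F y in nhds x. u y = u x" using assms(1)[OF that] by (simp add: locally_constant_at_def)
    from DERIV_cong_ev[OF refl this refl] show ?thesis by simp
  qed
  then have "\<exists>c. \<forall>x\<in>{a<..<b}. u x = c"
    by (intro has_field_derivative_zero_constant[of "{a<..<b}" u]) (auto intro: has_field_derivative_at_within)
  then show ?thesis using assms(2,3) by metis
qed

text \<open>A transitive relation between times that holds across the constant pieces of a control holds between any two
  times. The induction is on the number of switching times in between.\<close>
lemma piecewise_induct:
  assumes u: "u \<in> controls \<Omega>"
    and const: "\<And>a b v. a < b \<Longrightarrow> v \<in> \<Omega> \<Longrightarrow> (\<And>s. s \<in> {a<..<b} \<Longrightarrow> locally_constant_at u s \<and> u s = v) \<Longrightarrow> R a b"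
    and trans: "\<And>a b c. a < b \<Longrightarrow> b < c \<Longrightarrow> R a b \<Longrightarrow> R b c \<Longrightarrow> R a c"
    and "a < b"
  shows "R (a::real) b"
  using \<open>a < b\<close>
proof (induction "card {s \<in> {a<..<b}. \<not> locally_constant_at u s}" arbitrary: a b rule: less_induct)
  case less
  have fin: "finite {s \<in> {a<..<b}. \<not> locally_constant_at u s}" for a b
  proof (rule finite_subset)
    show "finite {s \<in> {a..b}. \<not> locally_constant_at u s}" using u by (auto simp: controls_def)
  qed auto
  show ?case
  proof (cases "{s \<in> {a<..<b}. \<not> locally_constant_at u s} = {}")
    case True
    define v where "v = u ((a + b) / 2)"
    have lc: "locally_constant_at u s" if "s \<in> {a<..<b}" for s using True that by auto
    have "u s = v" if "s \<in> {a<..<b}" for s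
      unfolding v_def by (rule locally_constant_on_interval_const[OF lc that]) (use less.prems in auto)
    moreover have "v \<in> \<Omega>" using u by (auto simp: controls_def v_def)
    ultimately show ?thesis using const[OF less.prems, of v] lc by blast
  next
    case False
    then obtain m where m: "m \<in> {a<..<b}" "\<not> locally_constant_at u m" by auto
    have "{s \<in> {a<..<m}. \<not> locally_constant_at u s} \<subset> {s \<in> {a<..<b}. \<not> locally_constant_at u s}"
      "{s \<in> {m<..<b}. \<not> locally_constant_at u s} \<subset> {s \<in> {a<..<b}. \<not> locally_constant_at u s}"
      using m by auto
    then have "R a m" "R m b"
      using less.hyps m(1) psubset_card_mono[OF fin] by auto
    then show ?thesis using trans[of a m b] m(1) by auto
  qed
qed

text \<open>The value \<open>w\<close> at the junction is free, so that the junction can be made a switching time.\<close>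
definition concat_control :: "real \<Rightarrow> real \<Rightarrow> (real \<Rightarrow> real) \<Rightarrow> (real \<Rightarrow> real) \<Rightarrow> real \<Rightarrow> real" where
  "concat_control S w u1 u2 = (\<lambda>s. if s < S then u1 s else if s = S then w else u2 (s - S))"

lemma concat_control_locally_constant:
  assumes "s < S"
  shows "locally_constant_at (concat_control S w u1 u2) s \<longleftrightarrow> locally_constant_at u1 s"
proof -
  have "\<forall>\<^sub>F r in nhds s. r \<in> {..<S}" by (rule eventually_nhds_in_open) (use assms in auto)
  then have "\<forall>\<^sub>F r in nhds s. (concat_control S w u1 u2 r = concat_control S w u1 u2 s) = (u1 r = u1 s)"
    by eventually_elim (use assms in \<open>auto simp: concat_control_def\<close>)
  then show ?thesis unfolding locally_constant_at_def by (rule eventually_subst)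
qed

lemma locally_constant_at_shift:
  "locally_constant_at (\<lambda>s. u (s - S)) s \<longleftrightarrow> locally_constant_at u (s - S)"
proof -
  have "dist r s = dist (r - S) (s - S)" for r by (simp add: dist_real_def)
  then show ?thesis unfolding locally_constant_at_iff_ball by (metis add_diff_cancel_right')
qed

lemma concat_control_locally_constant':
  assumes "s > S"
  shows "locally_constant_at (concat_control S w u1 u2) s \<longleftrightarrow> locally_constant_at u2 (s - S)"
proof -
  have "\<forall>\<^sub>F r in nhds s. r \<in> {S<..}" by (rule eventually_nhds_in_open) (use assms in auto)
  then have "\<forall>\<^sub>F r in nhds s. (concat_control S w u1 u2 r = concat_control S w u1 u2 s) = (u2 (r - S) = u2 (s - S))"
    by eventually_elim (use assms in \<open>auto simp: concat_control_def\<close>)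
  then have "locally_constant_at (concat_control S w u1 u2) s \<longleftrightarrow> locally_constant_at (\<lambda>s. u2 (s - S)) s"
    unfolding locally_constant_at_def by (rule eventually_subst)
  then show ?thesis by (simp add: locally_constant_at_shift)
qed

lemma concat_control_in_controls:
  assumes "u1 \<in> controls \<Omega>" "u2 \<in> controls \<Omega>" "w \<in> \<Omega>"
  shows "concat_control S w u1 u2 \<in> controls \<Omega>"
  unfolding controls_def
proof (intro CollectI conjI allI)
  show "range (concat_control S w u1 u2) \<subseteq> \<Omega>"
    using assms by (auto simp: concat_control_def controls_def)
  fix a b
  have "{s \<in> {a..b}. \<not> locally_constant_at (concat_control S w u1 u2) s} \<subseteq>
     {S} \<union> {s \<in> {a..b}. \<not> locally_constant_at u1 s} \<union> (\<lambda>s. s + S) ` {s \<in> {a - S..b - S}. \<not> locally_constant_at u2 s}"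
  proof
    fix s assume s: "s \<in> {s \<in> {a..b}. \<not> locally_constant_at (concat_control S w u1 u2) s}"
    consider "s = S" | "s < S" | "s > S" by linarith
    then show "s \<in> {S} \<union> {s \<in> {a..b}. \<not> locally_constant_at u1 s} \<union> (\<lambda>s. s + S) ` {s \<in> {a - S..b - S}. \<not> locally_constant_at u2 s}"
    proof cases
      case 3
      then have "s - S \<in> {s \<in> {a - S..b - S}. \<not> locally_constant_at u2 s}"
        using s by (auto simp: concat_control_locally_constant')
      then have "(s - S) + S \<in> (\<lambda>s. s + S) ` {s \<in> {a - S..b - S}. \<not> locally_constant_at u2 s}" by (rule imageI)
      then show ?thesis by simp
    qed (use s in \<open>auto simp: concat_control_locally_constant\<close>)
  qed
  moreover have "finite \<dots>" using assms by (auto simp: controls_def)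
  ultimately show "finite {s \<in> {a..b}. \<not> locally_constant_at (concat_control S w u1 u2) s}" by (rule finite_subset)
qed

lemma constant_control: "v \<in> \<Omega> \<Longrightarrow> (\<lambda>_. v) \<in> controls \<Omega>"
  by (auto simp: controls_def locally_constant_at_def)

text \<open>If the concatenated control were locally constant at \<open>S\<close>, the curve would have to be differentiable there. One of the
  two values \<open>um\<close>, \<open>up\<close> at \<open>S\<close> differs from the values just before \<open>S\<close> and rules this out.\<close>
lemma vf_solution_concat:
  assumes u: "u1 \<in> controls {um..up}" "u2 \<in> controls {um..up}" and "um < up"
    and c1: "vf_solution f0 f1 u1 c1" and c2: "vf_solution f0 f1 u2 c2" and S: "c2 0 = c1 S"
  shows "\<exists>u\<in>controls {um..up}. vf_solution f0 f1 u (\<lambda>s. if s \<le> S then c1 s else c2 (s - S))"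
proof -
  have "\<exists>w\<in>{um, up}. \<not> locally_constant_at (concat_control S w u1 u2) S"
  proof (rule ccontr)
    assume "\<not> ?thesis"
    then have "locally_constant_at (concat_control S um u1 u2) S" "locally_constant_at (concat_control S up u1 u2) S" by auto
    then have "\<forall>\<^sub>F s in nhds S. concat_control S um u1 u2 s = um \<and> concat_control S up u1 u2 s = up"
      unfolding locally_constant_at_def by eventually_elim (simp add: concat_control_def)
    then obtain d where d: "d > 0" "\<And>s. dist s S < d \<Longrightarrow> concat_control S um u1 u2 s = um \<and> concat_control S up u1 u2 s = up"
      unfolding eventually_nhds_metric by blast
    from d(2)[of "S - d / 2"] d(1) \<open>um < up\<close> show False by (auto simp: concat_control_def dist_real_def split: if_splits)
  qed
  then obtain w where "w \<in> {um, up}" and not_lc: "\<not> locally_constant_at (concat_control S w u1 u2) S"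
    by blast
  then have w: "w \<in> {um..up}" "\<not> locally_constant_at (concat_control S w u1 u2) S"
    using \<open>um < up\<close> by auto
  let ?u = "concat_control S w u1 u2" and ?c = "\<lambda>s. if s \<le> S then c1 s else c2 (s - S)"
  have "vf_solution f0 f1 ?u ?c"
    unfolding vf_solution_def
  proof (intro conjI allI impI)
    have cont: "continuous_on UNIV c1" "continuous_on UNIV c2" using c1 c2 by (auto simp: vf_solution_def)
    show "continuous_on UNIV ?c"
      by (intro continuous_on_cases_le continuous_on_subset[OF cont(1)] continuous_on_compose2[OF cont(2)] continuous_intros)
         (auto simp: S)
    fix s assume lc: "locally_constant_at ?u s"
    then have "s \<noteq> S" using w(2) by auto
    then consider "s < S" | "s > S" by linarith
    then show "(?c has_vector_derivative f0 (?c s) + ?u s *\<^sub>R f1 (?c s)) (at s)"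
    proof cases
      case 1
      then have "locally_constant_at u1 s" using lc by (simp add: concat_control_locally_constant)
      then have "(c1 has_vector_derivative f0 (c1 s) + u1 s *\<^sub>R f1 (c1 s)) (at s)" using c1 by (simp add: vf_solution_def)
      then have "(?c has_vector_derivative f0 (c1 s) + u1 s *\<^sub>R f1 (c1 s)) (at s)"
        by (rule has_vector_derivative_transform_within_open[of _ _ _ "{..<S}"]) (use 1 in auto)
      then show ?thesis using 1 by (simp add: concat_control_def)
    next
      case 2
      then have "locally_constant_at u2 (s - S)" using lc by (simp add: concat_control_locally_constant')
      then have "(c2 has_vector_derivative f0 (c2 (s - S)) + u2 (s - S) *\<^sub>R f1 (c2 (s - S))) (at (s + - S))" using c2 by (simp add: vf_solution_def)
      from has_vector_derivative_shift[OF this]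
      have "((\<lambda>s. c2 (s - S)) has_vector_derivative f0 (c2 (s - S)) + u2 (s - S) *\<^sub>R f1 (c2 (s - S))) (at s)" by simp
      then have "(?c has_vector_derivative f0 (c2 (s - S)) + u2 (s - S) *\<^sub>R f1 (c2 (s - S))) (at s)"
        by (rule has_vector_derivative_transform_within_open[of _ _ _ "{S<..}"]) (use 2 in auto)
      then show ?thesis using 2 by (simp add: concat_control_def)
    qed
  qed
  moreover have "?u \<in> controls {um..up}" using concat_control_in_controls u w(1) by blast
  ultimately show ?thesis by blast
qed

text \<open>The two properties of positive orbits that the general theory of control sets rests on: transitivity, and lower
  semicontinuity in the initial point.\<close>
locale orbit_system =
  fixes \<Omega> :: "real set" and sol :: "(real \<Rightarrow> real) \<Rightarrow> (real \<Rightarrow> 'a::metric_space) \<Rightarrow> bool"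
  assumes orbit_trans: "y \<in> positive_orbit \<Omega> sol x \<Longrightarrow> z \<in> positive_orbit \<Omega> sol y \<Longrightarrow> z \<in> positive_orbit \<Omega> sol x"
    and orbit_lsc: "z \<in> positive_orbit \<Omega> sol y \<Longrightarrow> e > 0 \<Longrightarrow>
      \<exists>d>0. \<forall>y'. dist y' y < d \<longrightarrow> (\<exists>z'\<in>positive_orbit \<Omega> sol y'. dist z' z < e)"
begin

lemma closure_orbit_trans:
  assumes y: "y \<in> closure (positive_orbit \<Omega> sol x)" and z: "z \<in> closure (positive_orbit \<Omega> sol y)"
  shows "z \<in> closure (positive_orbit \<Omega> sol x)"
  unfolding closure_approachable
proof (intro allI impI)
  fix e :: real assume "e > 0"
  then obtain z' where z': "z' \<in> positive_orbit \<Omega> sol y" "dist z' z < e / 2"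
    using z unfolding closure_approachable by (meson half_gt_zero)
  obtain d where d: "d > 0" "\<And>y'. dist y' y < d \<Longrightarrow> \<exists>z''\<in>positive_orbit \<Omega> sol y'. dist z'' z' < e / 2"
    using orbit_lsc[OF z'(1), of "e / 2"] \<open>e > 0\<close> by auto
  obtain y' where y': "y' \<in> positive_orbit \<Omega> sol x" "dist y' y < d"
    using y d(1) unfolding closure_approachable by blast
  obtain z'' where z'': "z'' \<in> positive_orbit \<Omega> sol y'" "dist z'' z' < e / 2" using d(2)[OF y'(2)] by blast
  have "dist z'' z < e" using dist_triangle[of z'' z z'] z''(2) z'(2) by linarith
  then show "\<exists>y\<in>positive_orbit \<Omega> sol x. dist y z < e" using orbit_trans[OF y'(1) z''(1)] by blast
qed

text \<open>The union of the two sets satisfies the first two axioms of a control set, so maximality makes both equal to it.\<close>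
lemma control_sets_equal:
  assumes D: "control_set euclidean \<Omega> sol D" and D': "control_set euclidean \<Omega> sol D'"
    and x: "x \<in> D" "y \<in> D'" "y \<in> closure (positive_orbit \<Omega> sol x)"
    and x': "x' \<in> D" "y' \<in> D'" "x' \<in> closure (positive_orbit \<Omega> sol y')"
  shows "D = D'"
proof -
  have pre: "pre_control_set euclidean \<Omega> sol D" "pre_control_set euclidean \<Omega> sol D'"
    using D D' by (auto simp: control_set_def)
  have cl: "\<And>p q. p \<in> D \<Longrightarrow> q \<in> D \<Longrightarrow> q \<in> closure (positive_orbit \<Omega> sol p)"
    "\<And>p q. p \<in> D' \<Longrightarrow> q \<in> D' \<Longrightarrow> q \<in> closure (positive_orbit \<Omega> sol p)"
    using pre by (auto simp: pre_control_set_def)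
  have "pre_control_set euclidean \<Omega> sol (D \<union> D')"
    unfolding pre_control_set_def
  proof (intro conjI ballI)
    fix p assume p: "p \<in> D \<union> D'"
    show "\<exists>u\<in>controls \<Omega>. \<exists>c. sol u c \<and> c 0 = p \<and> c ` {0..} \<subseteq> D \<union> D'"
      using p pre unfolding pre_control_set_def by (meson UnE le_supI1 le_supI2)
    have "q \<in> closure (positive_orbit \<Omega> sol p)" if q: "q \<in> D \<union> D'" for q
    proof -
      consider "p \<in> D" "q \<in> D" | "p \<in> D'" "q \<in> D'" | "p \<in> D" "q \<in> D'" | "p \<in> D'" "q \<in> D" using p q by blast
      then show ?thesis
      proof cases
        case 3
        then show ?thesis
          using closure_orbit_trans[OF closure_orbit_trans[OF cl(1)[of p x] x(3)] cl(2)[of y q]] x by blast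
      next
        case 4
        then show ?thesis
          using closure_orbit_trans[OF closure_orbit_trans[OF cl(2)[of p y'] x'(3)] cl(1)[of x' q]] x' by blast
      qed (use cl in auto)
    qed
    then show "D \<union> D' \<subseteq> euclidean closure_of positive_orbit \<Omega> sol p" by auto
  qed auto
  then show ?thesis using D D' unfolding control_set_def by (metis sup_ge1 sup_ge2)
qed

lemma control_sets_equal_if_intersect:
  assumes "control_set euclidean \<Omega> sol D" "control_set euclidean \<Omega> sol D'" "x \<in> D" "x \<in> D'"
  shows "D = D'"
proof -
  have "x \<in> closure (positive_orbit \<Omega> sol x)"
    using assms unfolding control_set_def pre_control_set_def by auto
  then show ?thesis using control_sets_equal assms by blast
qed

end

section \<open>The control set around the origin\<close>

lemma Lam_scaleR: "Lam M t (c *\<^sub>R w) = c *\<^sub>R Lam M t w"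
proof -
  let ?f = "\<lambda>t. Lam M t (c *\<^sub>R w) - c *\<^sub>R Lam M t w"
  have "(?f has_vector_derivative rho M t *v (c *\<^sub>R w) - c *\<^sub>R (rho M t *v w)) (at t)" for t
    by (intro has_vector_derivative_diff Lam_has_vector_derivative
        bounded_linear.has_vector_derivative[OF bounded_linear_scaleR_right Lam_has_vector_derivative])
  then have "(?f has_vector_derivative 0) (at t)" for t by (simp add: mv.scaleR_right)
  from constant_if_vector_derivative_0[of ?f, OF this, of t 0] show ?thesis by simp
qed

context plane_system begin

abbreviation sol2 :: "(real \<Rightarrow> real) \<Rightarrow> (real \<Rightarrow> plane) \<Rightarrow> bool" where
  "sol2 \<equiv> vf_solution (\<lambda>x. A *v x) (\<lambda>x. b - B *v x)"

lemma planar_field: "A *v x + v *\<^sub>R (b - B *v x) = M v *v x + v *\<^sub>R b"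
  by (simp add: M_def mv.diff_left mv.scaleR_left scaleR_diff_right)

lemma constant_piece:
  assumes "r < s" "continuous_on UNIV c"
    and "\<And>q. q \<in> {r<..<s} \<Longrightarrow> (c has_vector_derivative A *v c q + v *\<^sub>R (b - B *v c q)) (at q)"
  shows "c s = flow v (s - r) (c r)"
  using affine_ode_unique[of r s c "M v" "v *\<^sub>R b"] assms
  by (simp add: planar_field flow_def Lam_scaleR continuous_on_subset)

lemma sol2_reach:
  assumes u: "u \<in> controls {um..up}" and c: "sol2 u c" and "r < s"
  shows "\<exists>\<tau>. reach (s - r) \<tau> (c r) (c s)"
  using \<open>r < s\<close>
proof (rule piecewise_induct[OF u, rotated -1])
  fix a b' v assume *: "a < b'" "v \<in> {um..up}" "\<And>s. s \<in> {a<..<b'} \<Longrightarrow> locally_constant_at u s \<and> u s = v"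
  have "c b' = flow v (b' - a) (c a)"
    by (rule constant_piece) (use * c in \<open>auto simp: vf_solution_def\<close>)
  then show "\<exists>\<tau>. reach (b' - a) \<tau> (c a) (c b')"
    using reach.step[of "b' - a" v "c a"] * by auto
next
  fix a b' d assume "\<exists>\<tau>. reach (b' - a) \<tau> (c a) (c b')" "\<exists>\<tau>. reach (d - b') \<tau> (c b') (c d)"
  then obtain \<tau> \<tau>' where "reach (b' - a) \<tau> (c a) (c b')" "reach (d - b') \<tau>' (c b') (c d)" by blast
  from reach.trans[OF this] show "\<exists>\<tau>. reach (d - a) \<tau> (c a) (c d)" by auto
qed

definition h0 :: plane where "h0 = (SOME c. \<exists>e. core c e)"

text \<open>The points that reach the hub \<open>h0\<close> and lie in the closure of its orbit. A point whose orbit closure contains \<open>h0\<close>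
  also reaches \<open>h0\<close> itself, so this is the control set of \<open>h0\<close>.\<close>
definition region :: "plane set" where
  "region = closure {y. reaches h0 y} \<inter> {x. reaches x h0}"

lemma h0_core: obtains e where "core h0 e"
  using someI_ex[OF core_exists] unfolding h0_def by blast

lemma h0_hub: "hub h0"
  using h0_core core_def by metis

lemma closure_reaches_trans:
  assumes y: "y \<in> closure {y. reaches x y}" and z: "reaches y z"
  shows "z \<in> closure {z. reaches x z}"
  unfolding closure_approachable
proof (intro allI impI)
  fix e :: real assume "e > 0"
  obtain S \<tau> where r: "reach S \<tau> y z" using z unfolding reaches_def by blast
  obtain d where d: "d > 0" "\<And>y'. dist y' y < d \<Longrightarrow> \<exists>z'. reach S \<tau> y' z' \<and> dist z' z < e"
    using reach_lower_semicontinuous[OF r \<open>e > 0\<close>] by blast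
  obtain y' where y': "reaches x y'" "dist y' y < d"
    using y d(1) unfolding closure_approachable by blast
  then show "\<exists>z'\<in>{z. reaches x z}. dist z' z < e"
    using d(2)[OF y'(2)] reaches_trans[OF y'(1) reachesI] by blast
qed

lemma region_if_mutual: "reaches h0 x \<Longrightarrow> reaches x h0 \<Longrightarrow> x \<in> region"
  unfolding region_def using closure_subset by fastforce

lemma region_path:
  assumes "x \<in> region" "reaches x y" "reaches y h0"
  shows "y \<in> region"
  using assms closure_reaches_trans unfolding region_def by blast

lemma region_interior: "h0 \<in> interior region"
proof -
  obtain e where e: "e > 0" "\<And>y. dist y h0 < e \<Longrightarrow> reaches h0 y \<and> reaches y h0"
    using h0_hub unfolding hub_def by blast
  then have "ball h0 e \<subseteq> region" using region_if_mutual by (auto simp: dist_commute)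
  then show ?thesis using e(1) unfolding mem_interior by blast
qed

lemma hub_in_interior_region:
  assumes "hub c" "reaches h0 c" "reaches c h0"
  shows "c \<in> interior region"
proof -
  obtain e where e: "e > 0" "\<And>y. dist y c < e \<Longrightarrow> reaches c y \<and> reaches y c"
    using assms(1) unfolding hub_def by blast
  then have "ball c e \<subseteq> region" using region_if_mutual assms reaches_trans by (metis dist_commute mem_ball subsetI)
  then show ?thesis using e(1) unfolding mem_interior by blast
qed

lemma zero_in_closure_region: "0 \<in> closure region"
proof -
  obtain e where e: "core h0 e" using h0_core .
  have "(eqpt \<longlongrightarrow> eqpt 0) (at 0)" using eqpt_isCont[of 0] det_A by (simp add: isCont_def)
  then have lim: "\<forall>\<^sub>F v in at 0. dist (eqpt v) 0 < d" if "d > 0" for d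
    using tendstoD[of eqpt "eqpt 0" "at 0" d] that by simp
  have "eqpt v \<in> region" if "0 < \<bar>v\<bar> \<and> \<bar>v\<bar> < e" for v
    using e region_if_mutual that unfolding core_def by blast
  then have ev: "\<forall>\<^sub>F v in at 0. eqpt v \<in> region"
    unfolding eventually_at using e by (intro exI[of _ e]) (auto simp: core_def)
  show ?thesis
    unfolding closure_approachable
  proof (intro allI impI)
    fix d :: real assume "d > 0"
    from ev lim[OF this] have "\<forall>\<^sub>F v in at 0. eqpt v \<in> region \<and> dist (eqpt v) 0 < d"
      by eventually_elim auto
    then obtain v where "eqpt v \<in> region \<and> dist (eqpt v) 0 < d"
      using eventually_happens[of _ "at (0::real)"] by auto
    then show "\<exists>y\<in>region. dist y 0 < d" by blast
  qed
qed

lemma reaches_h0_if_stable: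
  assumes "det A > 0" "trace A < 0"
  shows "reaches x h0"
proof -
  obtain e where e: "core h0 e" using h0_core .
  have "\<forall>\<^sub>F v in at 0. trace (M v) < 0" "\<forall>\<^sub>F v in at 0. det (M v) > 0"
    using order_tendstoD(2)[OF trace_det_M_tendsto(2)[of 0]] order_tendstoD(1)[OF trace_det_M_tendsto(1)[of 0]] assms by simp_all
  then have "\<forall>\<^sub>F v in at 0. trace (M v) < 0 \<and> det (M v) > 0" by eventually_elim auto
  then obtain e' where e': "e' > 0" "\<And>v. 0 < \<bar>v\<bar> \<and> \<bar>v\<bar> < e' \<Longrightarrow> trace (M v) < 0 \<and> det (M v) > 0"
    by (rule eventually_small) blast
  define v where "v = min e e' / 2"
  have v: "0 < \<bar>v\<bar> \<and> \<bar>v\<bar> < e" "0 < \<bar>v\<bar> \<and> \<bar>v\<bar> < e'" using e e' unfolding core_def v_def by auto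
  then have c: "v \<in> {um<..<up}" "hub (eqpt v)" "reaches (eqpt v) h0" using e unfolding core_def by blast+
  obtain r where r: "r > 0" "\<And>y. dist y (eqpt v) < r \<Longrightarrow> reaches y (eqpt v)" using c(2) unfolding hub_def by blast
  obtain y where "dist y (eqpt v) < r" "reaches x y" using attract[of v r x] e'(2)[OF v(2)] c(1) r(1) by auto
  then show ?thesis using r(2) c(3) reaches_trans by blast
qed

lemma region_closed_if_stable:
  assumes "det A > 0" "trace A < 0"
  shows "closed region"
proof -
  have "reaches x h0" for x by (rule reaches_h0_if_stable[OF assms])
  then show ?thesis unfolding region_def by simp
qed

lemma reaches_h0_open: "open {x. reaches x h0}"
  unfolding open_contains_ball
proof (rule ballI)
  fix x assume "x \<in> {x. reaches x h0}"
  then obtain S \<tau> where r: "reach S \<tau> x h0" unfolding reaches_def by blast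
  obtain e where e: "e > 0" "\<And>y. dist y h0 < e \<Longrightarrow> reaches y h0" using h0_hub unfolding hub_def by blast
  obtain d where d: "d > 0" "\<And>x'. dist x' x < d \<Longrightarrow> \<exists>y. reach S \<tau> x' y \<and> dist y h0 < e"
    using reach_lower_semicontinuous[OF r e(1)] by blast
  have "reaches x' h0" if "dist x' x < d" for x'
    using d(2)[OF that] e(2) reaches_trans[OF reachesI] by blast
  then show "\<exists>e>0. ball x e \<subseteq> {x. reaches x h0}"
    using d(1) by (intro exI[of _ d]) (auto simp: dist_commute)
qed

lemma reached_from_h0_if_unstable:
  assumes "det A > 0" "trace A > 0"
  shows "reaches h0 x"
proof -
  obtain e where e: "core h0 e" using h0_core .
  have "\<forall>\<^sub>F v in at 0. trace (M v) > 0" "\<forall>\<^sub>F v in at 0. det (M v) > 0"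
    using order_tendstoD(1)[OF trace_det_M_tendsto(2)[of 0]] order_tendstoD(1)[OF trace_det_M_tendsto(1)[of 0]] assms by simp_all
  then have "\<forall>\<^sub>F v in at 0. trace (M v) > 0 \<and> det (M v) > 0" by eventually_elim auto
  then obtain e' where e': "e' > 0" "\<And>v. 0 < \<bar>v\<bar> \<and> \<bar>v\<bar> < e' \<Longrightarrow> trace (M v) > 0 \<and> det (M v) > 0"
    by (rule eventually_small) blast
  define v where "v = min e e' / 2"
  have v: "0 < \<bar>v\<bar> \<and> \<bar>v\<bar> < e" "0 < \<bar>v\<bar> \<and> \<bar>v\<bar> < e'" using e e' unfolding core_def v_def by auto
  then have c: "v \<in> {um<..<up}" "hub (eqpt v)" "reaches h0 (eqpt v)" using e unfolding core_def by blast+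
  obtain r where r: "r > 0" "\<And>y. dist y (eqpt v) < r \<Longrightarrow> reaches (eqpt v) y" using c(2) unfolding hub_def by blast
  obtain y where "dist y (eqpt v) < r" "reaches y x" using repel[of v r x] e'(2)[OF v(2)] c(1) r(1) by auto
  then show ?thesis using r(2) c(3) reaches_trans by blast
qed

lemma region_open_if_unstable:
  assumes "det A > 0" "trace A > 0"
  shows "open region"
proof -
  have "reaches h0 x" for x by (rule reached_from_h0_if_unstable[OF assms])
  then have "{y. reaches h0 y} = UNIV" by auto
  then show ?thesis unfolding region_def using reaches_h0_open by simp
qed

lemma region_UNIV:
  assumes "u \<in> {um<..<up}" "det (M u) > 0" "trace (M u) = 0"
  shows "region = UNIV"
proof -
  have "{y. reaches h0 y} = UNIV" "{x. reaches x h0} = UNIV" using reaches_all[OF assms] by auto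
  then show ?thesis unfolding region_def by simp
qed

end

text \<open>The planar system together with the drift \<open>t = \<alpha> \<integral>u\<close>; \<open>sol3\<close> is the full system in the coordinates \<open>(t, x)\<close>.\<close>
locale plane_system_lift = plane_system +
  fixes \<alpha> :: real
  assumes \<alpha>: "\<alpha> \<noteq> 0"
begin

abbreviation sol3 :: "(real \<Rightarrow> real) \<Rightarrow> (real \<Rightarrow> real \<times> plane) \<Rightarrow> bool" where
  "sol3 \<equiv> vf_solution (\<lambda>p. (0, A *v snd p)) (\<lambda>p. (\<alpha>, b - B *v snd p))"

lemma has_vector_derivative_fst_snd:
  assumes "(c has_vector_derivative d) (at s)"
  shows "((\<lambda>s. fst (c s)) has_vector_derivative fst d) (at s)" "((\<lambda>s. snd (c s)) has_vector_derivative snd d) (at s)"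
  using assms by (auto intro: bounded_linear.has_vector_derivative bounded_linear_fst bounded_linear_snd)

lemma sol3_snd: "sol3 u c \<Longrightarrow> sol2 u (\<lambda>s. snd (c s))"
  unfolding vf_solution_def
proof (intro conjI allI impI)
  assume c: "continuous_on UNIV c \<and> (\<forall>s. locally_constant_at u s \<longrightarrow>
    (c has_vector_derivative (0, A *v snd (c s)) + u s *\<^sub>R (\<alpha>, b - B *v snd (c s))) (at s))"
  then show "continuous_on UNIV (\<lambda>s. snd (c s))" by (auto intro: continuous_on_snd)
  fix s assume "locally_constant_at u s"
  with c have "(c has_vector_derivative (0, A *v snd (c s)) + u s *\<^sub>R (\<alpha>, b - B *v snd (c s))) (at s)" by blast
  from has_vector_derivative_fst_snd(2)[OF this]
  show "((\<lambda>s. snd (c s)) has_vector_derivative A *v snd (c s) + u s *\<^sub>R (b - B *v snd (c s))) (at s)" by simp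
qed

lemma sol3_reach:
  assumes u: "u \<in> controls {um..up}" and c: "sol3 u c" and "r < s"
  shows "reach (s - r) ((fst (c s) - fst (c r)) / \<alpha>) (snd (c r)) (snd (c s))"
  using \<open>r < s\<close>
proof (rule piecewise_induct[OF u, rotated -1])
  fix a b' v assume *: "a < b'" "v \<in> {um..up}" "\<And>s. s \<in> {a<..<b'} \<Longrightarrow> locally_constant_at u s \<and> u s = v"
  have cont: "continuous_on UNIV c" using c by (simp add: vf_solution_def)
  have der: "(c has_vector_derivative (v * \<alpha>, A *v snd (c q) + v *\<^sub>R (b - B *v snd (c q)))) (at q)" if "q \<in> {a<..<b'}" for q
    using c *(3)[OF that] unfolding vf_solution_def by auto
  have "snd (c b') = flow v (b' - a) (snd (c a))"
    by (rule constant_piece) (use *(1) has_vector_derivative_fst_snd(2)[OF der] cont in \<open>auto intro: continuous_on_snd\<close>)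
  moreover have "fst (c b') - v * \<alpha> * b' = fst (c a) - v * \<alpha> * a"
  proof (rule DERIV_isconst2[of a b' "\<lambda>q. fst (c q) - v * \<alpha> * q"])
    show "continuous_on {a..b'} (\<lambda>q. fst (c q) - v * \<alpha> * q)"
      using continuous_on_subset[OF cont] by (intro continuous_intros) auto
    fix q assume "a < q" "q < b'"
    then have "((\<lambda>q. fst (c q)) has_real_derivative v * \<alpha>) (at q)"
      using has_vector_derivative_fst_snd(1)[OF der[of q]] by (simp add: has_real_derivative_iff_has_vector_derivative)
    then show "((\<lambda>q. fst (c q) - v * \<alpha> * q) has_real_derivative 0) (at q)"
      by (auto intro!: derivative_eq_intros)
  qed (use *(1) in auto)
  then have "(fst (c b') - fst (c a)) / \<alpha> = v * (b' - a)"
    using \<alpha> by (simp add: field_simps)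
  ultimately show "reach (b' - a) ((fst (c b') - fst (c a)) / \<alpha>) (snd (c a)) (snd (c b'))"
    using reach.step[of "b' - a" v "snd (c a)"] * by simp
next
  fix a b' d assume "reach (b' - a) ((fst (c b') - fst (c a)) / \<alpha>) (snd (c a)) (snd (c b'))"
    "reach (d - b') ((fst (c d) - fst (c b')) / \<alpha>) (snd (c b')) (snd (c d))"
  from reach.trans[OF this] show "reach (d - a) ((fst (c d) - fst (c a)) / \<alpha>) (snd (c a)) (snd (c d))"
    by (simp add: add_divide_distrib[symmetric])
qed

lemma sol3_constant: "sol3 (\<lambda>_. v) (\<lambda>s. (t + \<alpha> * (v * s), flow v s x))"
  unfolding vf_solution_def
proof (intro conjI allI impI)
  have der: "((\<lambda>s. (t + \<alpha> * (v * s), flow v s x)) has_vector_derivative (\<alpha> * v, M v *v flow v s x + v *\<^sub>R b)) (at s)" for s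
    by (intro has_vector_derivative_Pair flow_has_vector_derivative)
       (auto simp flip: has_real_derivative_iff_has_vector_derivative intro!: derivative_eq_intros)
  show "continuous_on UNIV (\<lambda>s. (t + \<alpha> * (v * s), flow v s x))"
    using has_vector_derivative_continuous[OF der] by (simp add: continuous_at_imp_continuous_on)
  fix s
  show "((\<lambda>s. (t + \<alpha> * (v * s), flow v s x)) has_vector_derivative
      (0, A *v snd (t + \<alpha> * (v * s), flow v s x)) + v *\<^sub>R (\<alpha>, b - B *v snd (t + \<alpha> * (v * s), flow v s x))) (at s)"
    using der[of s] by (simp add: planar_field mult.commute)
qed

lemma reach_sol3:
  "reach S \<tau> x y \<Longrightarrow> \<exists>u\<in>controls {um..up}. \<exists>c. sol3 u c \<and> c 0 = (t, x) \<and> c S = (t + \<alpha> * \<tau>, y)"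
proof (induction arbitrary: t rule: reach.induct)
  case (step s u x)
  then show ?case using sol3_constant[of u t x] constant_control[of u "{um..up}"]
    by (intro bexI[of _ "\<lambda>_. u"] exI[of _ "\<lambda>s. (t + \<alpha> * (u * s), flow u s x)"]) auto
next
  case (trans S \<tau> x y S' \<tau>' z)
  obtain u1 c1 where 1: "u1 \<in> controls {um..up}" "sol3 u1 c1" "c1 0 = (t, x)" "c1 S = (t + \<alpha> * \<tau>, y)"
    using trans.IH(1) by blast
  obtain u2 c2 where 2: "u2 \<in> controls {um..up}" "sol3 u2 c2" "c2 0 = (t + \<alpha> * \<tau>, y)" "c2 S' = (t + \<alpha> * \<tau> + \<alpha> * \<tau>', z)"
    using trans.IH(2) by blast
  have "S > 0" "S' > 0" using trans.hyps reach_bounds by blast+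
  moreover obtain u where "u \<in> controls {um..up}" "sol3 u (\<lambda>s. if s \<le> S then c1 s else c2 (s - S))"
    using vf_solution_concat[OF 1(1) 2(1) _ 1(2) 2(2), of S] 1(4) 2(3) um up by auto
  ultimately show ?case
    by (intro bexI[of _ u] exI[of _ "\<lambda>s. if s \<le> S then c1 s else c2 (s - S)"]) (auto simp: 1 2 algebra_simps)
qed

lemma positive_orbit3: "(t', y) \<in> positive_orbit {um..up} sol3 (t, x) \<longleftrightarrow> (\<exists>S. reach S ((t' - t) / \<alpha>) x y)"
proof
  assume "(t', y) \<in> positive_orbit {um..up} sol3 (t, x)"
  then obtain c S u where c: "c S = (t', y)" "S > 0" "u \<in> controls {um..up}" "sol3 u c" "c 0 = (t, x)"
    unfolding positive_orbit_def by auto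
  from sol3_reach[OF c(3,4,2)] c show "\<exists>S. reach S ((t' - t) / \<alpha>) x y" by auto
next
  assume "\<exists>S. reach S ((t' - t) / \<alpha>) x y"
  then obtain S where S: "reach S ((t' - t) / \<alpha>) x y" by blast
  obtain u c where c: "u \<in> controls {um..up}" "sol3 u c" "c 0 = (t, x)" "c S = (t + \<alpha> * ((t' - t) / \<alpha>), y)"
    using reach_sol3[OF S] by blast
  then have "c S = (t', y)" using \<alpha> by simp
  moreover have "S > 0" using reach_bounds[OF S] by simp
  ultimately show "(t', y) \<in> positive_orbit {um..up} sol3 (t, x)"
    unfolding positive_orbit_def using c
    by (intro CollectI exI[of _ c] exI[of _ S] exI[of _ u]) auto
qed

lemma positive_orbit2: "positive_orbit {um..up} sol2 x = {y. reaches x y}"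
proof (intro equalityI subsetI CollectI)
  fix y assume "y \<in> positive_orbit {um..up} sol2 x"
  then obtain c S u where c: "c S = y" "S > 0" "u \<in> controls {um..up}" "sol2 u c" "c 0 = x"
    unfolding positive_orbit_def by auto
  from sol2_reach[OF c(3,4,2)] c show "reaches x y" unfolding reaches_def by auto
next
  fix y assume "y \<in> {y. reaches x y}"
  then obtain S \<tau> where S: "reach S \<tau> x y" unfolding reaches_def by blast
  obtain u c where c: "u \<in> controls {um..up}" "sol3 u c" "c 0 = (0, x)" "c S = (0 + \<alpha> * \<tau>, y)"
    using reach_sol3[OF S] by blast
  then have "sol2 u (\<lambda>s. snd (c s))" "snd (c 0) = x" "snd (c S) = y" using sol3_snd by auto
  moreover have "S > 0" using reach_bounds[OF S] by simp
  ultimately show "y \<in> positive_orbit {um..up} sol2 x"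
    unfolding positive_orbit_def using c(1)
    by (intro CollectI exI[of _ "\<lambda>s. snd (c s)"] exI[of _ S] exI[of _ u]) auto
qed

sublocale planar: orbit_system "{um..up}" sol2
proof
  fix x y z :: plane and e :: real
  show "y \<in> positive_orbit {um..up} sol2 x \<Longrightarrow> z \<in> positive_orbit {um..up} sol2 y \<Longrightarrow> z \<in> positive_orbit {um..up} sol2 x"
    unfolding positive_orbit2 using reaches_trans by blast
  assume z: "z \<in> positive_orbit {um..up} sol2 y" and "e > 0"
  then obtain S \<tau> where r: "reach S \<tau> y z" unfolding positive_orbit2 reaches_def by blast
  obtain d where d: "d > 0" "\<And>y'. dist y' y < d \<Longrightarrow> \<exists>z'. reach S \<tau> y' z' \<and> dist z' z < e"
    using reach_lower_semicontinuous[OF r \<open>e > 0\<close>] by blast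
  then show "\<exists>d>0. \<forall>y'. dist y' y < d \<longrightarrow> (\<exists>z'\<in>positive_orbit {um..up} sol2 y'. dist z' z < e)"
    unfolding positive_orbit2 using reachesI by (intro exI[of _ d]) blast
qed

sublocale lifted: orbit_system "{um..up}" sol3
proof
  fix x y z :: "real \<times> plane" and e :: real
  show "z \<in> positive_orbit {um..up} sol3 x"
    if yz: "y \<in> positive_orbit {um..up} sol3 x" "z \<in> positive_orbit {um..up} sol3 y"
  proof -
    obtain t x0 t' y0 t'' z0 where xyz: "x = (t, x0)" "y = (t', y0)" "z = (t'', z0)" by (metis surj_pair)
    obtain S S' where "reach S ((t' - t) / \<alpha>) x0 y0" "reach S' ((t'' - t') / \<alpha>) y0 z0"
      using yz unfolding xyz positive_orbit3 by blast
    from reach.trans[OF this] show ?thesis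
      unfolding xyz positive_orbit3 by (auto simp flip: add_divide_distrib)
  qed
  assume z: "z \<in> positive_orbit {um..up} sol3 y" and "e > 0"
  obtain t' y0 t'' z0 where yz: "y = (t', y0)" "z = (t'', z0)" by (metis surj_pair)
  obtain S where r: "reach S ((t'' - t') / \<alpha>) y0 z0" using z unfolding yz positive_orbit3 by blast
  have "e / 2 > 0" using \<open>e > 0\<close> by simp
  from reach_lower_semicontinuous[OF r this]
  obtain d where d: "d > 0" "\<And>y1. dist y1 y0 < d \<Longrightarrow> \<exists>z1. reach S ((t'' - t') / \<alpha>) y1 z1 \<and> dist z1 z0 < e / 2" by blast
  show "\<exists>d>0. \<forall>y'. dist y' y < d \<longrightarrow> (\<exists>z'\<in>positive_orbit {um..up} sol3 y'. dist z' z < e)"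
  proof (intro exI[of _ "min d (e / 2)"] conjI allI impI)
    fix y' :: "real \<times> plane" assume d': "dist y' y < min d (e / 2)"
    obtain q y1 where y': "y' = (q, y1)" by (metis surj_pair)
    have d1: "dist y1 y0 < d" "dist q t' < e / 2"
      using d' dist_snd_le[of y' y] dist_fst_le[of y' y] by (auto simp: y' yz)
    obtain z1 where z1: "reach S ((t'' - t') / \<alpha>) y1 z1" "dist z1 z0 < e / 2" using d(2)[OF d1(1)] by blast
    let ?z = "(q + (t'' - t'), z1)"
    have "dist (q + (t'' - t')) t'' < e / 2" using d1(2) by (simp add: dist_real_def)
    then have "dist ?z z < e"
      unfolding yz dist_Pair_Pair using z1(2) sqrt_sum_squares_le_sum[of "dist (q + (t'' - t')) t''" "dist z1 z0"] by simp
    moreover have "?z \<in> positive_orbit {um..up} sol3 y'"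
      unfolding y' positive_orbit3 using z1(1) by auto
    ultimately show "\<exists>z'\<in>positive_orbit {um..up} sol3 y'. dist z' z < e" by blast
  qed (use \<open>e > 0\<close> d in auto)
qed

text \<open>Steer to an equilibrium inside the region and stay there; all points on the way still reach \<open>h0\<close>.\<close>
lemma region_trajectory:
  assumes x: "x \<in> region"
  shows "\<exists>u\<in>controls {um..up}. \<exists>c. sol3 u c \<and> c 0 = (t, x) \<and> c ` {0..} \<subseteq> UNIV \<times> region"
proof -
  obtain e where e: "core h0 e" using h0_core .
  define v where "v = e / 2"
  have "0 < \<bar>v\<bar> \<and> \<bar>v\<bar> < e" using e unfolding core_def v_def by auto
  then have v: "v \<in> {um..up}" "det (M v) \<noteq> 0" "reaches h0 (eqpt v)" "reaches (eqpt v) h0"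
    using e unfolding core_def by force+
  have "reaches x (eqpt v)" using x v(3) reaches_trans unfolding region_def by blast
  then obtain S \<tau> where r: "reach S \<tau> x (eqpt v)" unfolding reaches_def by blast
  have "S > 0" using reach_bounds[OF r] by simp
  obtain u1 c1 where 1: "u1 \<in> controls {um..up}" "sol3 u1 c1" "c1 0 = (t, x)" "c1 S = (t + \<alpha> * \<tau>, eqpt v)"
    using reach_sol3[OF r] by blast
  let ?c2 = "\<lambda>s. (t + \<alpha> * \<tau> + \<alpha> * (v * s), flow v s (eqpt v))"
  let ?c = "\<lambda>s. if s \<le> S then c1 s else ?c2 (s - S)"
  have vS: "?c2 0 = c1 S" by (simp add: 1)
  have "um < up" using um up by simp
  from vf_solution_concat[OF 1(1) constant_control[OF v(1)] this 1(2) sol3_constant vS]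
  obtain u where u: "u \<in> controls {um..up}" "sol3 u ?c" by blast
  have "snd (?c s) \<in> region" if s: "s \<ge> 0" for s
  proof -
    consider "s = 0" | "0 < s" "s < S" | "s \<ge> S" using s by linarith
    then show ?thesis
    proof cases
      case 1
      then show ?thesis using \<open>S > 0\<close> \<open>c1 0 = (t, x)\<close> x by simp
    next
      case 2
      have "reaches x (snd (c1 s))" "reaches (snd (c1 s)) (eqpt v)"
        using sol3_reach[OF 1(1,2) 2(1)] sol3_reach[OF 1(1,2) 2(2)] 1(3,4) by (auto intro: reachesI)
      then have "snd (c1 s) \<in> region" using region_path[OF x] v(4) reaches_trans by blast
      then show ?thesis using 2 by simp
    next
      case 3
      then have "snd (?c s) = eqpt v" using 1(4) by (auto simp: flow_eqpt_self[OF v(2)])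
      then show ?thesis using region_if_mutual[OF v(3,4)] by simp
    qed
  qed
  then have "?c ` {0..} \<subseteq> UNIV \<times> region"
    by (intro image_subsetI) (unfold mem_Times_iff, blast intro: atLeast_iff[THEN iffD1])
  moreover have "?c 0 = (t, x)" using 1(3) \<open>S > 0\<close> by simp
  ultimately show ?thesis using u by blast
qed

lemma region_subset_closure: "x \<in> region \<Longrightarrow> region \<subseteq> closure {y. reaches x y}"
  using planar.closure_orbit_trans[unfolded positive_orbit2] closure_subset unfolding region_def by blast

theorem control_set_region: "control_set euclidean {um..up} sol2 region"
  unfolding control_set_def
proof (intro conjI allI impI)
  show "pre_control_set euclidean {um..up} sol2 region"
    unfolding pre_control_set_def
  proof (intro conjI ballI)
    fix x assume x: "x \<in> region"
    obtain u c where c: "u \<in> controls {um..up}" "sol3 u c" "c 0 = (0, x)" "c ` {0..} \<subseteq> UNIV \<times> region"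
      using region_trajectory[OF x] by blast
    have "(\<lambda>s. snd (c s)) ` {0..} \<subseteq> region"
    proof (rule image_subsetI)
      fix s :: real assume "s \<in> {0..}"
      then have "c s \<in> UNIV \<times> region" using c(4) by blast
      then show "snd (c s) \<in> region" by (simp add: mem_Times_iff)
    qed
    then show "\<exists>u\<in>controls {um..up}. \<exists>c. sol2 u c \<and> c 0 = x \<and> c ` {0..} \<subseteq> region"
      using c sol3_snd by (intro bexI[of _ u] exI[of _ "\<lambda>s. snd (c s)"]) auto
    show "region \<subseteq> euclidean closure_of positive_orbit {um..up} sol2 x"
      using region_subset_closure[OF x] by (simp add: positive_orbit2)
  qed auto
  fix D assume D: "pre_control_set euclidean {um..up} sol2 D \<and> region \<subseteq> D"
  have h: "h0 \<in> D" using D region_interior interior_subset by blast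
  obtain e where e: "e > 0" "\<And>y. dist y h0 < e \<Longrightarrow> reaches y h0" using h0_hub unfolding hub_def by blast
  have "x \<in> region" if x: "x \<in> D" for x
  proof -
    have cl: "x \<in> closure {y. reaches h0 y}" "h0 \<in> closure {y. reaches x y}"
      using D x h by (auto simp: pre_control_set_def positive_orbit2)
    then obtain y where "reaches x y" "dist y h0 < e" using e(1) unfolding closure_approachable by blast
    then have "reaches x h0" using e(2) reaches_trans by blast
    then show ?thesis using cl(1) unfolding region_def by simp
  qed
  then show "D = region" using D by blast
qed

text \<open>On the way through the hub, wait at the equilibria of \<open>v\<close> and of \<open>- v\<close>. The two waiting times change the drift in
  opposite directions, so suitable positive ones give any total.\<close>
lemma reach_any_drift:
  assumes "reaches x h0" "reaches h0 y"
  shows "\<exists>S. reach S \<delta> x y"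
proof -
  obtain e where e: "core h0 e" using h0_core .
  define v where "v = e / 2"
  have "0 < \<bar>v\<bar> \<and> \<bar>v\<bar> < e" "0 < \<bar>- v\<bar> \<and> \<bar>- v\<bar> < e" using e unfolding core_def v_def by auto
  then have v: "v \<in> {um<..<up}" "det (M v) \<noteq> 0" "reaches h0 (eqpt v)" "reaches (eqpt v) h0"
    "- v \<in> {um<..<up}" "det (M (- v)) \<noteq> 0" "reaches h0 (eqpt (- v))" "reaches (eqpt (- v)) h0"
    using e unfolding core_def by blast+
  have "reaches x (eqpt v)" "reaches (eqpt v) (eqpt (- v))" "reaches (eqpt (- v)) y"
    using v assms reaches_trans by blast+
  then obtain S1 \<tau>1 S2 \<tau>2 S3 \<tau>3 where r: "reach S1 \<tau>1 x (eqpt v)" "reach S2 \<tau>2 (eqpt v) (eqpt (- v))"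
    "reach S3 \<tau>3 (eqpt (- v)) y" unfolding reaches_def by blast
  have vpos: "v > 0" using e unfolding core_def v_def by simp
  define d where "d = (\<delta> - \<tau>1 - \<tau>2 - \<tau>3) / v"
  have w: "reach s (v * s) (eqpt v) (eqpt v)" "reach s (- v * s) (eqpt (- v)) (eqpt (- v))" if "s > 0" for s
    using reach.step[of s v "eqpt v"] reach.step[of s "- v" "eqpt (- v)"] that v
    by (auto simp: flow_eqpt_self)
  \<comment> \<open>waiting times at the two equilibria: both positive, with difference \<open>d\<close>\<close>
  have "\<bar>d\<bar> + d + 1 > 0" "\<bar>d\<bar> + 1 > 0" by linarith+
  note w(1)[OF this(1)] w(2)[OF this(2)]
  from reach.trans[OF r(1) reach.trans[OF this(1) reach.trans[OF r(2) reach.trans[OF this(2) r(3)]]]]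
  have "\<exists>S. reach S (\<tau>1 + (v * (\<bar>d\<bar> + d + 1) + (\<tau>2 + (- v * (\<bar>d\<bar> + 1) + \<tau>3)))) x y" by blast
  moreover have "\<tau>1 + (v * (\<bar>d\<bar> + d + 1) + (\<tau>2 + (- v * (\<bar>d\<bar> + 1) + \<tau>3))) = \<delta>"
  proof -
    have "v * d = \<delta> - \<tau>1 - \<tau>2 - \<tau>3" using vpos by (simp add: d_def)
    then show ?thesis by (simp add: algebra_simps)
  qed
  ultimately show ?thesis by simp
qed

text \<open>The drift is free, so the closures of orbits in the lifted system are cylinders over those in the plane.\<close>
theorem control_set_lifted_region: "control_set euclidean {um..up} sol3 (UNIV \<times> region)"
  unfolding control_set_def
proof (intro conjI allI impI)
  show "pre_control_set euclidean {um..up} sol3 (UNIV \<times> region)"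
    unfolding pre_control_set_def
  proof (intro conjI ballI)
    fix p :: "real \<times> plane" assume "p \<in> UNIV \<times> region"
    then obtain t x where p: "p = (t, x)" "x \<in> region" by (metis mem_Sigma_iff surj_pair)
    show "\<exists>u\<in>controls {um..up}. \<exists>c. sol3 u c \<and> c 0 = p \<and> c ` {0..} \<subseteq> UNIV \<times> region"
      unfolding p(1) by (rule region_trajectory[OF p(2)])
    have "(t', x') \<in> closure (positive_orbit {um..up} sol3 p)" if x': "x' \<in> region" for t' x'
      unfolding closure_approachable
    proof (intro allI impI)
      fix e :: real assume "e > 0"
      then obtain y where y: "reaches h0 y" "dist y x' < e"
        using x' unfolding region_def by (auto simp: closure_approachable)
      have "reaches x h0" using p(2) unfolding region_def by blast
      then have "(t', y) \<in> positive_orbit {um..up} sol3 p"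
        unfolding p(1) positive_orbit3 using reach_any_drift y(1) by blast
      moreover have "dist (t', y) (t', x') < e" using y(2) by (simp add: dist_Pair_Pair)
      ultimately show "\<exists>q\<in>positive_orbit {um..up} sol3 p. dist q (t', x') < e" by blast
    qed
    then show "UNIV \<times> region \<subseteq> euclidean closure_of positive_orbit {um..up} sol3 p" by auto
  qed auto
  fix D assume D: "pre_control_set euclidean {um..up} sol3 D \<and> UNIV \<times> region \<subseteq> D"
  have "h0 \<in> region" using region_interior interior_subset by blast
  then have h: "(0, h0) \<in> D" using D by auto
  obtain e where e: "e > 0" "\<And>y. dist y h0 < e \<Longrightarrow> reaches y h0" using h0_hub unfolding hub_def by blast
  have near: "\<exists>y'. reaches x y' \<and> dist y' y < e'"
    if cl: "(t', y) \<in> closure (positive_orbit {um..up} sol3 (t, x))" and pos: "e' > 0" for t t' x y e'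
  proof -
    obtain q where q: "q \<in> positive_orbit {um..up} sol3 (t, x)" "dist q (t', y) < e'"
      using cl pos unfolding closure_approachable by blast
    obtain t'' y' where q': "q = (t'', y')" by (metis surj_pair)
    have "reaches x y'" using q(1) reachesI unfolding q' positive_orbit3 by blast
    moreover have "dist y' y < e'" using q(2) dist_snd_le[of q "(t', y)"] by (simp add: q')
    ultimately show ?thesis by blast
  qed
  have "x \<in> region" if x: "(t, x) \<in> D" for t x
  proof -
    have cl: "(t, x) \<in> closure (positive_orbit {um..up} sol3 (0, h0))" "(0, h0) \<in> closure (positive_orbit {um..up} sol3 (t, x))"
      using D x h by (auto simp: pre_control_set_def)
    obtain y where "reaches x y" "dist y h0 < e" using near[OF cl(2) e(1)] by blast
    then have "reaches x h0" using e(2) reaches_trans by blast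
    moreover have "x \<in> closure {y. reaches h0 y}"
      unfolding closure_approachable using near[OF cl(1)] by blast
    ultimately show ?thesis unfolding region_def by simp
  qed
  then show "D = UNIV \<times> region" using D by auto
qed

end

section \<open>Uniqueness in the lifted system\<close>

lemma matrix_tendsto_0I:
  fixes f :: "'t \<Rightarrow> real^'n^'m"
  assumes "\<And>x. ((\<lambda>t. f t *v x) \<longlongrightarrow> 0) F"
  shows "(f \<longlongrightarrow> 0) F"
proof (intro vec_tendstoI)
  fix i j
  have "((\<lambda>t. (f t *v axis j 1) $ i) \<longlongrightarrow> 0 $ i) F" by (intro tendsto_vec_nth assms)
  then show "((\<lambda>t. f t $ i $ j) \<longlongrightarrow> 0 $ i $ j) F"
    by (simp add: matrix_vector_mult_basis column_def)
qed

lemma matrix_eigen_scaled: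
  fixes A :: "real^'n^'n"
  assumes "\<And>x. A *v (P *v x) = \<mu> *\<^sub>R (P *v x)"
  shows "mat_exp (s *\<^sub>R A) ** P = exp (s * \<mu>) *\<^sub>R P"
  by (simp add: matrix_eq mat_exp_eigenvector[OF assms] mv.scaleR_left flip: matrix_vector_mul_assoc)

text \<open>A projection onto a subspace on which \<open>exp (s A)\<close> decays. It commutes with everything that commutes with \<open>A\<close>,
  in particular with \<open>B\<close>.\<close>
definition spectral_projection :: "real^2^2 \<Rightarrow> real^2^2 \<Rightarrow> bool" where
  "spectral_projection A P \<longleftrightarrow> P ** P = P \<and> (\<forall>N. A ** N = N ** A \<longrightarrow> P ** N = N ** P) \<and>
     ((\<lambda>s. mat_exp (s *\<^sub>R A) ** P) \<longlongrightarrow> 0) at_top"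

lemma hyperbolic_splitting:
  fixes A :: "real^2^2"
  assumes det: "det A \<noteq> 0" and hyp: "\<not> (det A > 0 \<and> trace A = 0)"
  obtains P Q where "spectral_projection A P" "spectral_projection (- A) Q" "P + Q = mat 1"
proof -
  have 0: "spectral_projection N 0" for N by (simp add: spectral_projection_def mm.zero_left mm.zero_right)
  consider "det A > 0" "trace A < 0" | "det A > 0" "trace A > 0" | "det A < 0" using det hyp by linarith
  then show thesis
  proof cases
    case 1
    then have "spectral_projection A (mat 1)"
      unfolding spectral_projection_def by (auto intro!: matrix_tendsto_0I mat_exp_stable_tendsto_0)
    then show thesis using that[of "mat 1" 0] 0 by simp
  next
    case 2
    then have lim: "((\<lambda>s. mat_exp (s *\<^sub>R (- A)) *v x) \<longlongrightarrow> 0) at_top" for x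
      by (intro mat_exp_stable_tendsto_0) (simp_all add: trace_det_uminus)
    have "spectral_projection (- A) (mat 1)"
      using matrix_tendsto_0I[OF lim] by (simp add: spectral_projection_def)
    then show thesis using that[of 0 "mat 1"] 0 by simp
  next
    case 3
    define D where "D = sqrt ((trace A)\<^sup>2 - 4 * det A)"
    define \<mu>1 where "\<mu>1 = (trace A - D) / 2"
    define \<mu>2 where "\<mu>2 = (trace A + D) / 2"
    have "(trace A)\<^sup>2 - 4 * det A \<ge> 0" using 3 zero_le_power2[of "trace A"] by linarith
    then have D: "D * D = (trace A)\<^sup>2 - 4 * det A" "D \<ge> 0" by (simp_all add: D_def)
    have sum: "\<mu>1 + \<mu>2 = trace A" by (simp add: \<mu>1_def \<mu>2_def field_simps)
    have prod: "\<mu>1 * \<mu>2 = det A" using D(1) by (simp add: \<mu>1_def \<mu>2_def field_simps power2_eq_square)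
    have "\<mu>1 \<le> \<mu>2" using D(2) by (simp add: \<mu>1_def \<mu>2_def)
    with prod 3 have \<mu>: "\<mu>1 < 0" "\<mu>2 > 0"
      by (smt (verit) mult_nonneg_nonneg mult_nonpos_nonpos)+
    define P where "P = (1 / (\<mu>2 - \<mu>1)) *\<^sub>R (\<mu>2 *\<^sub>R mat 1 - A)"
    define Q where "Q = (1 / (\<mu>2 - \<mu>1)) *\<^sub>R (A - \<mu>1 *\<^sub>R mat 1)"
    have Pv: "P *v x = (1 / (\<mu>2 - \<mu>1)) *\<^sub>R (\<mu>2 *\<^sub>R x - A *v x)" and Qv: "Q *v x = (1 / (\<mu>2 - \<mu>1)) *\<^sub>R (A *v x - \<mu>1 *\<^sub>R x)" for x
      by (simp_all add: P_def Q_def mv.scaleR_left mv.diff_left)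
    have CH: "A *v (A *v x) = (\<mu>1 + \<mu>2) *\<^sub>R (A *v x) - (\<mu>1 * \<mu>2) *\<^sub>R x" for x
      unfolding sum prod by (rule cayley_hamilton_plane)
    have AP: "A *v (P *v x) = \<mu>1 *\<^sub>R (P *v x)" and AQ: "A *v (Q *v x) = \<mu>2 *\<^sub>R (Q *v x)" for x
      by (simp_all add: Pv Qv mv.scaleR_right mv.diff_right CH) (simp_all add: algebra_simps)
    have idem: "P *v (P *v x) = P *v x" "Q *v (Q *v x) = Q *v x" for x
      using \<mu> Pv[of "P *v x"] Qv[of "Q *v x"] by (simp_all add: AP AQ flip: scaleR_diff_left)
    have com: "P ** N = N ** P" "Q ** N = N ** Q" if "A ** N = N ** A" for N
      unfolding P_def Q_def using that by (simp_all add: mm.scaleR_left mm.scaleR_right mm.diff_left mm.diff_right)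
    have limP: "((\<lambda>s. mat_exp (s *\<^sub>R A) ** P) \<longlongrightarrow> 0) at_top"
    proof -
      have "((\<lambda>s. exp (s * \<mu>1)) \<longlongrightarrow> 0) at_top" using \<mu>(1) by real_asymp
      from tendsto_scaleR[OF this tendsto_const[of P]] show ?thesis
        unfolding matrix_eigen_scaled[OF AP] by simp
    qed
    have limQ: "((\<lambda>s. mat_exp (s *\<^sub>R (- A)) ** Q) \<longlongrightarrow> 0) at_top"
    proof -
      have AQ': "- A *v (Q *v x) = (- \<mu>2) *\<^sub>R (Q *v x)" for x using AQ by (simp add: mv.minus_left)
      have "((\<lambda>s. exp (s * - \<mu>2)) \<longlongrightarrow> 0) at_top" using \<mu>(2) by real_asymp
      from tendsto_scaleR[OF this tendsto_const[of Q]] show ?thesis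
        unfolding matrix_eigen_scaled[OF AQ'] by simp
    qed
    have com': "A ** N = N ** A" if "- A ** N = N ** - A" for N using that by (simp add: mm.minus_left mm.minus_right)
    have "P ** P = P" "Q ** Q = Q"
      unfolding matrix_eq by (simp_all add: idem flip: matrix_vector_mul_assoc)
    then have "spectral_projection A P" "spectral_projection (- A) Q"
      unfolding spectral_projection_def using com com' limP limQ by blast+
    moreover have "P + Q = mat 1"
    proof -
      have "P + Q = (1 / (\<mu>2 - \<mu>1)) *\<^sub>R ((\<mu>2 *\<^sub>R mat 1 - A) + (A - \<mu>1 *\<^sub>R mat 1))"
        unfolding P_def Q_def by (simp only: scaleR_add_right)
      also have "(\<mu>2 *\<^sub>R mat 1 - A) + (A - \<mu>1 *\<^sub>R mat 1) = (\<mu>2 - \<mu>1) *\<^sub>R (mat 1 :: real^2^2)"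
        by (simp add: scaleR_diff_left)
      finally show ?thesis using \<mu> by simp
    qed
    ultimately show thesis by (rule that)
  qed
qed

lemma rho_bounded: obtains K where "K > 0" "\<And>\<tau>. \<bar>\<tau>\<bar> \<le> 1 \<Longrightarrow> norm (rho B \<tau>) \<le> K"
proof -
  have "continuous_on {-1..1} (rho B)" by (simp add: continuous_at_imp_continuous_on rho_isCont)
  then have "bounded (rho B ` {-1..1})" by (intro compact_imp_bounded compact_continuous_image) auto
  then obtain K where "K > 0" "\<And>y. y \<in> rho B ` {-1..1} \<Longrightarrow> norm y \<le> K" unfolding bounded_pos by blast
  then show thesis using that[of K] by (auto simp: abs_le_iff)
qed

text \<open>The bound on \<open>\<tau>\<close> keeps the factor \<open>exp (\<tau> B)\<close> in a compact set, so that the decay of \<open>exp (S A)\<close> wins for large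
  \<open>S\<close>.\<close>
lemma contraction_on_projection:
  fixes A B :: "real^2^2"
  assumes P: "spectral_projection A P" and AB: "A ** B = B ** A"
  shows "\<exists>S0>0. \<forall>S\<ge>S0. \<forall>\<tau>. \<bar>\<tau>\<bar> \<le> 1 \<longrightarrow> (\<forall>x. norm (mat_exp (S *\<^sub>R A + \<tau> *\<^sub>R B) *v (P *v x)) \<le> norm (P *v x) / 2)"
proof -
  obtain K where K: "K > 0" "\<And>\<tau>. \<bar>\<tau>\<bar> \<le> 1 \<Longrightarrow> norm (rho B \<tau>) \<le> K" using rho_bounded[of B] by blast
  have "((\<lambda>s. mat_exp (s *\<^sub>R A) ** P) \<longlongrightarrow> 0) at_top" using P by (simp add: spectral_projection_def)
  then have "\<forall>\<^sub>F S in at_top. norm (mat_exp (S *\<^sub>R A) ** P) < 1 / (2 * K)"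
    using tendstoD[of _ 0 _ "1 / (2 * K)"] K(1) by (fastforce simp: dist_norm)
  then obtain S1 where S1: "\<And>S. S \<ge> S1 \<Longrightarrow> norm (mat_exp (S *\<^sub>R A) ** P) < 1 / (2 * K)"
    unfolding eventually_at_top_linorder by blast
  show ?thesis
  proof (intro exI[of _ "max S1 1"] conjI allI impI)
    fix S \<tau> :: real and x assume S: "S \<ge> max S1 1" and \<tau>: "\<bar>\<tau>\<bar> \<le> 1"
    have "mat_exp (S *\<^sub>R A + \<tau> *\<^sub>R B) = mat_exp (\<tau> *\<^sub>R B) ** mat_exp (S *\<^sub>R A)"
      unfolding add.commute[of "S *\<^sub>R A"] by (rule mat_exp_add) (simp add: mm.scaleR_left mm.scaleR_right AB)
    moreover have "P *v x = P *v (P *v x)" using P by (simp add: spectral_projection_def matrix_vector_mul_assoc)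
    ultimately have "mat_exp (S *\<^sub>R A + \<tau> *\<^sub>R B) *v (P *v x) = rho B \<tau> *v ((mat_exp (S *\<^sub>R A) ** P) *v (P *v x))"
      by (metis rho_def matrix_vector_mul_assoc)
    also have "norm (rho B \<tau> *v ((mat_exp (S *\<^sub>R A) ** P) *v (P *v x))) \<le> norm (rho B \<tau>) * (norm (mat_exp (S *\<^sub>R A) ** P) * norm (P *v x))"
      by (meson mult_left_mono norm_ge_zero norm_matrix_vector_mult_le order_trans)
    also have "\<dots> \<le> K * (1 / (2 * K) * norm (P *v x))"
      using S1[of S] S K \<tau> by (intro mult_mono mult_right_mono mult_nonneg_nonneg) auto
    finally show "norm (mat_exp (S *\<^sub>R A + \<tau> *\<^sub>R B) *v (P *v x)) \<le> norm (P *v x) / 2" using K(1) by simp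
  qed auto
qed

context plane_system begin

text \<open>Maps \<open>E S \<tau>\<close> with long duration and bounded drift contract the range of \<open>P\<close> and expand the range of \<open>Q\<close>, at a
  uniform rate.\<close>
definition splitting :: "real^2^2 \<Rightarrow> real^2^2 \<Rightarrow> real \<Rightarrow> bool" where
  "splitting P Q S0 \<longleftrightarrow> S0 > 0 \<and> P + Q = mat 1 \<and>
     (\<forall>S (\<tau>::real) x. P *v (E S \<tau> *v x) = E S \<tau> *v (P *v x) \<and> Q *v (E S \<tau> *v x) = E S \<tau> *v (Q *v x)) \<and>
     (\<forall>S\<ge>S0. \<forall>\<tau>. \<bar>\<tau>\<bar> \<le> 1 \<longrightarrow> (\<forall>x. norm (E S \<tau> *v (P *v x)) \<le> norm (P *v x) / 2 \<and>
       norm (E (- S) (- \<tau>) *v (Q *v x)) \<le> norm (Q *v x) / 2))"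

lemma splitting_exists:
  assumes "\<not> (det A > 0 \<and> trace A = 0)"
  shows "\<exists>P Q S0. splitting P Q S0"
proof -
  obtain P Q where PQ: "spectral_projection A P" "spectral_projection (- A) Q" "P + Q = mat 1"
    using hyperbolic_splitting[OF det_A assms] .
  have "(- A) ** B = B ** (- A)" by (simp add: mm.minus_left mm.minus_right commute)
  from contraction_on_projection[OF PQ(2) this] contraction_on_projection[OF PQ(1) commute]
  obtain S1 S2 where S: "S1 > 0" "S2 > 0"
    "\<And>S \<tau> x. S \<ge> S1 \<Longrightarrow> \<bar>\<tau>\<bar> \<le> 1 \<Longrightarrow> norm (mat_exp (S *\<^sub>R A + \<tau> *\<^sub>R B) *v (P *v x)) \<le> norm (P *v x) / 2"
    "\<And>S \<tau> x. S \<ge> S2 \<Longrightarrow> \<bar>\<tau>\<bar> \<le> 1 \<Longrightarrow> norm (mat_exp (S *\<^sub>R - A + \<tau> *\<^sub>R B) *v (Q *v x)) \<le> norm (Q *v x) / 2"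
    by blast
  have comm: "A ** P = P ** A" "B ** P = P ** B" "A ** Q = Q ** A" "B ** Q = Q ** B"
    using PQ(1,2) commute unfolding spectral_projection_def by (simp_all add: mm.minus_left mm.minus_right)
  show ?thesis unfolding splitting_def
  proof (rule exI[of _ P], rule exI[of _ Q], rule exI[of _ "max S1 S2"], intro conjI allI impI)
    fix S \<tau> :: real and x :: plane assume "S \<ge> max S1 S2" "\<bar>\<tau>\<bar> \<le> 1"
    then show "norm (E S \<tau> *v (P *v x)) \<le> norm (P *v x) / 2" "norm (E (- S) (- \<tau>) *v (Q *v x)) \<le> norm (Q *v x) / 2"
      using S(3)[of S "- \<tau>" x] S(4)[of S \<tau> x] by (simp_all add: E_def)
  qed (use S PQ comm E_commute in auto)
qed

lemma reach_loop_repeat: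
  assumes "reach S \<tau> p p"
  shows "reach (real (Suc k) * S) (real (Suc k) * \<tau>) p p"
proof (induction k)
  case (Suc k)
  show ?case using reach.trans[OF assms Suc] by (simp add: algebra_simps)
qed (use assms in simp)

context
  fixes P Q S0
  assumes split: "splitting P Q S0"
begin

lemma split_sum: "P *v x + Q *v x = x"
proof -
  have "(P + Q) *v x = x" using split by (simp add: splitting_def)
  then show ?thesis by (simp add: mv.add_left)
qed

lemma split_commute: "P *v (E S \<tau> *v x) = E S \<tau> *v (P *v x)" "Q *v (E S \<tau> *v x) = E S \<tau> *v (Q *v x)"
  using split by (auto simp: splitting_def)

lemma split_contract:
  assumes "S \<ge> S0" "\<bar>\<tau>\<bar> \<le> 1"
  shows "norm (E S \<tau> *v (P *v x)) \<le> norm (P *v x) / 2" "norm (E (- S) (- \<tau>) *v (Q *v x)) \<le> norm (Q *v x) / 2"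
  using split assms by (auto simp: splitting_def)

lemma split_contract_power:
  assumes "S \<ge> S0" "\<bar>\<tau>\<bar> \<le> 1"
  shows "norm (E (real k * S) (real k * \<tau>) *v (P *v x)) \<le> norm (P *v x) / 2 ^ k"
    "norm (E (- (real k * S)) (- (real k * \<tau>)) *v (Q *v x)) \<le> norm (Q *v x) / 2 ^ k"
proof (induction k)
  case (Suc k)
  { case 1
    have "E (real (Suc k) * S) (real (Suc k) * \<tau>) *v (P *v x) = E S \<tau> *v (P *v (E (real k * S) (real k * \<tau>) *v x))"
      using E_add_vector[of S "real k * S" \<tau> "real k * \<tau>" "P *v x"] by (simp add: split_commute algebra_simps)
    then show ?case using split_contract(1)[OF assms, of "E (real k * S) (real k * \<tau>) *v x"] Suc(1) by (simp add: split_commute)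
  next
    case 2
    have "E (- (real (Suc k) * S)) (- (real (Suc k) * \<tau>)) *v (Q *v x) = E (- S) (- \<tau>) *v (Q *v (E (- (real k * S)) (- (real k * \<tau>)) *v x))"
      using E_add_vector[of "- S" "- (real k * S)" "- \<tau>" "- (real k * \<tau>)" "Q *v x"] by (simp add: split_commute algebra_simps)
    then show ?case using split_contract(2)[OF assms, of "E (- (real k * S)) (- (real k * \<tau>)) *v x"] Suc(2) by (simp add: split_commute) }
qed simp_all

text \<open>The return map \<open>z \<mapsto> y + E S \<tau> (z - x)\<close> is uniformly hyperbolic, so that it has a fixed point at a distance
  from \<open>x\<close> proportional to the error \<open>y - x\<close>.\<close>
lemma loop_near:
  assumes S: "S \<ge> S0" "\<bar>\<tau>\<bar> \<le> 1" and r: "reach S \<tau> x y"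
  shows "\<exists>p. reach S \<tau> p p \<and> norm (p - x) \<le> 2 * (norm P + norm Q) * norm (y - x)"
proof -
  let ?M = "E S \<tau>"
  have bound: "norm \<zeta> \<le> 2 * (norm P + norm Q) * norm (\<zeta> - ?M *v \<zeta>)" for \<zeta>
  proof -
    define \<eta> where "\<eta> = \<zeta> - ?M *v \<zeta>"
    have "P *v \<zeta> = P *v \<eta> + ?M *v (P *v \<zeta>)" by (simp add: \<eta>_def mv.diff_right split_commute)
    then have "norm (P *v \<zeta>) \<le> norm (P *v \<eta>) + norm (?M *v (P *v \<zeta>))" by (metis norm_triangle_ineq)
    then have 1: "norm (P *v \<zeta>) \<le> 2 * norm (P *v \<eta>)" using split_contract(1)[OF S, of \<zeta>] by simp
    have "E (- S) (- \<tau>) *v (Q *v \<eta>) = E (- S) (- \<tau>) *v (Q *v \<zeta>) - Q *v \<zeta>"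
      by (simp add: \<eta>_def mv.diff_right split_commute E_inverse)
    then have "Q *v \<zeta> = E (- S) (- \<tau>) *v (Q *v \<zeta>) - E (- S) (- \<tau>) *v (Q *v \<eta>)" by simp
    then have "norm (Q *v \<zeta>) \<le> norm (E (- S) (- \<tau>) *v (Q *v \<zeta>)) + norm (E (- S) (- \<tau>) *v (Q *v \<eta>))"
      by (metis norm_triangle_ineq4)
    then have 2: "norm (Q *v \<zeta>) \<le> norm (Q *v \<eta>)"
      using split_contract(2)[OF S, of \<zeta>] split_contract(2)[OF S, of \<eta>] by simp
    have "norm \<zeta> \<le> norm (P *v \<zeta>) + norm (Q *v \<zeta>)" by (metis split_sum norm_triangle_ineq)
    also have "\<dots> \<le> 2 * norm (P *v \<eta>) + 2 * norm (Q *v \<eta>)" using 1 2 norm_ge_zero[of "Q *v \<eta>"] by linarith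
    also have "\<dots> \<le> 2 * (norm P * norm \<eta>) + 2 * (norm Q * norm \<eta>)"
      by (intro add_mono mult_left_mono norm_matrix_vector_mult_le) auto
    finally show ?thesis by (simp add: \<eta>_def algebra_simps)
  qed
  let ?L = "\<lambda>\<zeta>. \<zeta> - ?M *v \<zeta>"
  have lin: "linear ?L" by (intro linearI) (auto simp: mv.add_right mv.scaleR_right scaleR_diff_right)
  have "inj ?L"
    unfolding linear_injective_0[OF lin]
  proof (intro allI impI)
    fix \<zeta> assume "?L \<zeta> = 0"
    then show "\<zeta> = 0" using bound[of \<zeta>] by simp
  qed
  then have "surj ?L" using linear_injective_imp_surjective[OF lin] by blast
  then obtain \<zeta> where \<zeta>: "?L \<zeta> = y - x" by (metis surjD)
  have "reach S \<tau> (x + \<zeta>) (y + ?M *v (x + \<zeta> - x))" by (rule reach_shift[OF r])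
  moreover have "y + ?M *v (x + \<zeta> - x) = x + \<zeta>"
  proof -
    define m where "m = ?M *v \<zeta>"
    have "\<zeta> - m = y - x" using \<zeta> by (simp add: m_def)
    then have "y + m = x + \<zeta>" by (simp add: algebra_simps)
    then show ?thesis by (simp add: m_def)
  qed
  ultimately show ?thesis using bound[of \<zeta>] \<zeta> by (intro exI[of _ "x + \<zeta>"]) auto
qed

text \<open>Both loops have the same stable and unstable directions. Displace \<open>p\<close> slightly in the unstable direction so that
  \<open>k\<close> turns of the first loop produce the unstable part of \<open>q - p\<close>; the remaining stable part is then
  contracted by \<open>k\<close> turns of the second loop.\<close>
lemma loops_connected:
  assumes p: "reach S1 \<tau>1 p p" "S1 \<ge> S0" "\<bar>\<tau>1\<bar> \<le> 1" and q: "reach S2 \<tau>2 q q" "S2 \<ge> S0" "\<bar>\<tau>2\<bar> \<le> 1" and "e > 0"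
  shows "\<exists>x y. dist x p < e \<and> dist y q < e \<and> reaches x y"
proof -
  define \<delta> where "\<delta> = q - p"
  have lim: "((\<lambda>k. C / 2 ^ Suc k) \<longlongrightarrow> 0) sequentially" for C :: real
    by real_asymp
  have ev: "\<forall>\<^sub>F k in sequentially. C / 2 ^ Suc k < e" for C :: real
    using order_tendstoD(2)[OF lim \<open>e > 0\<close>] .
  have "\<forall>\<^sub>F k in sequentially. norm (Q *v \<delta>) / 2 ^ Suc k < e \<and> norm (P *v \<delta>) / 2 ^ Suc k < e"
    using ev[of "norm (Q *v \<delta>)"] ev[of "norm (P *v \<delta>)"] by eventually_elim auto
  then obtain k where k: "norm (Q *v \<delta>) / 2 ^ Suc k < e" "norm (P *v \<delta>) / 2 ^ Suc k < e"
    by (auto dest: eventually_happens)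
  let ?E1 = "E (real (Suc k) * S1) (real (Suc k) * \<tau>1)" and ?E2 = "E (real (Suc k) * S2) (real (Suc k) * \<tau>2)"
  define \<zeta> where "\<zeta> = E (- (real (Suc k) * S1)) (- (real (Suc k) * \<tau>1)) *v (Q *v \<delta>)"
  have "norm \<zeta> < e" using split_contract_power(2)[OF p(2,3), of "Suc k" \<delta>] k(1) unfolding \<zeta>_def by linarith
  have "reaches (p + \<zeta>) (p + ?E1 *v ((p + \<zeta>) - p))"
    using reach_shift[OF reach_loop_repeat[OF p(1), of k]] reachesI by blast
  moreover have "?E1 *v ((p + \<zeta>) - p) = Q *v \<delta>" by (simp add: \<zeta>_def E_inverse del: of_nat_Suc)
  moreover have "reaches (p + Q *v \<delta>) (q + ?E2 *v ((p + Q *v \<delta>) - q))"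
    using reach_shift[OF reach_loop_repeat[OF q(1), of k]] reachesI by blast
  moreover have "(p + Q *v \<delta>) - q = - (P *v \<delta>)"
    using split_sum[of \<delta>] by (simp add: \<delta>_def algebra_simps)
  moreover have "norm (?E2 *v - (P *v \<delta>)) < e"
    using split_contract_power(1)[OF q(2,3), of "Suc k" \<delta>] k(2) by (simp add: mv.minus_right del: of_nat_Suc)
  ultimately have "reaches (p + \<zeta>) (q + ?E2 *v - (P *v \<delta>))" "dist (q + ?E2 *v - (P *v \<delta>)) q < e" "dist (p + \<zeta>) p < e"
    using reaches_trans \<open>norm \<zeta> < e\<close> by (auto simp: dist_norm)
  then show ?thesis by blast
qed

end
end

context plane_system_lift begin

text \<open>Inside \<open>D\<close> follow a trajectory for a long time and return close to the initial point: this is an approximate loop with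
  small drift, hence there is an exact planar loop nearby. It is connected in both directions with the
  loop that rests at the equilibrium of a small control. The drift of the connecting trajectories does not
  matter, because \<open>UNIV \<times> region\<close> is invariant under translations of \<open>t\<close>.\<close>
theorem lifted_control_set_unique:
  assumes D: "control_set euclidean {um..up} sol3 D" and int: "interior D \<noteq> {}"
  shows "D = UNIV \<times> region"
proof (cases "det A > 0 \<and> trace A = 0")
  case True
  then have "region = UNIV" by (intro region_UNIV[of 0]) (use um up in auto)
  then show ?thesis using D control_set_lifted_region unfolding control_set_def by auto
next
  case False
  then obtain P Q S0 where split: "splitting P Q S0" using splitting_exists by blast
  have S0: "S0 > 0" using split by (simp add: splitting_def)
  obtain t0 x0 where "(t0, x0) \<in> interior D" using int by auto
  then obtain r where r: "r > 0" "ball (t0, x0) r \<subseteq> D" unfolding mem_interior by blast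
  then have inD: "(t0, x0) \<in> D" by auto
  obtain u c where c: "u \<in> controls {um..up}" "sol3 u c" "c 0 = (t0, x0)" "c ` {0..} \<subseteq> D"
    using D inD unfolding control_set_def pre_control_set_def by blast
  have "c S0 \<in> D" using c(4) S0 by auto
  then have cl: "(t0, x0) \<in> closure (positive_orbit {um..up} sol3 (c S0))"
    using D inD unfolding control_set_def pre_control_set_def by auto
  define C where "C = 2 * (norm P + norm Q) + 1"
  have C: "C > 0" by (simp add: C_def add_nonneg_pos)
  \<comment> \<open>a return within \<open>d\<close> has drift at most \<open>1\<close>, and the exact loop passes within \<open>r / 2\<close> of \<open>x0\<close>\<close>
  define d where "d = min \<bar>\<alpha>\<bar> (r / 2 / C)"
  have d: "d > 0" using \<alpha> r C by (simp add: d_def)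
  obtain w where w: "w \<in> positive_orbit {um..up} sol3 (c S0)" "dist w (t0, x0) < d"
    using cl d unfolding closure_approachable by blast
  obtain t1 x1 where x1: "c S0 = (t1, x1)" by (metis surj_pair)
  obtain t2 x2 where x2: "w = (t2, x2)" by (metis surj_pair)
  have "reach S0 ((t1 - t0) / \<alpha>) x0 x1" using sol3_reach[OF c(1,2) S0] by (simp add: c(3) x1)
  moreover obtain S where "reach S ((t2 - t1) / \<alpha>) x1 x2" using w(1) positive_orbit3 unfolding x1 x2 by blast
  ultimately have "reach (S0 + S) ((t1 - t0) / \<alpha> + (t2 - t1) / \<alpha>) x0 x2" by (rule reach.trans)
  then have loop: "reach (S0 + S) ((t2 - t0) / \<alpha>) x0 x2" by (simp flip: add_divide_distrib)
  have S: "S > 0" using reach_bounds[OF \<open>reach S ((t2 - t1) / \<alpha>) x1 x2\<close>] by simp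
  have "\<bar>t2 - t0\<bar> \<le> \<bar>\<alpha>\<bar>" using w(2) dist_fst_le[of w "(t0, x0)"] by (simp add: x2 d_def dist_real_def)
  then have \<tau>: "\<bar>(t2 - t0) / \<alpha>\<bar> \<le> 1" using \<alpha> by (simp add: abs_divide)
  obtain p where p: "reach (S0 + S) ((t2 - t0) / \<alpha>) p p" "norm (p - x0) \<le> 2 * (norm P + norm Q) * norm (x2 - x0)"
    using loop_near[OF split _ \<tau> loop] S by auto
  have "dist p x0 < r / 2"
  proof -
    have "norm (x2 - x0) < r / 2 / C" using w(2) dist_snd_le[of w "(t0, x0)"] by (simp add: x2 d_def dist_norm)
    then have "C * norm (x2 - x0) < r / 2" using C by (simp add: field_simps)
    moreover have "2 * (norm P + norm Q) * norm (x2 - x0) \<le> C * norm (x2 - x0)" by (intro mult_right_mono) (auto simp: C_def)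
    ultimately show ?thesis using p(2) by (simp add: dist_norm)
  qed
  then have pD: "(t0, x) \<in> D" if "dist x p < r / 2" for x
  proof -
    have "dist (t0, x0) (t0, x) < r"
      using that dist_triangle[of x0 x p] \<open>dist p x0 < r / 2\<close> by (simp add: dist_Pair_Pair dist_commute)
    then show ?thesis using r(2) by auto
  qed
  obtain e where e: "core h0 e" using h0_core .
  \<comment> \<open>so small that resting at \<open>eqpt v\<close> for the time \<open>S0\<close> has drift at most \<open>1\<close>\<close>
  define v where "v = min (e / 2) (1 / S0)"
  have "0 < \<bar>v\<bar> \<and> \<bar>v\<bar> < e" using e S0 unfolding core_def v_def by auto
  then have v: "v \<in> {um..up}" "det (M v) \<noteq> 0" "hub (eqpt v)" "reaches h0 (eqpt v)" "reaches (eqpt v) h0"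
    using e unfolding core_def by force+
  have "v * S0 \<le> 1 / S0 * S0" by (intro mult_right_mono) (use S0 in \<open>auto simp: v_def\<close>)
  moreover have "v > 0" using e S0 unfolding core_def v_def by simp
  ultimately have vS: "\<bar>v * S0\<bar> \<le> 1" using S0 by simp
  have loopv: "reach S0 (v * S0) (eqpt v) (eqpt v)"
    using reach.step[OF S0 v(1), of "eqpt v"] by (simp add: flow_eqpt_self[OF v(2)])
  obtain e' where e': "e' > 0" "ball (eqpt v) e' \<subseteq> region"
    using hub_in_interior_region[OF v(3-5)] unfolding mem_interior by blast
  have SS: "S0 + S \<ge> S0" "S0 \<ge> S0" using S by auto
  have m: "min e' (r / 2) > 0" using e' r by simp
  obtain x y where xy: "dist x p < min e' (r / 2)" "dist y (eqpt v) < min e' (r / 2)" "reaches x y"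
    using loops_connected[OF split p(1) SS(1) \<tau> loopv SS(2) vS m] by blast
  obtain x' y' where xy': "dist x' (eqpt v) < min e' (r / 2)" "dist y' p < min e' (r / 2)" "reaches x' y'"
    using loops_connected[OF split loopv SS(2) vS p(1) SS(1) \<tau> m] by blast
  obtain s \<tau>1 where r1: "reach s \<tau>1 x y" using xy(3) unfolding reaches_def by blast
  obtain s' \<tau>2 where r2: "reach s' \<tau>2 x' y'" using xy'(3) unfolding reaches_def by blast
  have "(t0 + \<alpha> * \<tau>1, y) \<in> positive_orbit {um..up} sol3 (t0, x)"
    unfolding positive_orbit3 using r1 \<alpha> by auto
  then have cl1: "(t0 + \<alpha> * \<tau>1, y) \<in> closure (positive_orbit {um..up} sol3 (t0, x))" using closure_subset by blast
  have "(t0, y') \<in> positive_orbit {um..up} sol3 (t0 - \<alpha> * \<tau>2, x')"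
    unfolding positive_orbit3 using r2 \<alpha> by auto
  then have cl2: "(t0, y') \<in> closure (positive_orbit {um..up} sol3 (t0 - \<alpha> * \<tau>2, x'))" using closure_subset by blast
  have inD': "(t0, x) \<in> D" "(t0, y') \<in> D" using pD xy(1) xy'(2) by auto
  have "y \<in> region" "x' \<in> region" using e'(2) xy(2) xy'(1) by (auto simp: dist_commute)
  then have inR: "(t0 + \<alpha> * \<tau>1, y) \<in> UNIV \<times> region" "(t0 - \<alpha> * \<tau>2, x') \<in> UNIV \<times> region" by auto
  show ?thesis
    by (rule lifted.control_sets_equal[OF D control_set_lifted_region inD'(1) inR(1) cl1 inD'(2) inR(2) cl2])
qed

end

section \<open>Uniqueness in the plane\<close>

lemma closure_meets_open:
  assumes "z \<in> closure S" "open U" "z \<in> U"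
  obtains y where "y \<in> S" "y \<in> U"
  using assms open_Int_closure_eq_empty[of U S] by blast

context plane_system begin

lemma scalar_trace_det:
  assumes "A = l *\<^sub>R mat 1"
  shows "trace (S *\<^sub>R A - \<tau> *\<^sub>R B) = 2 * (l * S) - \<tau> * trace B"
    "det (S *\<^sub>R A - \<tau> *\<^sub>R B) = (l * S)\<^sup>2 - l * S * \<tau> * trace B + \<tau>\<^sup>2 * det B"
  by (simp_all add: assms plane_matrix_components det_2 algebra_simps power2_eq_square)

lemma scalar_trace_det_M:
  assumes "A = l *\<^sub>R mat 1"
  shows "trace (M u) = 2 * l - u * trace B" "det (M u) = l\<^sup>2 - l * u * trace B + u\<^sup>2 * det B"
  using scalar_trace_det[OF assms, of 1 u] by (simp_all add: M_def)

context
  fixes l \<beta> :: real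
  assumes A: "A = l *\<^sub>R mat 1" and l: "l \<noteq> 0" and \<beta>: "det (B - \<beta> *\<^sub>R mat 1) = 0"
begin

text \<open>The left eigenvector of \<open>B\<close> for the eigenvalue \<open>\<beta>\<close>, normalised to the value \<open>1\<close> at \<open>b\<close>.\<close>
definition left_eigen :: "plane \<Rightarrow> real" where
  "left_eigen x = wedge x ((B - \<beta> *\<^sub>R mat 1) *v b) / wedge b (B *v b)"

lemma wB: "wedge b (B *v b) \<noteq> 0"
  using cyclic by (auto simp: A mv.scaleR_left wedge_simps)

lemma left_eigen_B: "left_eigen (B *v x) = \<beta> * left_eigen x"
proof -
  have "wedge ((B - \<beta> *\<^sub>R mat 1) *v x) ((B - \<beta> *\<^sub>R mat 1) *v b) = 0" by (simp only: wedge_matrix \<beta> mult_zero_left)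
  moreover have "(B - \<beta> *\<^sub>R mat 1) *v x = B *v x - \<beta> *\<^sub>R x" by (simp add: mv.diff_left mv.scaleR_left)
  ultimately show ?thesis by (simp add: left_eigen_def wedge_simps)
qed

lemma left_eigen_b: "left_eigen b = 1"
  using wB by (simp add: left_eigen_def mv.diff_left mv.scaleR_left wedge_simps)

lemma left_eigen_linear: "bounded_linear left_eigen"
  unfolding linear_conv_bounded_linear[symmetric] left_eigen_def
  by (intro linearI) (auto simp: wedge_simps add_divide_distrib)

text \<open>For \<open>A = l I\<close> the function \<open>X = 1 - \<beta> \<ell>\<close> satisfies \<open>X' = (l - u \<beta>) X - l\<close> along trajectories. With the integrating
  factor, the derivative is \<open>- l\<close> times a positive function, whatever the control is; multiplying by \<open>l\<close>
  treats both signs of \<open>l\<close> together.\<close>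
lemma left_eigen_monotone:
  "reach S \<tau> x y \<Longrightarrow> l * (exp (- (l * S - \<tau> * \<beta>)) * (1 - \<beta> * left_eigen y) - (1 - \<beta> * left_eigen x)) < 0"
proof (induction rule: reach.induct)
  case (step s u x)
  interpret le: bounded_linear left_eigen by (rule left_eigen_linear)
  define \<nu> where "\<nu> = l - u * \<beta>"
  define g where "g = (\<lambda>r. l * (exp (- \<nu> * r) * (1 - \<beta> * left_eigen (flow u r x))))"
  have dec: "\<exists>y. (g has_real_derivative y) (at r) \<and> y < 0" for r
  proof -
    let ?f = "left_eigen (flow u r x)"
    have le_M: "left_eigen (M u *v z + u *\<^sub>R b) = \<nu> * left_eigen z + u" for z
    proof -
      have "M u *v z + u *\<^sub>R b = l *\<^sub>R z - u *\<^sub>R (B *v z) + u *\<^sub>R b"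
        unfolding M_def by (simp add: A mv.diff_left mv.scaleR_left)
      then have "left_eigen (M u *v z + u *\<^sub>R b) = l * left_eigen z - u * (\<beta> * left_eigen z) + u"
        by (simp only: le.add le.diff le.scaleR left_eigen_B left_eigen_b real_scaleR_def mult_1_right)
      then show ?thesis by (simp add: \<nu>_def algebra_simps)
    qed
    have d: "((\<lambda>r. left_eigen (flow u r x)) has_real_derivative \<nu> * ?f + u) (at r)"
      using bounded_linear.has_vector_derivative[OF left_eigen_linear flow_has_vector_derivative[of u x r]]
      by (simp add: le_M has_real_derivative_iff_has_vector_derivative)
    have "(g has_real_derivative l * ((- \<nu> * exp (- \<nu> * r)) * (1 - \<beta> * ?f) + exp (- \<nu> * r) * (- (\<beta> * (\<nu> * ?f + u))))) (at r)"
      unfolding g_def by (auto intro!: derivative_eq_intros d)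
    moreover have "l * ((- \<nu> * exp (- \<nu> * r)) * (1 - \<beta> * ?f) + exp (- \<nu> * r) * (- (\<beta> * (\<nu> * ?f + u)))) = - (l * l * exp (- \<nu> * r))"
      by (simp add: \<nu>_def algebra_simps)
    moreover have "l * l > 0" using l by (metis not_real_square_gt_zero)
    ultimately show ?thesis by (intro exI[of _ "- (l * l * exp (- \<nu> * r))"]) simp
  qed
  have "g s < g 0" by (rule DERIV_neg_imp_decreasing[OF step(1) dec])
  moreover have "- (l * s - u * s * \<beta>) = - \<nu> * s" by (simp add: \<nu>_def algebra_simps)
  moreover have "l * (exp (- \<nu> * s) * (1 - \<beta> * left_eigen (flow u s x)) - (1 - \<beta> * left_eigen x)) = g s - g 0"
    unfolding right_diff_distrib[of l "exp (- \<nu> * s) * (1 - \<beta> * left_eigen (flow u s x))"] by (simp add: g_def)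
  ultimately show ?case by simp
next
  case (trans S \<tau> x y S' \<tau>' z)
  let ?X = "\<lambda>x. 1 - \<beta> * left_eigen x"
  have "exp (- (l * S - \<tau> * \<beta>)) * (l * (exp (- (l * S' - \<tau>' * \<beta>)) * ?X z - ?X y)) < 0"
    using trans.IH(2) by (simp add: mult_pos_neg)
  moreover have "exp (- (l * S - \<tau> * \<beta>)) * (l * (exp (- (l * S' - \<tau>' * \<beta>)) * ?X z - ?X y)) =
     l * (exp (- (l * (S + S') - (\<tau> + \<tau>') * \<beta>)) * ?X z) - l * (exp (- (l * S - \<tau> * \<beta>)) * ?X y)"
  proof -
    have "- (l * (S + S') - (\<tau> + \<tau>') * \<beta>) = - (l * S - \<tau> * \<beta>) + - (l * S' - \<tau>' * \<beta>)" by (simp add: algebra_simps)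
    then have "exp (- (l * (S + S') - (\<tau> + \<tau>') * \<beta>)) = exp (- (l * S - \<tau> * \<beta>)) * exp (- (l * S' - \<tau>' * \<beta>))"
      by (simp only: exp_add)
    moreover have "x1 * (l * (x2 * x3 - x4)) = l * ((x1 * x2) * x3) - l * (x1 * x4)" for x1 x2 x3 x4
      by (simp add: algebra_simps)
    ultimately show ?thesis by (simp only:)
  qed
  moreover have "l * (x1 - x3) = (l * x1 - l * x2) + l * (x2 - x3)" for x1 x2 x3
    by (simp add: algebra_simps)
  ultimately show ?case using trans.IH(1) by (metis add_neg_neg)
qed

lemma left_eigen_loop:
  assumes "reach S \<tau> q q" "1 - \<beta> * left_eigen q > 0"
  shows "l * (l * S - \<tau> * \<beta>) > 0"
proof -
  have "(1 - \<beta> * left_eigen q) * (l * (exp (- (l * S - \<tau> * \<beta>)) - 1)) < 0"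
    using left_eigen_monotone[OF assms(1)] by (simp add: algebra_simps)
  then have "l * (exp (- (l * S - \<tau> * \<beta>)) - 1) < 0"
    using assms(2) by (simp add: mult_less_0_iff)
  then show ?thesis by (auto simp: mult_less_0_iff zero_less_mult_iff)
qed

lemma left_eigen_forward:
  assumes "reach S \<tau> x y" "l < 0" "1 - \<beta> * left_eigen x > 0"
  shows "1 - \<beta> * left_eigen y > 0"
proof -
  have "exp (- (l * S - \<tau> * \<beta>)) * (1 - \<beta> * left_eigen y) > 1 - \<beta> * left_eigen x"
    using left_eigen_monotone[OF assms(1)] assms(2) by (simp add: mult_less_0_iff)
  then have "exp (- (l * S - \<tau> * \<beta>)) * (1 - \<beta> * left_eigen y) > 0" using assms(3) by linarith
  then show ?thesis by (simp add: zero_less_mult_iff)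
qed

lemma left_eigen_backward:
  assumes "reach S \<tau> x y" "l > 0" "1 - \<beta> * left_eigen y > 0"
  shows "1 - \<beta> * left_eigen x > 0"
proof -
  have "exp (- (l * S - \<tau> * \<beta>)) * (1 - \<beta> * left_eigen y) < 1 - \<beta> * left_eigen x"
    using left_eigen_monotone[OF assms(1)] assms(2) by (simp add: mult_less_0_iff)
  moreover have "exp (- (l * S - \<tau> * \<beta>)) * (1 - \<beta> * left_eigen y) > 0" using assms(3) by simp
  ultimately show ?thesis by linarith
qed

lemma left_eigen_open: "open {x. 1 - \<beta> * left_eigen x > 0}"
  by (intro open_Collect_less continuous_intros bounded_linear.continuous_on[OF left_eigen_linear])

lemma left_eigen_0: "left_eigen 0 = 0"
  by (simp add: left_eigen_def wedge_simps)

end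

text \<open>Going back from \<open>x\<close> with the control \<open>0\<close> and then with a control \<open>u \<noteq> 0\<close> gives a map of the two durations with an
  invertible derivative at some point with small positive durations: the determinant is an exponential
  polynomial in one of them that is not constantly zero because \<open>b \<and> x \<noteq> 0\<close>.\<close>
lemma backward_set_interior:
  assumes A: "A = l *\<^sub>R mat 1" and l: "l \<noteq> 0" and U: "open U" "x \<in> U" and bx: "wedge b x \<noteq> 0"
  shows "\<exists>z\<in>U. z \<in> interior {z. \<exists>S \<tau> s. reach S \<tau> z (exp (- l * s) *\<^sub>R x) \<and> s > 0}"
proof -
  let ?B = "{z. \<exists>S \<tau> s. reach S \<tau> z (exp (- l * s) *\<^sub>R x) \<and> s > 0}"
  obtain e where e: "e > 0" "\<And>v. 0 < \<bar>v\<bar> \<and> \<bar>v\<bar> < e \<Longrightarrow> v \<in> {um<..<up} \<and> det (M v) \<noteq> 0"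
    using eventually_small[OF eventually_in_range] by blast
  define u where "u = e / 2"
  have u: "u \<noteq> 0" "u \<in> {um<..<up}" "det (M u) \<noteq> 0" using e(1) e(2)[of u] by (auto simp: u_def)
  define c where "c = eqpt u"
  define F where "F = (\<lambda>p. c + rho (M u) (- fst p) *v (exp (- l * snd p) *\<^sub>R x - c))"
  have F: "F p = flow u (- fst p) (exp (- l * snd p) *\<^sub>R x)" for p
    unfolding F_def c_def flow_eqpt[OF u(3)] rho_M ..
  have "continuous_on UNIV (rho (M u))" by (simp add: continuous_at_imp_continuous_on rho_isCont)
  then have "continuous_on UNIV (\<lambda>p::real \<times> real. rho (M u) (- fst p))"
    by (rule continuous_on_compose2) (intro continuous_intros, simp)
  moreover have "continuous_on UNIV (\<lambda>p::real \<times> real. exp (- l * snd p) *\<^sub>R x - c)"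
    by (intro continuous_intros)
  ultimately have contF: "continuous_on UNIV F"
    unfolding F_def by (intro continuous_on_add continuous_on_const mv.continuous_on)
  then have isF: "isCont F (0, 0)" by (simp add: continuous_on_eq_continuous_at)
  have F0: "F (0, 0) = x" by (simp add: F_def)
  have near: "\<forall>\<^sub>F d in at_right 0. F (d, k d) \<in> U" if k: "(k \<longlongrightarrow> 0) (at_right 0)" for k
  proof -
    have "((\<lambda>d. F (d, k d)) \<longlongrightarrow> F (0, 0)) (at_right 0)"
      by (rule isCont_tendsto_compose[OF isF tendsto_Pair[OF tendsto_ident_at k]])
    then show ?thesis unfolding F0 using U by (rule topological_tendstoD)
  qed
  have "((\<lambda>d::real. d / 2) \<longlongrightarrow> 0 / 2) (at_right 0)" by (intro tendsto_intros) simp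
  then have "\<forall>\<^sub>F d in at_right 0. F (d, d) \<in> U" "\<forall>\<^sub>F d in at_right 0. F (d, d / 2) \<in> U"
    using near[of "\<lambda>d. d"] near[of "\<lambda>d. d / 2"] tendsto_ident_at by auto
  moreover have "\<forall>\<^sub>F d in at_right (0::real). d > 0" by (rule eventually_at_right_less)
  ultimately have "\<forall>\<^sub>F d in at_right 0. F (d, d) \<in> U \<and> F (d, d / 2) \<in> U \<and> d > 0" by eventually_elim auto
  then obtain d where d: "F (d, d) \<in> U" "F (d, d / 2) \<in> U" "d > 0"
    using eventually_happens[of _ "at_right (0::real)"] by auto
  \<comment> \<open>the determinant of the derivative is a nonzero multiple of the difference of the two sides\<close>
  define ok where "ok s \<longleftrightarrow> exp (- l * s) * wedge (B *v x) x \<noteq> wedge b x" for s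
  have "ok d \<or> ok (d / 2)"
  proof (rule ccontr)
    assume "\<not> ?thesis"
    then have eq: "exp (- l * d) * wedge (B *v x) x = wedge b x" "exp (- l * (d / 2)) * wedge (B *v x) x = wedge b x"
      by (auto simp: ok_def)
    then have "wedge (B *v x) x \<noteq> 0" using bx by auto
    then have "exp (- l * d) = exp (- l * (d / 2))" using eq by (metis mult_right_cancel)
    then show False using l d(3) by simp
  qed
  then obtain s where s: "s > 0" "F (d, s) \<in> U" "ok s" using d by (metis half_gt_zero)
  define R where "R = rho (M u) (- d)"
  define k1 where "k1 = - (M u *v (R *v (exp (- l * s) *\<^sub>R x - c)))"
  define k2 where "k2 = (- l * exp (- l * s)) *\<^sub>R (R *v x)"
  let ?S = "{0<..} \<times> {0<..} :: (real \<times> real) set"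
  have "F (d, s) \<in> interior (F ` ?S)"
  proof (rule planar_open_mapping)
    have d1: "((\<lambda>p::real \<times> real. rho (M u) (- fst p)) has_derivative (\<lambda>h. (- fst h) *\<^sub>R (M u ** R))) (at (d, s))"
      unfolding R_def
      by (rule has_derivative_compose[of "\<lambda>p. - fst p" "\<lambda>h. - fst h"])
         (use rho_has_vector_derivative[of "M u" "- d"] in \<open>auto simp: has_vector_derivative_def intro!: derivative_eq_intros\<close>)
    have d2: "((\<lambda>p::real \<times> real. exp (- l * snd p) *\<^sub>R x - c) has_derivative (\<lambda>h. (snd h * (- l * exp (- l * s))) *\<^sub>R x)) (at (d, s))"
      by (auto intro!: derivative_eq_intros)
    have "(F has_derivative (\<lambda>h. 0 + (rho (M u) (- fst (d, s)) *v ((snd h * (- l * exp (- l * s))) *\<^sub>R x)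
        + ((- fst h) *\<^sub>R (M u ** R)) *v (exp (- l * snd (d, s)) *\<^sub>R x - c)))) (at (d, s))"
      unfolding F_def by (intro has_derivative_add has_derivative_const mv.FDERIV d1 d2)
    moreover have "0 + (rho (M u) (- fst (d, s)) *v ((snd h * (- l * exp (- l * s))) *\<^sub>R x)
        + ((- fst h) *\<^sub>R (M u ** R)) *v (exp (- l * snd (d, s)) *\<^sub>R x - c)) = fst h *\<^sub>R k1 + snd h *\<^sub>R k2" for h
      by (simp add: k1_def k2_def R_def mv.scaleR_right mv.scaleR_left mv.minus_left mv.minus_right matrix_vector_mul_assoc)
    ultimately show "(F has_derivative (\<lambda>h. fst h *\<^sub>R k1 + snd h *\<^sub>R k2)) (at (d, s))" by simp
    have detR: "det R \<noteq> 0"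
    proof
      assume "det R = 0"
      then have "wedge (rho (M u) (- (- d)) *v (R *v b)) (rho (M u) (- (- d)) *v (R *v x)) = 0"
        by (simp add: wedge_matrix)
      then show False using bx unfolding R_def rho_minus_vector by simp
    qed
    have "M u *v x = l *\<^sub>R x - u *\<^sub>R (B *v x)" unfolding M_def by (simp add: A mv.diff_left mv.scaleR_left)
    then have "M u *v (exp (- l * s) *\<^sub>R x - c) = (exp (- l * s) * l) *\<^sub>R x - (exp (- l * s) * u) *\<^sub>R (B *v x) + u *\<^sub>R b"
      by (simp add: c_def mv.diff_right mv.scaleR_right eqpt_zero[OF u(3)] scaleR_diff_right)
    then have "wedge (M u *v (exp (- l * s) *\<^sub>R x - c)) x =
        wedge ((exp (- l * s) * l) *\<^sub>R x - (exp (- l * s) * u) *\<^sub>R (B *v x) + u *\<^sub>R b) x"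
      by (simp only:)
    also have "\<dots> = u * (wedge b x - exp (- l * s) * wedge (B *v x) x)"
      by (simp add: wedge_simps algebra_simps)
    finally have "wedge (M u *v (exp (- l * s) *\<^sub>R x - c)) x = u * (wedge b x - exp (- l * s) * wedge (B *v x) x)" .
    then have "wedge (M u *v (exp (- l * s) *\<^sub>R x - c)) x \<noteq> 0" using u(1) s(3) by (auto simp: ok_def)
    moreover have "wedge k1 k2 = l * exp (- l * s) * (det R * wedge (M u *v (exp (- l * s) *\<^sub>R x - c)) x)"
    proof -
      have "wedge k1 k2 = (- 1) * ((- l * exp (- l * s)) * wedge (R *v (M u *v (exp (- l * s) *\<^sub>R x - c))) (R *v x))"
        unfolding k1_def k2_def R_def rho_commute_M by (simp add: wedge_def algebra_simps)
      then show ?thesis unfolding wedge_matrix by simp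
    qed
    ultimately show "wedge k1 k2 \<noteq> 0" using detR l by simp
  qed (use contF s d in \<open>auto intro: continuous_on_subset open_Times\<close>)
  moreover have "F ` ?S \<subseteq> ?B"
  proof (rule image_subsetI)
    fix p assume "p \<in> ?S"
    then have p: "fst p > 0" "snd p > 0" by (auto simp: mem_Times_iff)
    have "reach (fst p) (u * fst p) (F p) (flow u (fst p) (F p))" by (rule reach.step) (use p u in auto)
    moreover have "flow u (fst p) (F p) = exp (- l * snd p) *\<^sub>R x" by (simp add: F flow_inverse)
    ultimately show "F p \<in> ?B" using p(2) by auto
  qed
  ultimately show ?thesis using s(2) interior_mono by blast
qed

lemma scalar_drift:
  assumes "A = l *\<^sub>R mat 1"
  shows "flow 0 s (exp (- l * s) *\<^sub>R x) = x"
proof -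
  have "A *v x = l *\<^sub>R x" for x by (simp add: assms mv.scaleR_left)
  then have "rho A s *v x = exp (s * l) *\<^sub>R x" for x unfolding rho_def by (rule mat_exp_eigenvector)
  then have "flow 0 s (exp (- l * s) *\<^sub>R x) = (exp (s * l) * exp (- l * s)) *\<^sub>R x" by (simp add: flow_def)
  also have "exp (s * l) * exp (- l * s) = 1" by (simp flip: exp_add)
  finally show ?thesis by simp
qed

text \<open>The linear part of the loop, or its inverse, decays under iteration. So the hub \<open>h0\<close> reaches points close to \<open>q\<close>
  (\<open>l < 0\<close>), or points close to \<open>q\<close> reach \<open>h0\<close> (\<open>l > 0\<close>).\<close>
lemma loop_near_region:
  assumes A: "A = l *\<^sub>R mat 1" and l: "l \<noteq> 0" and r: "reach S \<tau> q q"
    and N: "l * trace (S *\<^sub>R A - \<tau> *\<^sub>R B) > 0" "det (S *\<^sub>R A - \<tau> *\<^sub>R B) > 0" and e: "e > 0"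
  shows "\<exists>z\<in>region. dist z q < e"
proof -
  let ?N = "S *\<^sub>R A - \<tau> *\<^sub>R B"
  have "l * l > 0" using l by (metis not_real_square_gt_zero)
  then have detA: "det A > 0" "trace A = 2 * l" by (simp_all add: A det_2 plane_matrix_components)
  have seq: "filterlim (\<lambda>k. real (Suc k)) at_top sequentially"
    by (rule filterlim_compose[OF filterlim_real_sequentially filterlim_Suc])
  show ?thesis
  proof (cases "l < 0")
    case True
    have trN: "trace ?N < 0" using N(1) True by (simp add: zero_less_mult_iff)
    have near: "\<exists>y. reaches h0 y \<and> dist y q < e" if e: "e > 0" for e
    proof -
      from filterlim_compose[OF mat_exp_stable_tendsto_0[OF trN N(2), of "h0 - q"] seq]
      have "\<forall>\<^sub>F k in sequentially. dist (mat_exp (real (Suc k) *\<^sub>R ?N) *v (h0 - q)) 0 < e"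
        using e by (rule tendstoD)
      then obtain k where k: "norm (mat_exp (real (Suc k) *\<^sub>R ?N) *v (h0 - q)) < e"
        by (auto dest: eventually_happens)
      have "E (real (Suc k) * S) (real (Suc k) * \<tau>) = mat_exp (real (Suc k) *\<^sub>R ?N)"
        by (simp only: E_def scaleR_diff_right scaleR_scaleR)
      then have "reaches h0 (q + mat_exp (real (Suc k) *\<^sub>R ?N) *v (h0 - q))"
        using reach_shift[OF reach_loop_repeat[OF r, of k], of h0] reachesI by metis
      then show ?thesis using k by (intro exI conjI) (auto simp: dist_norm)
    qed
    then have "q \<in> closure {y. reaches h0 y}" unfolding closure_approachable by blast
    moreover have "reaches q h0" by (rule reaches_h0_if_stable) (use detA True in auto)
    ultimately have "q \<in> region" unfolding region_def by simp
    then show ?thesis using e by (intro bexI[of _ q]) auto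
  next
    case False
    then have pos: "l > 0" using l by simp
    have "trace (- ?N) < 0" "det (- ?N) > 0"
      using N pos unfolding trace_det_uminus by (auto simp: zero_less_mult_iff)
    from filterlim_compose[OF mat_exp_stable_tendsto_0[OF this, of "h0 - q"] seq]
    have "\<forall>\<^sub>F k in sequentially. dist (mat_exp (real (Suc k) *\<^sub>R (- ?N)) *v (h0 - q)) 0 < e"
      using e by (rule tendstoD)
    then obtain k where k: "norm (mat_exp (real (Suc k) *\<^sub>R (- ?N)) *v (h0 - q)) < e"
      by (auto dest: eventually_happens)
    let ?S = "real (Suc k) * S" and ?\<tau> = "real (Suc k) * \<tau>"
    define z where "z = q + E (- ?S) (- ?\<tau>) *v (h0 - q)"
    have "E (- ?S) (- ?\<tau>) = mat_exp (real (Suc k) *\<^sub>R (- ?N))"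
      by (simp only: E_def) (simp add: algebra_simps del: of_nat_Suc)
    then have dz: "dist z q < e" using k by (simp add: z_def dist_norm)
    have "reaches z (q + E ?S ?\<tau> *v (z - q))"
      using reach_shift[OF reach_loop_repeat[OF r, of k]] reachesI by blast
    then have "reaches z h0" by (simp add: z_def E_inverse del: of_nat_Suc)
    moreover have "reaches h0 z" by (rule reached_from_h0_if_unstable) (use detA pos in auto)
    ultimately show ?thesis using region_if_mutual dz by blast
  qed
qed

end

context plane_system_lift begin

text \<open>The set \<open>D\<close> lies in the closure of the orbit of \<open>x\<close>, so this orbit meets the open set of points that can be steered to \<open>x\<close>. The loop ends with
  the control \<open>0\<close> for a positive time, which later makes an inequality strict.\<close>
lemma exact_loop:
  assumes A: "A = l *\<^sub>R mat 1" and l: "l \<noteq> 0"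
    and D: "control_set euclidean {um..up} sol2 D" and x: "x \<in> interior D" "wedge b x \<noteq> 0"
  shows "\<exists>S \<tau> s. s > 0 \<and> reach S \<tau> x (exp (- l * s) *\<^sub>R x) \<and> reach (S + s) \<tau> x x"
proof -
  obtain z where z: "z \<in> interior D" "z \<in> interior {z. \<exists>S \<tau> s. reach S \<tau> z (exp (- l * s) *\<^sub>R x) \<and> s > 0}"
    using backward_set_interior[OF A l open_interior x] by blast
  have "x \<in> D" "z \<in> D" using x(1) z(1) interior_subset by blast+
  then have "z \<in> closure {y. reaches x y}"
    using D unfolding control_set_def pre_control_set_def positive_orbit2 by auto
  from closure_meets_open[OF this open_interior z(2)]
  obtain y where y: "reaches x y" "y \<in> interior {z. \<exists>S \<tau> s. reach S \<tau> z (exp (- l * s) *\<^sub>R x) \<and> s > 0}"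
    by blast
  then obtain S \<tau> s where s: "reach S \<tau> y (exp (- l * s) *\<^sub>R x)" "s > 0" using interior_subset by blast
  obtain S1 \<tau>1 where "reach S1 \<tau>1 x y" using y(1) unfolding reaches_def by blast
  from reach.trans[OF this s(1)] have r: "reach (S1 + S) (\<tau>1 + \<tau>) x (exp (- l * s) *\<^sub>R x)" .
  have "reach s (0 * s) (exp (- l * s) *\<^sub>R x) (flow 0 s (exp (- l * s) *\<^sub>R x))"
    by (rule reach.step[OF s(2)]) (use um up in auto)
  then have "reach s 0 (exp (- l * s) *\<^sub>R x) x" by (simp only: scalar_drift[OF A] mult_zero_left)
  from reach.trans[OF r this] show ?thesis using r s(2) by auto
qed

lemma exists_off_line:
  assumes "open W" "q \<in> W" "wedge b (B *v b) \<noteq> 0"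
  shows "\<exists>q\<in>W. wedge b q \<noteq> 0"
proof (cases "wedge b q = 0")
  case True
  have "((\<lambda>t. q + t *\<^sub>R (B *v b)) \<longlongrightarrow> q + 0 *\<^sub>R (B *v b)) (at_right 0)" by (intro tendsto_intros)
  then have "\<forall>\<^sub>F t in at_right 0. q + t *\<^sub>R (B *v b) \<in> W"
    using assms(1,2) by (simp add: tendsto_def)
  moreover have "\<forall>\<^sub>F t in at_right (0::real). t > 0" by (rule eventually_at_right_less)
  ultimately have "\<forall>\<^sub>F t in at_right 0. q + t *\<^sub>R (B *v b) \<in> W \<and> t > 0" by eventually_elim auto
  then obtain t where t: "q + t *\<^sub>R (B *v b) \<in> W" "t > 0"
    using eventually_happens[of _ "at_right (0::real)"] by auto
  have "wedge b (q + t *\<^sub>R (B *v b)) = t * wedge b (B *v b)" by (simp add: wedge_simps True)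
  then show ?thesis using t assms(3) by (intro bexI[OF _ t(1)]) auto
qed (use assms in auto)

text \<open>If \<open>0\<close> is no hub, then \<open>A = l I\<close>, and it suffices to find a loop in the interior of \<open>D\<close> whose linear part is
  the exponential of a matrix with eigenvalues whose real parts have the sign of \<open>l\<close>. Suppose first that \<open>B\<close> has no
  real eigenvalue. If no \<open>A - u B\<close> is a centre, the trace of \<open>A - u B\<close> has the sign of \<open>l\<close> for all interior \<open>u\<close>, and
  every loop that uses the control \<open>0\<close> for some time will do. If \<open>B\<close> has real eigenvalues, the loop is taken
  through a point where both functions \<open>1 - \<beta> \<ell>\<close> are positive; such points are found along a trajectory that starts
  (\<open>l < 0\<close>) or ends (\<open>l > 0\<close>) near \<open>0\<close>.\<close>
theorem planar_control_set_unique: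
  assumes D: "control_set euclidean {um..up} sol2 D" and int: "interior D \<noteq> {}" and cl0: "0 \<in> closure D"
  shows "D = region"
proof (cases "wedge b (A *v b) = 0")
  case False
  have "hub (eqpt 0)" by (rule eqpt_hub) (use False um up det_A in auto)
  then obtain e where e: "e > 0" "\<And>y. dist y 0 < e \<Longrightarrow> reaches 0 y \<and> reaches y 0" and hub0: "hub 0" unfolding hub_def by auto
  obtain x where x: "x \<in> region" "dist x 0 < e" using zero_in_closure_region e(1) unfolding closure_approachable by blast
  obtain r where r: "r > 0" "\<And>y. dist y h0 < r \<Longrightarrow> reaches y h0" using h0_hub unfolding hub_def by blast
  obtain y where y: "reaches h0 y" "dist y x < e - dist x 0"
  proof -
    have "x \<in> closure {y. reaches h0 y}" "e - dist x 0 > 0" using x by (auto simp: region_def)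
    then show thesis using that unfolding closure_approachable by blast
  qed
  have "dist y 0 < e" using dist_triangle[of y 0 x] y(2) by linarith
  then have "reaches h0 0" using y(1) e(2) reaches_trans by blast
  moreover have "reaches 0 h0" using e(2)[OF x(2)] x(1) reaches_trans unfolding region_def by blast
  ultimately have "0 \<in> interior region" using hub_in_interior_region[OF hub0] by blast
  then obtain d where d: "d > 0" "ball 0 d \<subseteq> region" unfolding mem_interior by blast
  obtain y where "y \<in> D" "dist y 0 < d" using cl0 d(1) unfolding closure_approachable by blast
  then have "y \<in> region" using d(2) by (auto simp: dist_commute)
  then show ?thesis using planar.control_sets_equal_if_intersect[OF D control_set_region \<open>y \<in> D\<close>] by blast
next
  case True
  then obtain l where l: "l \<noteq> 0" and A: "A = l *\<^sub>R mat 1" using scalar_if_not_cyclic by blast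
  have wB: "wedge b (B *v b) \<noteq> 0" using cyclic True by simp
  have cl: "q' \<in> closure {y. reaches q y}" if "q \<in> D" "q' \<in> D" for q q'
    using D that unfolding control_set_def pre_control_set_def positive_orbit2 by auto
  have finish: "D = region"
    if q: "q \<in> interior D" and r: "reach S \<tau> q q" and N: "l * trace (S *\<^sub>R A - \<tau> *\<^sub>R B) > 0" "det (S *\<^sub>R A - \<tau> *\<^sub>R B) > 0" for q S \<tau>
  proof -
    obtain e where e: "e > 0" "ball q e \<subseteq> D" using q unfolding mem_interior by blast
    obtain z where "z \<in> region" "dist z q < e" using loop_near_region[OF A l r N e(1)] by blast
    then show ?thesis using e(2) planar.control_sets_equal_if_intersect[OF D control_set_region, of z]
      by (auto simp: dist_commute)
  qed
  show ?thesis
  proof (cases "\<exists>u\<in>{um<..<up}. det (M u) > 0 \<and> trace (M u) = 0")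
    case True
    then have "region = UNIV" using region_UNIV by blast
    then show ?thesis using D control_set_region unfolding control_set_def by auto
  next
    case no_centre: False
    define T where "T = trace B"
    define \<Delta> where "\<Delta> = det B"
    show ?thesis
    proof (cases "T\<^sup>2 < 4 * \<Delta>")
      case True
      have pos: "a\<^sup>2 - a * c * T + c\<^sup>2 * \<Delta> > 0" if "a \<noteq> 0" for a c
      proof -
        have "a\<^sup>2 - a * c * T + c\<^sup>2 * \<Delta> = (a - c * T / 2)\<^sup>2 + c\<^sup>2 * (\<Delta> - T\<^sup>2 / 4)"
          by (simp add: power2_eq_square algebra_simps)
        moreover have "(a - c * T / 2)\<^sup>2 + c\<^sup>2 * (\<Delta> - T\<^sup>2 / 4) > 0"
          using True that by (cases "c = 0") (auto intro!: add_nonneg_pos)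
        ultimately show ?thesis by simp
      qed
      have nonneg: "l * (2 * l - u * T) \<ge> 0" if "u \<in> {um..up}" for u
      proof (rule ccontr)
        assume neg: "\<not> ?thesis"
        have ll: "l * l > 0" using l by (metis not_real_square_gt_zero)
        \<comment> \<open>the trace would vanish at the control \<open>\<theta> * u\<close> between \<open>0\<close> and \<open>u\<close>\<close>
        define \<theta> where "\<theta> = 2 * (l * l) / (u * (l * T))"
        have big: "u * (l * T) > 2 * (l * l)" using neg by (simp add: algebra_simps)
        have quot: "0 < a / c \<and> a / c < 1 \<and> a / c * c = a" if "0 < a" "a < c" for a c :: real
          using that by simp
        have "0 < \<theta> \<and> \<theta> < 1 \<and> \<theta> * (u * (l * T)) = 2 * (l * l)"
          unfolding \<theta>_def by (rule quot) (use ll big in auto)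
        then have \<theta>: "0 < \<theta>" "\<theta> < 1" "\<theta> * (u * (l * T)) = 2 * (l * l)" by auto
        have "l * (2 * l - (\<theta> * u) * T) = 2 * (l * l) - \<theta> * (u * (l * T))" by (simp add: algebra_simps)
        also have "\<dots> = 0" unfolding \<theta>(3) by (rule diff_self)
        finally have "trace (M (\<theta> * u)) = 0" using l by (simp add: scalar_trace_det_M[OF A] T_def)
        moreover have "det (M (\<theta> * u)) > 0" using pos[OF l, of "\<theta> * u"] by (simp add: scalar_trace_det_M[OF A] T_def \<Delta>_def mult_ac)
        moreover have "\<theta> * u \<in> {um<..<up}"
        proof (cases "u \<ge> 0")
          case True
          then have "0 \<le> \<theta> * u" using \<theta>(1) by simp
          moreover have "\<theta> * u < up"
          proof (cases "u = 0")
            case False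
            then have "\<theta> * u < u" using \<open>u \<ge> 0\<close> \<theta>(2) by simp
            then show ?thesis using \<open>u \<in> {um..up}\<close> by simp
          qed (use up in simp)
          ultimately show ?thesis using um by simp
        next
          case False
          then have "u < \<theta> * u" "\<theta> * u < 0" using \<theta> by (auto simp: mult_less_0_iff)
          then show ?thesis using \<open>u \<in> {um..up}\<close> up by auto
        qed
        ultimately show False using no_centre by blast
      qed
      obtain q where q: "q \<in> interior D" "wedge b q \<noteq> 0" using exists_off_line[OF open_interior _ wB] int by blast
      obtain S \<tau> s where s: "s > 0" "reach S \<tau> q (exp (- l * s) *\<^sub>R q)" "reach (S + s) \<tau> q q"
        using exact_loop[OF A l D q] by blast
      have S: "S > 0" "um * S \<le> \<tau>" "\<tau> \<le> up * S" using reach_bounds[OF s(2)] by auto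
      have "\<tau> / S \<in> {um..up}" using S by (simp add: field_simps)
      from mult_nonneg_nonneg[OF nonneg[OF this], of S] have "l * (2 * (l * S) - \<tau> * T) \<ge> 0"
        using S(1) by (simp add: algebra_simps)
      moreover have "l * (2 * (l * (S + s)) - \<tau> * T) = l * (2 * (l * S) - \<tau> * T) + 2 * (l * l) * s" by (simp add: algebra_simps)
      moreover have "l * l * s > 0" using l s(1) by (metis mult_pos_pos not_real_square_gt_zero)
      ultimately have "l * (2 * (l * (S + s)) - \<tau> * T) > 0" by linarith
      then show ?thesis
        using finish[OF q(1) s(3)] pos[of "l * (S + s)" \<tau>] l S(1) s(1)
        by (simp add: scalar_trace_det[OF A] T_def \<Delta>_def)
    next
      case False
      define D' where "D' = sqrt (T\<^sup>2 - 4 * \<Delta>)"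
      have D': "D' * D' = T\<^sup>2 - 4 * \<Delta>" using False by (simp add: D'_def)
      define \<beta>1 where "\<beta>1 = (T - D') / 2"
      define \<beta>2 where "\<beta>2 = (T + D') / 2"
      have sum: "\<beta>1 + \<beta>2 = T" by (simp add: \<beta>1_def \<beta>2_def field_simps)
      have prod: "\<beta>1 * \<beta>2 = \<Delta>" using D' by (simp add: \<beta>1_def \<beta>2_def field_simps power2_eq_square)
      have char: "det (B - \<beta> *\<^sub>R mat 1) = (\<beta> - \<beta>1) * (\<beta> - \<beta>2)" for \<beta>
      proof -
        have "det (B - \<beta> *\<^sub>R mat 1) = \<beta> * \<beta> - T * \<beta> + \<Delta>"
          by (simp add: det_2 T_def \<Delta>_def plane_matrix_components algebra_simps)
        then show ?thesis by (simp add: sum[symmetric] prod[symmetric] algebra_simps)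
      qed
      have \<beta>: "det (B - \<beta>1 *\<^sub>R mat 1) = 0" "det (B - \<beta>2 *\<^sub>R mat 1) = 0" by (simp_all add: char)
      define W where "W = {x. 1 - \<beta>1 * left_eigen \<beta>1 x > 0} \<inter> {x. 1 - \<beta>2 * left_eigen \<beta>2 x > 0}"
      have W: "open W" "0 \<in> W"
        using left_eigen_open[OF A l \<beta>(1)] left_eigen_open[OF A l \<beta>(2)] left_eigen_0[OF A l \<beta>(1)] left_eigen_0[OF A l \<beta>(2)]
        by (auto simp: W_def)
      obtain y where y: "y \<in> D" "y \<in> W" using closure_meets_open[OF cl0 W] by blast
      have "\<exists>q. q \<in> interior D \<inter> W"
      proof (cases "l < 0")
        case True
        obtain q0 where "q0 \<in> interior D" using int by blast
        then have "q0 \<in> D" using interior_subset by blast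
        from closure_meets_open[OF cl[OF y(1) this] open_interior \<open>q0 \<in> interior D\<close>]
        obtain q where q: "q \<in> interior D" "reaches y q" by blast
        then obtain S \<tau> where "reach S \<tau> y q" unfolding reaches_def by blast
        then have "q \<in> W" using left_eigen_forward[OF A l \<beta>(1)] left_eigen_forward[OF A l \<beta>(2)] True y(2) unfolding W_def by blast
        then show ?thesis using q(1) by blast
      next
        case False
        then have pos: "l > 0" using l by simp
        obtain q where q: "q \<in> interior D" using int by blast
        then have "q \<in> D" using interior_subset by blast
        from closure_meets_open[OF cl[OF this y(1)] W(1) y(2)]
        obtain y' where y': "y' \<in> W" "reaches q y'" by blast
        then obtain S \<tau> where "reach S \<tau> q y'" unfolding reaches_def by blast
        then have "q \<in> W" using left_eigen_backward[OF A l \<beta>(1)] left_eigen_backward[OF A l \<beta>(2)] pos y'(1) unfolding W_def by blast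
        then show ?thesis using q by blast
      qed
      then obtain q where q: "q \<in> interior D" "q \<in> W" "wedge b q \<noteq> 0"
        using exists_off_line[of "interior D \<inter> W", OF open_Int[OF open_interior W(1)] _ wB] by blast
      obtain S \<tau> where r: "reach S \<tau> q q" using exact_loop[OF A l D q(1,3)] by blast
      define \<nu>1 where "\<nu>1 = l * S - \<tau> * \<beta>1"
      define \<nu>2 where "\<nu>2 = l * S - \<tau> * \<beta>2"
      have \<nu>: "l * \<nu>1 > 0" "l * \<nu>2 > 0"
        using left_eigen_loop[OF A l \<beta>(1) r] left_eigen_loop[OF A l \<beta>(2) r] q(2) by (auto simp: W_def \<nu>1_def \<nu>2_def)
      have "trace (S *\<^sub>R A - \<tau> *\<^sub>R B) = \<nu>1 + \<nu>2"
        unfolding scalar_trace_det[OF A] T_def[symmetric] sum[symmetric] by (simp add: \<nu>1_def \<nu>2_def algebra_simps)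
      moreover have "det (S *\<^sub>R A - \<tau> *\<^sub>R B) = \<nu>1 * \<nu>2"
        unfolding scalar_trace_det[OF A] T_def[symmetric] \<Delta>_def[symmetric] sum[symmetric] prod[symmetric]
        by (simp add: \<nu>1_def \<nu>2_def algebra_simps power2_eq_square)
      moreover have "\<nu>1 * \<nu>2 > 0" using \<nu> by (auto simp: zero_less_mult_iff)
      moreover have "l * (\<nu>1 + \<nu>2) > 0" using \<nu> by (simp add: distrib_left)
      ultimately show ?thesis using finish[OF q(1) r] by simp
    qed
  qed
qed

end

section \<open>From the group to the planar system\<close>

lemma has_vector_derivative_vecI:
  assumes "\<And>i. ((\<lambda>t. f t $ i) has_real_derivative f' $ i) (at s)"
  shows "((f :: real \<Rightarrow> real^'n) has_vector_derivative f') (at s)"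
  unfolding has_vector_derivative_def
proof (subst has_derivative_componentwise_within, intro ballI)
  fix e :: "real^'n" assume "e \<in> Basis"
  then obtain i where e: "e = axis i 1" by (auto simp: Basis_vec_def)
  show "((\<lambda>t. f t \<bullet> e) has_derivative (\<lambda>h. h *\<^sub>R f' \<bullet> e)) (at s)"
    using assms[of i] by (simp add: e inner_axis has_field_derivative_def mult_commute_abs)
qed

lemma vf_solution_push:
  assumes der: "\<And>x. (h has_derivative h' x) (at x)"
    and f0: "\<And>x. h' x (f0 x) = g0 (h x)" and f1: "\<And>x. h' x (f1 x) = g1 (h x)"
    and c: "vf_solution f0 f1 u c"
  shows "vf_solution g0 g1 u (h \<circ> c)"
  unfolding vf_solution_def
proof (intro conjI allI impI)
  have "continuous_on UNIV h" by (intro continuous_at_imp_continuous_on ballI has_derivative_continuous[OF der])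
  then show "continuous_on UNIV (h \<circ> c)"
    using c continuous_on_compose[of UNIV c h] continuous_on_subset unfolding vf_solution_def by blast
  fix s assume "locally_constant_at u s"
  then have "(c has_vector_derivative f0 (c s) + u s *\<^sub>R f1 (c s)) (at s)" using c by (simp add: vf_solution_def)
  then have "(c has_derivative (\<lambda>r. r *\<^sub>R (f0 (c s) + u s *\<^sub>R f1 (c s)))) (at s)" by (simp add: has_vector_derivative_def)
  from has_derivative_compose[OF this der]
  have "((h \<circ> c) has_derivative (\<lambda>r. h' (c s) (r *\<^sub>R (f0 (c s) + u s *\<^sub>R f1 (c s))))) (at s)" by (simp add: o_def)
  moreover have "h' (c s) (r *\<^sub>R (f0 (c s) + u s *\<^sub>R f1 (c s))) = r *\<^sub>R (g0 ((h \<circ> c) s) + u s *\<^sub>R g1 ((h \<circ> c) s))" for r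
  proof -
    interpret bounded_linear "h' (c s)" using der has_derivative_bounded_linear by blast
    show ?thesis by (simp add: scaleR add f0 f1)
  qed
  ultimately show "((h \<circ> c) has_vector_derivative g0 ((h \<circ> c) s) + u s *\<^sub>R g1 ((h \<circ> c) s)) (at s)"
    by (simp add: has_vector_derivative_def)
qed

text \<open>Control sets depend only on the topology and on the solutions, so a homeomorphism that matches the solutions
  matches the control sets.\<close>
locale conjugate_systems =
  fixes T :: "'b topology" and h :: "'a::metric_space \<Rightarrow> 'b"
    and sol :: "(real \<Rightarrow> real) \<Rightarrow> (real \<Rightarrow> 'a) \<Rightarrow> bool"
    and sol' :: "(real \<Rightarrow> real) \<Rightarrow> (real \<Rightarrow> 'b) \<Rightarrow> bool"
  assumes homeo: "homeomorphic_map euclidean T h"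
    and sol': "\<And>u c'. sol' u c' \<longleftrightarrow> (\<exists>c. c' = h \<circ> c \<and> sol u c)"
begin

lemma inj: "inj h" using homeo by (simp add: homeomorphic_eq_everything_map)

lemma range_h: "range h = topspace T"
  using homeo by (simp add: homeomorphic_eq_everything_map)

lemma orbit_image: "positive_orbit \<Omega> sol' (h x) = h ` positive_orbit \<Omega> sol x"
proof (intro equalityI subsetI)
  fix y assume "y \<in> positive_orbit \<Omega> sol' (h x)"
  then obtain c S u where "y = h (c S)" "S > 0" "u \<in> controls \<Omega>" "sol u c" "h (c 0) = h x"
    unfolding positive_orbit_def sol' by auto
  then show "y \<in> h ` positive_orbit \<Omega> sol x"
    using inj unfolding positive_orbit_def inj_eq[OF inj] by blast
next
  fix y assume "y \<in> h ` positive_orbit \<Omega> sol x"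
  then obtain c S u where "y = (h \<circ> c) S" "S > 0" "u \<in> controls \<Omega>" "sol u c" "(h \<circ> c) 0 = h x"
    unfolding positive_orbit_def by auto
  then show "y \<in> positive_orbit \<Omega> sol' (h x)"
    unfolding positive_orbit_def sol' by blast
qed

lemma pre_control_set_image: "pre_control_set T \<Omega> sol' (h ` D) \<longleftrightarrow> pre_control_set euclidean \<Omega> sol D"
proof -
  have 1: "h ` D \<subseteq> topspace T" using range_h by blast
  have 2: "(\<exists>c'. sol' u c' \<and> c' 0 = h x \<and> c' ` {0..} \<subseteq> h ` D) \<longleftrightarrow> (\<exists>c. sol u c \<and> c 0 = x \<and> c ` {0..} \<subseteq> D)" for u x
    unfolding sol'
  proof
    assume "\<exists>c'. (\<exists>c. c' = h \<circ> c \<and> sol u c) \<and> c' 0 = h x \<and> c' ` {0..} \<subseteq> h ` D"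
    then obtain c where c: "sol u c" "h (c 0) = h x" "h ` c ` {0..} \<subseteq> h ` D" by (auto simp: image_comp)
    then show "\<exists>c. sol u c \<and> c 0 = x \<and> c ` {0..} \<subseteq> D"
      using inj by (metis inj_eq inj_image_subset_iff)
  next
    assume "\<exists>c. sol u c \<and> c 0 = x \<and> c ` {0..} \<subseteq> D"
    then obtain c where "sol u c" "c 0 = x" "c ` {0..} \<subseteq> D" by blast
    then show "\<exists>c'. (\<exists>c. c' = h \<circ> c \<and> sol u c) \<and> c' 0 = h x \<and> c' ` {0..} \<subseteq> h ` D"
      by (intro exI[of _ "h \<circ> c"]) auto
  qed
  have 3: "h ` D \<subseteq> T closure_of positive_orbit \<Omega> sol' (h x) \<longleftrightarrow> D \<subseteq> closure (positive_orbit \<Omega> sol x)" for x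
    unfolding orbit_image homeomorphic_map_closure_of[OF homeo, simplified]
    using inj by (simp add: inj_image_subset_iff)
  show ?thesis unfolding pre_control_set_def using 1 2 3 by simp
qed

lemma control_set_image: "control_set T \<Omega> sol' (h ` D) \<longleftrightarrow> control_set euclidean \<Omega> sol D"
proof -
  have "D' = h ` (h -` D')" if "pre_control_set T \<Omega> sol' D'" for D'
    using that range_h unfolding pre_control_set_def by auto
  then have "(\<forall>D'. pre_control_set T \<Omega> sol' D' \<and> h ` D \<subseteq> D' \<longrightarrow> D' = h ` D) \<longleftrightarrow>
    (\<forall>D'. pre_control_set T \<Omega> sol' (h ` D') \<and> h ` D \<subseteq> h ` D' \<longrightarrow> h ` D' = h ` D)"
    by metis
  then show ?thesis
    unfolding control_set_def pre_control_set_image using inj by (simp add: inj_image_subset_iff inj_image_eq_iff)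
qed

lemma control_set_iff: "control_set T \<Omega> sol' D' \<longleftrightarrow> (\<exists>D. D' = h ` D \<and> control_set euclidean \<Omega> sol D)"
proof
  assume D': "control_set T \<Omega> sol' D'"
  then have "D' = h ` (h -` D')" using range_h unfolding control_set_def pre_control_set_def by auto
  then show "\<exists>D. D' = h ` D \<and> control_set euclidean \<Omega> sol D" using D' control_set_image by metis
qed (auto simp: control_set_image)

lemma unique_control_set_image:
  assumes "\<And>D. control_set euclidean \<Omega> sol D \<and> interior D \<noteq> {} \<and> P D \<longleftrightarrow> D = D0"
    and "\<And>D. P' (h ` D) \<longleftrightarrow> P D"
  shows "control_set T \<Omega> sol' D' \<and> T interior_of D' \<noteq> {} \<and> P' D' \<longleftrightarrow> D' = h ` D0"
proof -
  have "T interior_of (h ` D) \<noteq> {} \<longleftrightarrow> interior D \<noteq> {}" for D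
    by (simp add: homeomorphic_map_interior_of[OF homeo])
  note int = this
  show ?thesis
  proof
    assume L: "control_set T \<Omega> sol' D' \<and> T interior_of D' \<noteq> {} \<and> P' D'"
    then have "control_set T \<Omega> sol' D'" by (rule conjunct1)
    then obtain D where D: "D' = h ` D" "control_set euclidean \<Omega> sol D" unfolding control_set_iff by blast
    then have "D = D0" using L assms(1)[of D] assms(2)[of D] int[of D] by simp
    then show "D' = h ` D0" using D(1) by simp
  next
    assume "D' = h ` D0"
    then show "control_set T \<Omega> sol' D' \<and> T interior_of D' \<noteq> {} \<and> P' D'"
      using assms(1)[of D0] assms(2)[of D0] int[of D0] by (simp add: control_set_image)
  qed
qed

end

lemma matrix_Lam:
  assumes "\<theta> ** A = A ** \<theta>"
  shows "A *v Lam \<theta> t z = Lam \<theta> t (A *v z)"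
proof -
  let ?f = "\<lambda>t. A *v Lam \<theta> t z - Lam \<theta> t (A *v z)"
  have "(?f has_vector_derivative A *v (rho \<theta> t *v z) - rho \<theta> t *v (A *v z)) (at t)" for t
    by (intro has_vector_derivative_diff Lam_has_vector_derivative
        bounded_linear.has_vector_derivative[OF mv.bounded_linear_right Lam_has_vector_derivative])
  moreover have "A *v (rho \<theta> t *v z) = rho \<theta> t *v (A *v z)" for t
    by (simp add: matrix_vector_mul_assoc rho_commute[OF assms])
  ultimately have "(?f has_vector_derivative 0) (at t)" for t by simp
  from constant_if_vector_derivative_0[of ?f, OF this, of t 0] show ?thesis by (simp add: mv.zero_right)
qed

lemma rho_fst_has_derivative:
  "((\<lambda>p::real \<times> plane. rho \<theta> (k * fst p)) has_derivative (\<lambda>h. (k * fst h) *\<^sub>R (\<theta> ** rho \<theta> (k * fst q)))) (at q)"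
  by (rule has_derivative_compose[of "\<lambda>p. k * fst p" "\<lambda>h. k * fst h"])
     (use rho_has_vector_derivative[of \<theta> "k * fst q"] in \<open>auto simp: has_vector_derivative_def intro!: derivative_eq_intros\<close>)

lemma Lam_fst_has_derivative:
  "((\<lambda>p::real \<times> plane. Lam \<theta> (fst p) z) has_derivative (\<lambda>h. fst h *\<^sub>R (rho \<theta> (fst q) *v z))) (at q)"
  by (rule has_derivative_compose[of fst fst])
     (use Lam_has_vector_derivative[of \<theta> z "fst q"] in \<open>auto simp: has_vector_derivative_def intro!: derivative_eq_intros\<close>)

text \<open>A linear control system of nilrank two. The vector \<open>\<zeta> = A\<^sup>-\<^sup>1 \<xi>\<close> is a parameter in order to avoid the inverse
  matrix.\<close>
locale lcs =
  fixes \<theta> A :: "real^2^2" and \<xi> \<eta> \<zeta> :: plane and \<alpha> :: real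
  assumes com: "A ** \<theta> = \<theta> ** A" and \<zeta>: "A *v \<zeta> = \<xi>" and det: "det A \<noteq> 0"
begin

definition b :: plane where "b = \<eta> + \<alpha> *\<^sub>R \<zeta>"

lemma vf_com: "A *v (rho \<theta> t *v x) = rho \<theta> t *v (A *v x)" "\<theta> *v (rho \<theta> t *v x) = rho \<theta> t *v (\<theta> *v x)"
  by (simp_all add: matrix_vector_mul_assoc rho_commute com)

lemma linear_vf_eq: "linear_vf \<theta> A \<xi> (t, v) = (0, A *v (v + Lam \<theta> t \<zeta>))"
  by (simp add: linear_vf_def mv.add_right matrix_Lam com \<zeta>)

text \<open>A Lie algebra of vector fields that contains the two fields of the system: \<open>linear_vf\<close> is \<open>field 1 0 0\<close> and
  \<open>left_inv_vf\<close> is \<open>field 0 \<alpha> \<eta>\<close>. In the coordinates \<open>(t, x)\<close> these are affine fields.\<close>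
definition field :: "real \<Rightarrow> real \<Rightarrow> plane \<Rightarrow> point \<Rightarrow> point" where
  "field s a c = (\<lambda>p. (a, s *\<^sub>R (A *v (snd p + Lam \<theta> (fst p) \<zeta>)) + rho \<theta> (1 * fst p) *v c))"

definition field_deriv :: "real \<Rightarrow> plane \<Rightarrow> real \<Rightarrow> point \<Rightarrow> point" where
  "field_deriv s c t = (\<lambda>h. (0, s *\<^sub>R (A *v (snd h + fst h *\<^sub>R (rho \<theta> t *v \<zeta>))) + fst h *\<^sub>R (rho \<theta> t *v (\<theta> *v c))))"

lemma field_has_derivative: "(field s a c has_derivative field_deriv s c (fst p)) (at p)"
proof -
  have "(field s a c has_derivative (\<lambda>h. (0, s *\<^sub>R (A *v (snd h + fst h *\<^sub>R (rho \<theta> (fst p) *v \<zeta>))) +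
     (rho \<theta> (1 * fst p) *v 0 + ((1 * fst h) *\<^sub>R (\<theta> ** rho \<theta> (1 * fst p))) *v c)))) (at p)"
    unfolding field_def
    by (intro has_derivative_Pair has_derivative_const has_derivative_add has_derivative_scaleR_right
        bounded_linear.has_derivative[OF mv.bounded_linear_right] mv.FDERIV rho_fst_has_derivative Lam_fst_has_derivative
        has_derivative_snd[OF has_derivative_ident] has_derivative_fst)
  then show ?thesis
    by (simp add: field_deriv_def mv.zero_right mv.scaleR_left vf_com flip: matrix_vector_mul_assoc)
qed

lemma field_bracket:
  "lie_bracket (field s a c) (field s' a' c') =
   field 0 0 (s' *\<^sub>R (A *v (c + a *\<^sub>R \<zeta>)) - s *\<^sub>R (A *v (c' + a' *\<^sub>R \<zeta>)) + \<theta> *v (a *\<^sub>R c' - a' *\<^sub>R c))"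
proof
  fix p
  have "frechet_derivative (field s a c) (at p) = field_deriv s c (fst p)" for s a c
    using frechet_derivative_at[OF field_has_derivative] by simp
  then show "lie_bracket (field s a c) (field s' a' c') p =
    field 0 0 (s' *\<^sub>R (A *v (c + a *\<^sub>R \<zeta>)) - s *\<^sub>R (A *v (c' + a' *\<^sub>R \<zeta>)) + \<theta> *v (a *\<^sub>R c' - a' *\<^sub>R c)) p"
    unfolding lie_bracket_def
    by (simp add: field_def field_deriv_def mv.add_right mv.diff_right mv.scaleR_right vf_com
        scaleR_add_right scaleR_diff_right mult.commute)
qed

lemma field_add: "(\<lambda>p. field s a c p + field s' a' c' p) = field (s + s') (a + a') (c + c')"
  by (auto simp: field_def mv.add_right scaleR_add_left)

lemma field_scale: "(\<lambda>p. k *\<^sub>R field s a c p) = field (k * s) (k * a) (k *\<^sub>R c)"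
  by (auto simp: field_def mv.scaleR_right scaleR_add_right)

text \<open>At the identity the field with parameters \<open>(s, a, c)\<close> has the value \<open>(a, c)\<close>. A proper subspace of such values that is
  preserved by the bracket contains the values of all generated fields.\<close>
lemma larc_fails:
  assumes V: "subspace V" "V \<noteq> UNIV" "(\<alpha>, \<eta>) \<in> V"
    and br: "\<And>s a c s' a' c'. (a, c) \<in> V \<Longrightarrow> (a', c') \<in> V \<Longrightarrow>
      (0, s' *\<^sub>R (A *v (c + a *\<^sub>R \<zeta>)) - s *\<^sub>R (A *v (c' + a' *\<^sub>R \<zeta>)) + \<theta> *v (a *\<^sub>R c' - a' *\<^sub>R c)) \<in> V"
  shows "\<not> LARC (linear_vf \<theta> A \<xi>) (left_inv_vf \<theta> \<alpha> \<eta>)"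
proof
  assume larc: "LARC (linear_vf \<theta> A \<xi>) (left_inv_vf \<theta> \<alpha> \<eta>)"
  have form: "\<exists>s a c. f = field s a c \<and> (a, c) \<in> V" if "f \<in> lie_generated {linear_vf \<theta> A \<xi>, left_inv_vf \<theta> \<alpha> \<eta>}" for f
    using that
  proof (induction rule: lie_generated.induct)
    case (base f)
    have X: "linear_vf \<theta> A \<xi> = field 1 0 0"
      using linear_vf_eq by (auto simp: field_def fun_eq_iff mv.zero_right)
    have Y: "left_inv_vf \<theta> \<alpha> \<eta> = field 0 \<alpha> \<eta>"
      by (auto simp: left_inv_vf_def field_def)
    have "(0, 0) \<in> V" using subspace_0[OF V(1)] by (simp add: zero_prod_def)
    then have "\<exists>s a c. linear_vf \<theta> A \<xi> = field s a c \<and> (a, c) \<in> V"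
      "\<exists>s a c. left_inv_vf \<theta> \<alpha> \<eta> = field s a c \<and> (a, c) \<in> V"
      unfolding X Y using V(3) by blast+
    then show ?case using base by auto
  next
    case (add f g)
    then obtain s a c s' a' c' where f: "f = field s a c" "(a, c) \<in> V" "g = field s' a' c'" "(a', c') \<in> V" by blast
    have "(a + a', c + c') \<in> V" using subspace_add[OF V(1) f(2,4)] by simp
    then show ?case unfolding f(1,3) field_add by blast
  next
    case (scale f k)
    then obtain s a c where f: "f = field s a c" "(a, c) \<in> V" by blast
    have "(k * a, k *\<^sub>R c) \<in> V" using subspace_scale[OF V(1) f(2), of k] by simp
    then show ?case unfolding f(1) field_scale by blast
  next
    case (bracket f g)
    then obtain s a c s' a' c' where f: "f = field s a c" "(a, c) \<in> V" "g = field s' a' c'" "(a', c') \<in> V" by blast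
    show ?case unfolding f(1,3) field_bracket using br[OF f(2,4), of s' s] by blast
  qed
  have "(\<lambda>f. f (0, 0)) ` lie_generated {linear_vf \<theta> A \<xi>, left_inv_vf \<theta> \<alpha> \<eta>} \<subseteq> V"
  proof (rule image_subsetI)
    fix f assume "f \<in> lie_generated {linear_vf \<theta> A \<xi>, left_inv_vf \<theta> \<alpha> \<eta>}"
    then obtain s a c where f: "f = field s a c" "(a, c) \<in> V" using form by blast
    then show "f (0, 0) \<in> V" by (simp add: field_def mv.zero_right)
  qed
  then have "span ((\<lambda>f. f (0, 0)) ` lie_generated {linear_vf \<theta> A \<xi>, left_inv_vf \<theta> \<alpha> \<eta>}) \<subseteq> V"
    using V(1) by (rule span_minimal)
  then show False using larc V(2) unfolding LARC_def by auto
qed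

lemma larc_imp_drift:
  assumes "LARC (linear_vf \<theta> A \<xi>) (left_inv_vf \<theta> \<alpha> \<eta>)"
  shows "\<alpha> \<noteq> 0"
proof
  assume "\<alpha> = 0"
  have "subspace {p :: point. fst p = 0}" by (auto simp: subspace_def)
  moreover have "(1, 0) \<notin> {p :: point. fst p = 0}" by simp
  ultimately show False using larc_fails[of "{p. fst p = 0}"] assms \<open>\<alpha> = 0\<close> by fastforce
qed

text \<open>If \<open>b\<close> were zero or a common eigenvector of \<open>A\<close> and \<open>\<theta>\<close>, the fields that, in the
  coordinate \<open>x\<close>, are tangent to the span of \<open>b\<close> along it would form a Lie algebra containing the system.\<close>
lemma larc_imp_cyclic:
  assumes "LARC (linear_vf \<theta> A \<xi>) (left_inv_vf \<theta> \<alpha> \<eta>)"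
  shows "wedge b (A *v b) \<noteq> 0 \<or> wedge b (\<theta> *v b) \<noteq> 0"
proof (rule ccontr)
  assume "\<not> ?thesis"
  then have w: "wedge b (A *v b) = 0" "wedge b (\<theta> *v b) = 0" by auto
  define K where "K = span {b}"
  have inv: "N *v x \<in> K" if "wedge b (N *v b) = 0" "x \<in> K" for N x
  proof -
    have "\<exists>k. N *v b = k *\<^sub>R b"
    proof (cases "b = 0")
      case False
      then show ?thesis using wedge_eq_0_imp_multiple[OF that(1)] by metis
    qed (simp add: mv.zero_right)
    then obtain k where k: "N *v b = k *\<^sub>R b" by blast
    from that(2) obtain r where r: "x = r *\<^sub>R b" unfolding K_def span_singleton by auto
    have "N *v x = (r * k) *\<^sub>R b" by (simp add: r mv.scaleR_right k)
    then show ?thesis unfolding K_def span_singleton by auto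
  qed
  have K: "subspace K" by (simp add: K_def)
  define V where "V = {p :: point. snd p + fst p *\<^sub>R \<zeta> \<in> K}"
  have "subspace V"
  proof (unfold subspace_def V_def, intro conjI allI ballI impI CollectI)
    fix p q :: point and k :: real
    assume "p \<in> {p. snd p + fst p *\<^sub>R \<zeta> \<in> K}"
    then have p: "snd p + fst p *\<^sub>R \<zeta> \<in> K" by simp
    from subspace_scale[OF K p, of k] show "snd (k *\<^sub>R p) + fst (k *\<^sub>R p) *\<^sub>R \<zeta> \<in> K" by (simp add: scaleR_add_right)
    assume "q \<in> {p. snd p + fst p *\<^sub>R \<zeta> \<in> K}"
    then have q: "snd q + fst q *\<^sub>R \<zeta> \<in> K" by simp
    from subspace_add[OF K p q] show "snd (p + q) + fst (p + q) *\<^sub>R \<zeta> \<in> K" by (simp add: scaleR_add_left algebra_simps)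
  qed (simp add: subspace_0[OF K])
  moreover have "V \<noteq> UNIV"
  proof
    assume "V = UNIV"
    then have "c \<in> K" for c
    proof -
      have "(0, c) \<in> V" using \<open>V = UNIV\<close> by simp
      then show ?thesis by (simp add: V_def)
    qed
    then have "K = UNIV" by auto
    then have "dim (UNIV :: plane set) = dim {b}" unfolding K_def by (metis dim_span)
    moreover have "dim {b} \<le> 1" by (metis dim_singleton less_or_eq_imp_le zero_le_one order_refl)
    ultimately show False by simp
  qed
  moreover have "(\<alpha>, \<eta>) \<in> V" unfolding V_def K_def using span_base[of b "{b}"] by (simp add: b_def)
  moreover have "(0, s' *\<^sub>R (A *v (c + a *\<^sub>R \<zeta>)) - s *\<^sub>R (A *v (c' + a' *\<^sub>R \<zeta>)) + \<theta> *v (a *\<^sub>R c' - a' *\<^sub>R c)) \<in> V"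
    if "(a, c) \<in> V" "(a', c') \<in> V" for s a c s' a' c'
  proof -
    have m: "c + a *\<^sub>R \<zeta> \<in> K" "c' + a' *\<^sub>R \<zeta> \<in> K" using that by (auto simp: V_def)
    have "a *\<^sub>R c' - a' *\<^sub>R c = a *\<^sub>R (c' + a' *\<^sub>R \<zeta>) - a' *\<^sub>R (c + a *\<^sub>R \<zeta>)"
      by (simp add: scaleR_add_right mult.commute)
    then have "a *\<^sub>R c' - a' *\<^sub>R c \<in> K" using m K by (simp add: subspace_diff subspace_scale)
    then show ?thesis using m K w inv by (simp add: V_def subspace_add subspace_diff subspace_scale)
  qed
  ultimately show False using larc_fails[of V] assms by blast
qed

text \<open>The coordinate \<open>x\<close>, whose fibres are the cosets; \<open>\<Phi>\<close> and \<open>\<Psi>\<close> are the change of coordinates and its inverse. The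
  factors \<open>- 1\<close> and \<open>1\<close> are written out to match the rule for the derivative of \<open>rho \<theta> (k * fst g)\<close>.\<close>
definition p :: "point \<Rightarrow> plane" where
  "p g = rho \<theta> (- 1 * fst g) *v (snd g + Lam \<theta> (fst g) \<zeta>)"

definition \<Psi> :: "point \<Rightarrow> point" where
  "\<Psi> g = (fst g, rho \<theta> (1 * fst g) *v snd g - Lam \<theta> (fst g) \<zeta>)"

definition \<Phi> :: "point \<Rightarrow> point" where "\<Phi> g = (fst g, p g)"

lemma p_simp: "p (t, v) = rho \<theta> (- t) *v (v + Lam \<theta> t \<zeta>)" by (simp add: p_def)

lemma \<Psi>\<Phi>: "\<Psi> (\<Phi> g) = g" "\<Phi> (\<Psi> g) = g"
  by (simp_all add: \<Psi>_def \<Phi>_def p_def rho_minus_vector)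

lemma p_\<Psi>: "p (\<Psi> g) = snd g" using \<Psi>\<Phi>(2)[of g] by (metis \<Phi>_def snd_conv)

definition p' :: "point \<Rightarrow> point \<Rightarrow> plane" where
  "p' g h = rho \<theta> (- fst g) *v snd h + fst h *\<^sub>R (\<zeta> - \<theta> *v p g)"

lemma p_has_derivative: "(p has_derivative p' g) (at g)"
proof -
  have "(p has_derivative (\<lambda>h. rho \<theta> (- 1 * fst g) *v (snd h + fst h *\<^sub>R (rho \<theta> (fst g) *v \<zeta>)) +
      ((- 1 * fst h) *\<^sub>R (\<theta> ** rho \<theta> (- 1 * fst g))) *v (snd g + Lam \<theta> (fst g) \<zeta>))) (at g)"
    unfolding p_def[abs_def]
    by (intro mv.FDERIV has_derivative_add rho_fst_has_derivative Lam_fst_has_derivative has_derivative_snd[OF has_derivative_ident])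
  moreover have "rho \<theta> (- 1 * fst g) *v (snd h + fst h *\<^sub>R (rho \<theta> (fst g) *v \<zeta>)) +
      ((- 1 * fst h) *\<^sub>R (\<theta> ** rho \<theta> (- 1 * fst g))) *v (snd g + Lam \<theta> (fst g) \<zeta>) = p' g h" for h
    by (simp add: p'_def p_def mv.add_right mv.scaleR_right mv.scaleR_left rho_minus_vector scaleR_diff_right flip: matrix_vector_mul_assoc)
       (simp add: mv.minus_left mv.add_right mv.scaleR_left algebra_simps flip: matrix_vector_mul_assoc)?
  ultimately show ?thesis by simp
qed

lemma p'_X: "p' g (linear_vf \<theta> A \<xi> g) = A *v p g"
  by (cases g) (simp add: p'_def linear_vf_eq p_simp vf_com)

lemma p'_Y: "p' g (left_inv_vf \<theta> \<alpha> \<eta> g) = b - (\<alpha> *\<^sub>R \<theta>) *v p g"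
  by (cases g) (simp add: p'_def left_inv_vf_def rho_minus_vector b_def scaleR_diff_right mv.scaleR_left)

lemma p'_field: "p' g (linear_vf \<theta> A \<xi> g + v *\<^sub>R left_inv_vf \<theta> \<alpha> \<eta> g) = A *v p g + v *\<^sub>R (b - (\<alpha> *\<^sub>R \<theta>) *v p g)"
proof -
  interpret bounded_linear "p' g" using p_has_derivative has_derivative_bounded_linear by blast
  show ?thesis by (simp add: add scaleR p'_X p'_Y)
qed

lemma \<Phi>_has_derivative: "(\<Phi> has_derivative (\<lambda>h. (fst h, p' g h))) (at g)"
  unfolding \<Phi>_def[abs_def] by (intro has_derivative_Pair p_has_derivative has_derivative_fst[OF has_derivative_ident])

definition \<Psi>' :: "point \<Rightarrow> point \<Rightarrow> point" where
  "\<Psi>' g h = (fst h, rho \<theta> (fst g) *v (snd h + fst h *\<^sub>R (\<theta> *v snd g - \<zeta>)))"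

lemma \<Psi>_has_derivative: "(\<Psi> has_derivative \<Psi>' g) (at g)"
proof -
  have "(\<Psi> has_derivative (\<lambda>h. (fst h, rho \<theta> (1 * fst g) *v snd h + ((1 * fst h) *\<^sub>R (\<theta> ** rho \<theta> (1 * fst g))) *v snd g
      - fst h *\<^sub>R (rho \<theta> (fst g) *v \<zeta>)))) (at g)"
    unfolding \<Psi>_def[abs_def]
    by (intro has_derivative_Pair has_derivative_diff mv.FDERIV rho_fst_has_derivative Lam_fst_has_derivative
        has_derivative_snd[OF has_derivative_ident] has_derivative_fst[OF has_derivative_ident])
  moreover have "(fst h, rho \<theta> (1 * fst g) *v snd h + ((1 * fst h) *\<^sub>R (\<theta> ** rho \<theta> (1 * fst g))) *v snd g
      - fst h *\<^sub>R (rho \<theta> (fst g) *v \<zeta>)) = \<Psi>' g h" for h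
    by (simp add: \<Psi>'_def mv.add_right mv.diff_right mv.scaleR_right mv.scaleR_left vf_com scaleR_diff_right flip: matrix_vector_mul_assoc)
  ultimately show ?thesis by simp
qed

lemma \<Psi>'_X: "\<Psi>' g (0, A *v snd g) = linear_vf \<theta> A \<xi> (\<Psi> g)"
  by (simp add: \<Psi>'_def \<Psi>_def linear_vf_eq vf_com)

lemma \<Psi>'_Y: "\<Psi>' g (\<alpha>, b - (\<alpha> *\<^sub>R \<theta>) *v snd g) = left_inv_vf \<theta> \<alpha> \<eta> (\<Psi> g)"
  by (simp add: \<Psi>'_def \<Psi>_def left_inv_vf_def b_def mv.scaleR_left scaleR_diff_right)

abbreviation model2 where "model2 \<equiv> vf_solution (\<lambda>x. A *v x) (\<lambda>x. b - (\<alpha> *\<^sub>R \<theta>) *v x)"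
abbreviation model3 where "model3 \<equiv> vf_solution (\<lambda>g. (0, A *v snd g)) (\<lambda>g. (\<alpha>, b - (\<alpha> *\<^sub>R \<theta>) *v snd g))"

lemma \<Psi>_homeo: "homeomorphic_map euclidean euclidean \<Psi>"
proof -
  have "continuous_on UNIV \<Psi>" "continuous_on UNIV \<Phi>"
    using \<Psi>_has_derivative \<Phi>_has_derivative by (auto intro!: continuous_at_imp_continuous_on has_derivative_continuous)
  then have "homeomorphic_maps euclidean euclidean \<Psi> \<Phi>" by (simp add: homeomorphic_maps_def \<Psi>\<Phi>)
  then show ?thesis by (rule homeomorphic_maps_map[THEN iffD1, THEN conjunct1])
qed

lemma conjugate3: "conjugate_systems euclidean \<Psi> model3 (vf_solution (linear_vf \<theta> A \<xi>) (left_inv_vf \<theta> \<alpha> \<eta>))"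
proof
  show "homeomorphic_map euclidean euclidean \<Psi>" by (rule \<Psi>_homeo)
  fix u c'
  show "vf_solution (linear_vf \<theta> A \<xi>) (left_inv_vf \<theta> \<alpha> \<eta>) u c' \<longleftrightarrow> (\<exists>c. c' = \<Psi> \<circ> c \<and> model3 u c)"
  proof
    assume c': "vf_solution (linear_vf \<theta> A \<xi>) (left_inv_vf \<theta> \<alpha> \<eta>) u c'"
    have "model3 u (\<Phi> \<circ> c')"
    proof (rule vf_solution_push[OF \<Phi>_has_derivative _ _ c'])
      show "(fst (linear_vf \<theta> A \<xi> g), p' g (linear_vf \<theta> A \<xi> g)) = (0, A *v snd (\<Phi> g))" for g
        by (simp add: p'_X \<Phi>_def) (cases g, simp add: linear_vf_def)
      show "(fst (left_inv_vf \<theta> \<alpha> \<eta> g), p' g (left_inv_vf \<theta> \<alpha> \<eta> g)) = (\<alpha>, b - (\<alpha> *\<^sub>R \<theta>) *v snd (\<Phi> g))" for g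
        by (simp add: p'_Y \<Phi>_def) (cases g, simp add: left_inv_vf_def)
    qed
    moreover have "c' = \<Psi> \<circ> (\<Phi> \<circ> c')" by (simp add: fun_eq_iff \<Psi>\<Phi>)
    ultimately show "\<exists>c. c' = \<Psi> \<circ> c \<and> model3 u c" by blast
  next
    assume "\<exists>c. c' = \<Psi> \<circ> c \<and> model3 u c"
    then obtain c where "c' = \<Psi> \<circ> c" "model3 u c" by blast
    then show "vf_solution (linear_vf \<theta> A \<xi>) (left_inv_vf \<theta> \<alpha> \<eta>) u c'"
      using vf_solution_push[OF \<Psi>_has_derivative \<Psi>'_X \<Psi>'_Y] by blast
  qed
qed

abbreviation G0 where "G0 \<equiv> {g. linear_vf \<theta> A \<xi> g = 0}"

lemma G0_iff: "(t, v) \<in> G0 \<longleftrightarrow> v = - Lam \<theta> t \<zeta>"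
proof -
  have "A *v (v + Lam \<theta> t \<zeta>) = 0 \<longleftrightarrow> v + Lam \<theta> t \<zeta> = 0"
    using matrix_plane_injective[OF det, of "v + Lam \<theta> t \<zeta>" 0] by (auto simp: mv.zero_right)
  then show ?thesis by (simp add: linear_vf_eq zero_prod_def add_eq_0_iff2)
qed

definition q :: "plane \<Rightarrow> point set" where "q x = {g. p g = x}"

text \<open>The left translations by \<open>G0\<close> are the translations of \<open>t\<close> in the coordinates \<open>(t, x)\<close>.\<close>
lemma coset_eq: "coset_proj \<theta> G0 g = q (p g)"
proof -
  obtain t v where g: "g = (t, v)" by (metis surj_pair)
  have "p (s + t, - Lam \<theta> s \<zeta> + rho \<theta> s *v v) = p g" for s
  proof -
    have "Lam \<theta> (s + t) \<zeta> = Lam \<theta> s \<zeta> + rho \<theta> s *v Lam \<theta> t \<zeta>" using Lam_add[of \<theta> t s] by (simp add: add.commute)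
    moreover have "rho \<theta> (- (s + t)) = rho \<theta> (- t) ** rho \<theta> (- s)" using rho_add[of \<theta> "- t" "- s"] by (simp add: add.commute)
    ultimately show ?thesis by (simp add: g p_simp rho_minus_vector flip: matrix_vector_mul_assoc mv.add_right)
  qed
  moreover have "\<exists>s. g' = (s + t, - Lam \<theta> s \<zeta> + rho \<theta> s *v v)" if "p g' = p g" for g'
  proof -
    obtain t' v' where g': "g' = (t', v')" by (metis surj_pair)
    define s where "s = t' - t"
    have t': "t' = s + t" by (simp add: s_def)
    have 1: "Lam \<theta> (s + t) \<zeta> = Lam \<theta> s \<zeta> + rho \<theta> s *v Lam \<theta> t \<zeta>" using Lam_add[of \<theta> t s] by (simp add: add.commute)
    have "v' = rho \<theta> t' *v p g' - Lam \<theta> t' \<zeta>" by (simp add: g' p_simp rho_minus_vector)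
    also have "\<dots> = rho \<theta> (s + t) *v (rho \<theta> (- t) *v (v + Lam \<theta> t \<zeta>)) - Lam \<theta> (s + t) \<zeta>" by (simp add: that g p_simp t')
    also have "\<dots> = rho \<theta> s *v (v + Lam \<theta> t \<zeta>) - Lam \<theta> (s + t) \<zeta>"
      by (simp add: rho_add rho_minus_vector flip: matrix_vector_mul_assoc)
    also have "\<dots> = - Lam \<theta> s \<zeta> + rho \<theta> s *v v" by (simp add: 1 mv.add_right)
    finally show ?thesis using g' t' by blast
  qed
  moreover have "coset_proj \<theta> G0 g = {(s + t, - Lam \<theta> s \<zeta> + rho \<theta> s *v v) |s. True}"
    using G0_iff by (auto simp: coset_proj_def r_coset_def G_def g)
  ultimately show ?thesis unfolding q_def by auto
qed

lemma p_0: "p (0, x) = x" by (simp add: p_simp)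

lemma inj_q: "q x = q y \<longleftrightarrow> x = y"
proof
  assume "q x = q y"
  moreover have "(0, x) \<in> q x" by (simp add: q_def p_0)
  ultimately show "x = y" by (simp add: q_def p_0)
qed simp

lemma coset_vimage: "coset_proj \<theta> G0 -` (q ` V) = p -` V"
  by (auto simp: coset_eq inj_q)

lemma rcosets_eq: "rcosets\<^bsub>G \<theta>\<^esub> G0 = range q"
proof -
  have "rcosets\<^bsub>G \<theta>\<^esub> G0 = range (coset_proj \<theta> G0)" by (auto simp: RCOSETS_def coset_proj_def G_def)
  also have "coset_proj \<theta> G0 = q \<circ> p" by (simp add: fun_eq_iff coset_eq)
  also have "range (q \<circ> p) = range q" using surjI[of p "\<lambda>x. (0, x)", OF p_0] by (metis fun.set_map image_comp)
  finally show ?thesis .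
qed

lemma continuous_p: "continuous_on UNIV p"
  using p_has_derivative by (auto intro!: continuous_at_imp_continuous_on has_derivative_continuous)

lemma open_vimage_p: "open (p -` V) \<longleftrightarrow> open V"
proof
  assume "open (p -` V)"
  moreover have "V = (\<lambda>x. (0, x)) -` (p -` V)" by (auto simp: p_0)
  moreover have "continuous_on UNIV (\<lambda>x :: plane. (0 :: real, x))" by (intro continuous_intros)
  ultimately show "open V" using open_vimage by metis
qed (rule open_vimage[OF _ continuous_p])

lemma openin_image_q: "openin (coset_topology \<theta> G0) (q ` V) \<longleftrightarrow> open V"
  by (simp add: openin_coset_topology rcosets_eq coset_vimage open_vimage_p image_mono)

lemma q_homeo: "homeomorphic_map euclidean (coset_topology \<theta> G0) q"
proof -
  have "open_map euclidean (coset_topology \<theta> G0) q" by (simp add: open_map_def openin_image_q)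
  moreover have "continuous_map euclidean (coset_topology \<theta> G0) q"
    unfolding continuous_map_def
  proof (intro conjI allI impI)
    fix U assume U: "openin (coset_topology \<theta> G0) U"
    then have "U = q ` (q -` U)" using openin_subset[OF U] by (auto simp: topspace_coset_topology rcosets_eq)
    then have "open (q -` U)" using U openin_image_q by metis
    then show "openin euclidean {x \<in> topspace euclidean. q x \<in> U}" by (simp add: vimage_def)
  qed (auto simp: topspace_coset_topology rcosets_eq)
  ultimately show ?thesis
    by (intro bijective_open_imp_homeomorphic_map) (auto simp: topspace_coset_topology rcosets_eq inj_on_def inj_q)
qed

text \<open>The components of the coordinate \<open>x\<close>, as functions on the space of cosets, are admissible test functions.\<close>
lemma induced_solution_imp_planar:
  assumes c': "induced_solution \<theta> G0 (linear_vf \<theta> A \<xi>) (left_inv_vf \<theta> \<alpha> \<eta>) u c'"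
  shows "\<exists>c. c' = q \<circ> c \<and> model2 u c"
proof -
  have cont: "continuous_map euclideanreal (coset_topology \<theta> G0) c'" using c' by (simp add: induced_solution_def)
  obtain r where r: "homeomorphic_maps euclidean (coset_topology \<theta> G0) q r"
    using q_homeo homeomorphic_map_maps by blast
  have rq: "r (q x) = x" for x using r by (simp add: homeomorphic_maps_def)
  have "c' s \<in> topspace (coset_topology \<theta> G0)" for s
    using continuous_map_image_subset_topspace[OF cont] by auto
  then have qr: "q (r (c' s)) = c' s" for s using r by (simp add: homeomorphic_maps_def)
  define c where "c = r \<circ> c'"
  have c: "c' = q \<circ> c" by (simp add: c_def fun_eq_iff qr)
  have "model2 u c"
    unfolding vf_solution_def
  proof (intro conjI allI impI)
    have "continuous_map (coset_topology \<theta> G0) euclidean r" using r by (simp add: homeomorphic_maps_def)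
    then have "continuous_map euclideanreal euclidean c" unfolding c_def by (rule continuous_map_compose[OF cont])
    then show "continuous_on UNIV c" by simp
    fix s assume lc: "locally_constant_at u s"
    let ?d = "A *v c s + u s *\<^sub>R (b - (\<alpha> *\<^sub>R \<theta>) *v c s)"
    have comp: "((\<lambda>s. c s $ i) has_real_derivative ?d $ i) (at s)" for i
    proof -
      have d: "((\<lambda>g. p g $ i) has_derivative (\<lambda>h. p' g h $ i)) (at g)" for g
        by (rule bounded_linear.has_derivative[OF bounded_linear_vec_nth p_has_derivative])
      have fp: "(\<lambda>C. r C $ i) \<circ> coset_proj \<theta> G0 = (\<lambda>g. p g $ i)" by (simp add: fun_eq_iff coset_eq rq)
      have g: "coset_proj \<theta> G0 (0, c s) = c' s" by (simp add: coset_eq p_0 c)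
      have diff: "\<forall>g. ((\<lambda>C. r C $ i) \<circ> coset_proj \<theta> G0) differentiable (at g)"
        unfolding fp differentiable_def using d by blast
      have "(((\<lambda>C. r C $ i) \<circ> c') has_real_derivative
          frechet_derivative ((\<lambda>C. r C $ i) \<circ> coset_proj \<theta> G0) (at (0, c s))
            (linear_vf \<theta> A \<xi> (0, c s) + u s *\<^sub>R left_inv_vf \<theta> \<alpha> \<eta> (0, c s))) (at s)"
        using c' lc diff g unfolding induced_solution_def by blast
      moreover have "frechet_derivative ((\<lambda>C. r C $ i) \<circ> coset_proj \<theta> G0) (at (0, c s)) = (\<lambda>h. p' (0, c s) h $ i)"
        unfolding fp using frechet_derivative_at[OF d] by simp
      moreover have "(\<lambda>C. r C $ i) \<circ> c' = (\<lambda>s. c s $ i)" by (simp add: c_def fun_eq_iff)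
      ultimately show ?thesis using p'_field[of "(0, c s)" "u s"] by (simp add: p_0)
    qed
    show "(c has_vector_derivative ?d) (at s)"
      by (rule has_vector_derivative_vecI[OF comp])
  qed
  then show ?thesis using c by blast
qed

text \<open>A test function \<open>f\<close> satisfies \<open>f \<circ> \<pi> = (f \<circ> q) \<circ> p\<close>, so that both derivatives are values of the derivative of \<open>f \<circ> q\<close>;
  the projection of the vector field along \<open>p\<close> does not depend on the representative of the coset.\<close>
lemma planar_imp_induced_solution:
  assumes c: "model2 u c"
  shows "induced_solution \<theta> G0 (linear_vf \<theta> A \<xi>) (left_inv_vf \<theta> \<alpha> \<eta>) u (q \<circ> c)"
  unfolding induced_solution_def
proof (intro conjI allI impI)
  have "continuous_map euclideanreal euclidean c" using c by (simp add: vf_solution_def)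
  moreover have "continuous_map euclidean (coset_topology \<theta> G0) q"
    using q_homeo homeomorphic_imp_continuous_map by blast
  ultimately show "continuous_map euclideanreal (coset_topology \<theta> G0) (q \<circ> c)" by (rule continuous_map_compose)
  fix s and f :: "point set \<Rightarrow> real" and g
  assume lc: "locally_constant_at u s" and f: "\<forall>g. (f \<circ> coset_proj \<theta> G0) differentiable (at g)"
    and g: "coset_proj \<theta> G0 g = (q \<circ> c) s"
  have pg: "p g = c s" using g by (simp add: coset_eq inj_q)
  obtain F where F: "((f \<circ> coset_proj \<theta> G0) has_derivative F) (at (0, c s))" using f unfolding differentiable_def by blast
  have j: "((\<lambda>x :: plane. (0 :: real, x)) has_derivative (\<lambda>h. (0, h))) (at (c s))" by (auto intro!: derivative_eq_intros)
  have fq: "((\<lambda>x. f (q x)) has_derivative (\<lambda>h. F (0, h))) (at (c s))"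
    using has_derivative_compose[OF j F] by (simp add: o_def coset_eq p_0)
  have "((\<lambda>g. f (q (p g))) has_derivative (\<lambda>h. F (0, p' g h))) (at g)"
    by (rule has_derivative_compose[OF p_has_derivative]) (simp add: pg fq)
  then have "((f \<circ> coset_proj \<theta> G0) has_derivative (\<lambda>h. F (0, p' g h))) (at g)" by (simp add: o_def coset_eq)
  from frechet_derivative_at[OF this]
  have fd: "frechet_derivative (f \<circ> coset_proj \<theta> G0) (at g) = (\<lambda>h. F (0, p' g h))" by simp
  have "(c has_vector_derivative A *v c s + u s *\<^sub>R (b - (\<alpha> *\<^sub>R \<theta>) *v c s)) (at s)"
    using c lc by (simp add: vf_solution_def)
  then have "(c has_derivative (\<lambda>h. h *\<^sub>R (A *v c s + u s *\<^sub>R (b - (\<alpha> *\<^sub>R \<theta>) *v c s)))) (at s)"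
    by (simp add: has_vector_derivative_def)
  from has_derivative_compose[OF this fq]
  have d: "((f \<circ> (q \<circ> c)) has_derivative (\<lambda>h. F (0, h *\<^sub>R (A *v c s + u s *\<^sub>R (b - (\<alpha> *\<^sub>R \<theta>) *v c s))))) (at s)"
    by (simp add: o_def)
  interpret F: bounded_linear F using F has_derivative_bounded_linear by blast
  have "F (0, h *\<^sub>R x) = F (0, x) * h" for h x using F.scaleR[of h "(0, x)"] by simp
  with d show "((f \<circ> (q \<circ> c)) has_real_derivative
      frechet_derivative (f \<circ> coset_proj \<theta> G0) (at g) (linear_vf \<theta> A \<xi> g + u s *\<^sub>R left_inv_vf \<theta> \<alpha> \<eta> g)) (at s)"
    unfolding fd p'_field has_field_derivative_def by (simp add: pg mult_commute_abs)
qed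

lemma conjugate2: "conjugate_systems (coset_topology \<theta> G0) q model2
    (induced_solution \<theta> G0 (linear_vf \<theta> A \<xi>) (left_inv_vf \<theta> \<alpha> \<eta>))"
  using q_homeo induced_solution_imp_planar planar_imp_induced_solution by unfold_locales blast+

end

section \<open>The control set of the linear control system\<close>

theorem theorem3p9:
  fixes \<theta> A :: "real^2^2" and \<xi> \<eta> :: "real^2" and \<alpha> um up :: real
  defines "X \<equiv> linear_vf \<theta> A \<xi>"
    and "Y \<equiv> left_inv_vf \<theta> \<alpha> \<eta>"
    and "\<Omega> \<equiv> {um..up}"
  defines "G0 \<equiv> {g. X g = 0}"
  defines "\<pi> \<equiv> coset_proj \<theta> G0"
    and "Q \<equiv> coset_topology \<theta> G0"
  defines "\<Omega>hat \<equiv> {u \<in> interior \<Omega>. det (A - (\<alpha> * u) *\<^sub>R \<theta>) \<noteq> 0}"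
  defines "I0 \<equiv> connected_component_set \<Omega>hat 0"
  assumes "admissible_theta \<theta>"
    and "A ** \<theta> = \<theta> ** A"
    and "um < 0" and "0 < up"
    and "nilrank A = 2"
    and "LARC X Y"
  shows "\<exists>C D.
    (\<forall>C'. control_set euclidean \<Omega> (vf_solution X Y) C' \<and> interior C' \<noteq> {} \<longleftrightarrow> C' = C) \<and>
    (\<forall>D'. control_set Q \<Omega> (induced_solution \<theta> G0 X Y) D' \<and> Q interior_of D' \<noteq> {} \<and>
          \<pi> \<one>\<^bsub>G \<theta>\<^esub> \<in> Q closure_of D' \<longleftrightarrow> D' = D) \<and>
    C = \<pi> -` D \<and>
    (det A > 0 \<and> (\<forall>u\<in>I0. trace (A - (\<alpha> * u) *\<^sub>R \<theta>) > 0) \<longrightarrow> open C) \<and>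
    (det A > 0 \<and> (\<forall>u\<in>I0. trace (A - (\<alpha> * u) *\<^sub>R \<theta>) < 0) \<longrightarrow> closed C) \<and>
    (det A > 0 \<and> (\<exists>u\<in>I0. trace (A - (\<alpha> * u) *\<^sub>R \<theta>) = 0) \<longrightarrow> C = UNIV)"
proof -
  have det: "det A \<noteq> 0"
    using \<open>nilrank A = 2\<close> by (simp add: nilrank_def det_eq_0_rank)
  define \<zeta> where "\<zeta> = (1 / det A) *\<^sub>R (trace A *\<^sub>R \<xi> - A *v \<xi>)"
  have \<zeta>: "A *v \<zeta> = \<xi>"
    using det by (simp add: \<zeta>_def mv.scaleR_right mv.diff_right cayley_hamilton_plane)
  interpret L: lcs \<theta> A \<xi> \<eta> \<zeta> \<alpha>
    by unfold_locales (fact \<open>A ** \<theta> = \<theta> ** A\<close> \<zeta> det)+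
  have larc: "LARC (linear_vf \<theta> A \<xi>) (left_inv_vf \<theta> \<alpha> \<eta>)"
    using \<open>LARC X Y\<close> unfolding X_def Y_def .
  have \<alpha>: "\<alpha> \<noteq> 0" by (rule L.larc_imp_drift[OF larc])
  interpret S: plane_system_lift A "\<alpha> *\<^sub>R \<theta>" L.b um up \<alpha>
  proof
    show "A ** (\<alpha> *\<^sub>R \<theta>) = (\<alpha> *\<^sub>R \<theta>) ** A"
      using \<open>A ** \<theta> = \<theta> ** A\<close> by (simp add: mm.scaleR_left mm.scaleR_right)
    show "wedge L.b (A *v L.b) \<noteq> 0 \<or> wedge L.b ((\<alpha> *\<^sub>R \<theta>) *v L.b) \<noteq> 0"
      using L.larc_imp_cyclic[OF larc] \<alpha> by (simp add: mv.scaleR_left wedge_simps)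
  qed (fact \<open>um < 0\<close> \<open>0 < up\<close> det \<alpha>)+
  define C where "C = L.\<Psi> ` (UNIV \<times> S.region)"
  define D where "D = L.q ` S.region"
  have C_eq: "C = L.p -` S.region"
  proof (intro equalityI subsetI)
    fix g assume "g \<in> L.p -` S.region"
    then have "L.\<Phi> g \<in> UNIV \<times> S.region" by (simp add: L.\<Phi>_def)
    then have "L.\<Psi> (L.\<Phi> g) \<in> C" unfolding C_def by (rule imageI)
    then show "g \<in> C" by (simp only: L.\<Psi>\<Phi>)
  qed (auto simp: C_def L.p_\<Psi>)
  have \<pi>: "\<pi> g = L.q (L.p g)" for g
    unfolding \<pi>_def G0_def X_def by (rule L.coset_eq)
  have unit: "\<pi> \<one>\<^bsub>G \<theta>\<^esub> = L.q 0"
    unfolding \<pi> by (simp add: G_def L.p_0)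
  have M: "A - (\<alpha> * u) *\<^sub>R \<theta> = S.M u" for u
    by (simp add: S.M_def mult.commute)
  have uniqueC: "control_set euclidean \<Omega> (vf_solution X Y) C' \<and> interior C' \<noteq> {} \<longleftrightarrow> C' = C" for C'
  proof -
    have "interior (UNIV \<times> S.region) \<noteq> ({} :: point set)"
      using S.region_interior by (auto simp: interior_Times)
    then have "control_set euclidean \<Omega> S.sol3 E \<and> interior E \<noteq> {} \<and> True \<longleftrightarrow> E = UNIV \<times> S.region" for E
      using S.lifted_control_set_unique[of E] S.control_set_lifted_region unfolding \<Omega>_def by auto
    from conjugate_systems.unique_control_set_image[OF L.conjugate3 this, of "\<lambda>_. True" C']
    show ?thesis unfolding X_def Y_def C_def by simp
  qed
  have uniqueD: "control_set Q \<Omega> (induced_solution \<theta> G0 X Y) D' \<and> Q interior_of D' \<noteq> {} \<and>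
      \<pi> \<one>\<^bsub>G \<theta>\<^esub> \<in> Q closure_of D' \<longleftrightarrow> D' = D" for D'
  proof -
    have 1: "control_set euclidean \<Omega> S.sol2 E \<and> interior E \<noteq> {} \<and> 0 \<in> closure E \<longleftrightarrow> E = S.region" for E
      using S.planar_control_set_unique[of E] S.control_set_region S.region_interior S.zero_in_closure_region
      unfolding \<Omega>_def by auto
    have 2: "L.q 0 \<in> coset_topology \<theta> L.G0 closure_of (L.q ` E) \<longleftrightarrow> 0 \<in> closure E" for E
      using homeomorphic_map_closure_of[OF L.q_homeo, of E] by (auto simp: L.inj_q)
    from conjugate_systems.unique_control_set_image[OF L.conjugate2 1 2, of D']
    show ?thesis unfolding unit Q_def G0_def X_def Y_def D_def .
  qed
  have CD: "C = \<pi> -` D"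
    unfolding C_eq D_def by (auto simp: \<pi> L.inj_q)
  have "0 \<in> \<Omega>hat"
    using \<open>um < 0\<close> \<open>0 < up\<close> det by (simp add: \<Omega>hat_def \<Omega>_def)
  then have I0: "0 \<in> I0" by (simp add: I0_def)
  have sub: "I0 \<subseteq> \<Omega>hat" unfolding I0_def by (rule connected_component_subset)
  have det_pos: "det (S.M u) > 0" if "det A > 0" "u \<in> I0" for u
  proof (rule ccontr)
    assume neg: "\<not> det (S.M u) > 0"
    have "continuous_on I0 (\<lambda>u. det (S.M u))"
      using S.trace_det_M_tendsto(1) by (simp add: continuous_at_imp_continuous_on isCont_def)
    moreover have "connected I0" unfolding I0_def by (rule connected_connected_component)
    ultimately have "connected ((\<lambda>u. det (S.M u)) ` I0)" by (rule connected_continuous_image)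
    from connectedD_interval[OF this imageI[OF that(2)] imageI[OF I0], of 0]
    have "0 \<in> (\<lambda>u. det (S.M u)) ` I0" using neg that(1) by simp
    then show False using sub by (auto simp: \<Omega>hat_def M)
  qed
  have opn: "open C" if "det A > 0" "\<forall>u\<in>I0. trace (A - (\<alpha> * u) *\<^sub>R \<theta>) > 0"
  proof -
    have "trace A > 0" using bspec[OF that(2) I0] by simp
    then show ?thesis
      unfolding C_eq by (rule open_vimage[OF S.region_open_if_unstable[OF that(1)] L.continuous_p])
  qed
  have cls: "closed C" if "det A > 0" "\<forall>u\<in>I0. trace (A - (\<alpha> * u) *\<^sub>R \<theta>) < 0"
  proof -
    have "trace A < 0" using bspec[OF that(2) I0] by simp
    then show ?thesis
      unfolding C_eq by (rule closed_vimage[OF S.region_closed_if_stable[OF that(1)] L.continuous_p])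
  qed
  have all: "C = UNIV" if "det A > 0" "\<exists>u\<in>I0. trace (A - (\<alpha> * u) *\<^sub>R \<theta>) = 0"
  proof -
    from that(2) obtain u where u: "u \<in> I0" "trace (S.M u) = 0" by (auto simp: M)
    then have "u \<in> {um<..<up}" using sub by (auto simp: \<Omega>hat_def \<Omega>_def)
    then have "S.region = UNIV" using S.region_UNIV det_pos[OF that(1) u(1)] u(2) by blast
    then show ?thesis by (simp add: C_eq)
  qed
  show ?thesis
    using uniqueC uniqueD CD opn cls all by (intro exI[of _ C] exI[of _ D]) blast
qed

end
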